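(* Let $G=(V,E)$ be a finite connected graph with $|V|\ge 3$, $x_0\in V$, $\delta>0$. The empirical measure process $(L^n)_{n\ge1}$ of the $\delta$-once-reinforced random walk on $G$ started at $x_0$ satisfies a large deviation principle with the good rate function $$I_\delta(\nu)=\inf_{(\nu_k,r_k,E_k,q_k)_{k}\in\mathscr{A}(\nu)}\ \sum_{k=1}^{\mathfrak{b}} r_k\int_V R\big(q_k(x,\cdot)\,\|\,p_{E_k}(x,\cdot)\big)\,\nu_k(dx),\qquad \nu\in\mathscr{P}(V).$$ Moreover, for any $\delta>0$, $I_\delta(\nu)<\infty$ if and only if $\nu$ is an invariant distribution for some $q\in\mathscr{T}_G$.
   Context: Graphs are undirected and simple; an edge is a set $uv=\{u,v\}$, $u\sim v$ means adjacency, and $\mathfrak{b}=|E|$. The $\delta$-once-reinforced random walk ($\delta$-ORRW) started at $x_0$ is the $V$-valued process with $X_0=x_0$ and, with $\mathscr{F}_n=\sigma(X_0,\dots,X_n)$, $\mathbb{P}(X_{n+1}=u\mid X_n=v,\mathscr{F}_n)=w_n(uv)/\sum_{u'\sim v}w_n(u'v)$ if $u\sim v$ and $0$ otherwise, where $w_n(e)=\delta$ if $e\in\{X_iX_{i+1}:0\le i<n\}$ and $w_n(e)=1$ otherwise. $L^n=\frac1n\sum_{i=0}^{n-1}\delta_{X_i}$ (Dirac masses). $\mathscr{P}(V)$ is the set of probability measures on $V$ with the weak topology. A good rate function is lower semicontinuous, $[0,\infty]$-valued, with compact level sets, and not identically $\infty$. $(\xi_n)$ satisfies the large deviation principle with rate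 function $I$ if $\limsup_n\frac1n\log\mathbb{P}(\xi_n\in C)\le-\inf_C I$ for closed $C$ and $\liminf_n\frac1n\log\mathbb{P}(\xi_n\in O)\ge-\inf_O I$ for open $O$. Relative entropy: $R(\gamma\|\rho)=\int\frac{d\gamma}{d\rho}\log\frac{d\gamma}{d\rho}\,d\rho$ if $\gamma\ll\rho$, and $\infty$ otherwise. The infimum over the empty set is $\infty$. $\mathscr{E}$ is the set of sequences $(E_k)_{1\le k\le\mathfrak{b}}$ of subsets of $E$ with: $E_k\subset E_{k+1}$ for $1\le k<\mathfrak b$; $|E_k|=k$; $E_1=\{x_0v\}$ for some $v\in V$; and the unique edge of $E_{k+1}\setminus E_k$ is adjacent to (shares a vertex with) some edge of $E_k$. $V_k$ denotes the set of endpoints of edges in $E_k$. For $E'\subseteq E$: $p_{E'}(x,y)=\dfrac{g(xy)}{\sum_{z\sim x}g(xz)}$ if $y\sim x$ and $0$ otherwise, where $g(e)=\delta$ if $e\in E'$ and $g(e)=1$ if $e\notin E'$. For $E'\subseteq E$ with set of endpoints $V'$, $\mathscr{T}(E')$ is the set of transition probabilities $q:V'\times V\to[0,1]$ with $\sum_{z\in V}q(x,z)=1$ for each $x$ and $q(x,y)>0$ only if $xy\in E'$. $\mathscr{T}_G:=\mathscr{T}(E)$. For $\nu\in\mathscr{P}(V)$, $\mathscr{A}(\nu)$ is the set of families $(\nu_k,r_k,E_k,q_k)_{1\le k\le\mathfrak{b}}$ with $(E_k)_k\in\mathscr{E}$; $r_k\ge0$, $\sum_{k}r_k=1$; $q_k\in\mathscr{T}(E_k)$;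 $\nu_k\in\mathscr{P}(V_k)$ (viewed as a measure on $V$) with $\nu_kq_k=\nu_k$; and $\sum_{k}r_k\nu_k=\nu$. *)

theory Defs
  imports "HOL-Probability.Probability"
begin

section \<open>Graphs\<close>

text \<open>The vertex set is the universe of a type \<open>'v\<close> of class \<^class>\<open>finite\<close>; a graph is given by its
  edge set, a set of two-element subsets.\<close>

definition simple_graph :: "'v set set \<Rightarrow> bool" where
  "simple_graph E \<longleftrightarrow> (\<forall>e\<in>E. card e = 2)"

definition connected_graph :: "'v set set \<Rightarrow> bool" where
  "connected_graph E \<longleftrightarrow> (\<forall>u v. (u, v) \<in> {(x, y). {x, y} \<in> E}\<^sup>*)"

section \<open>Once-reinforced random walk\<close>

definition edge_weight :: "real \<Rightarrow> 'v set set \<Rightarrow> 'v set \<Rightarrow> real" where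
  "edge_weight \<delta> E' e = (if e \<in> E' then \<delta> else 1)"

definition step_prob :: "'v::finite set set \<Rightarrow> real \<Rightarrow> 'v set set \<Rightarrow> 'v \<Rightarrow> 'v \<Rightarrow> real" where
  "step_prob E \<delta> E' x y =
     (if {x, y} \<in> E
      then edge_weight \<delta> E' {x, y} / (\<Sum>z | {x, z} \<in> E. edge_weight \<delta> E' {x, z})
      else 0)"

definition traversed_edges :: "(nat \<Rightarrow> 'w \<Rightarrow> 'v) \<Rightarrow> nat \<Rightarrow> 'w \<Rightarrow> 'v set set" where
  "traversed_edges X n \<omega> = {{X i \<omega>, X (Suc i) \<omega>} | i. i < n}"

definition history_algebra :: "'w measure \<Rightarrow> (nat \<Rightarrow> 'w \<Rightarrow> 'v) \<Rightarrow> nat \<Rightarrow> 'w measure" where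
  "history_algebra M X n = sigma (space M) {X i -` A \<inter> space M | i A. i \<le> n}"

definition once_reinforced_walk ::
    "'v::finite set set \<Rightarrow> real \<Rightarrow> 'v \<Rightarrow> 'w measure \<Rightarrow> (nat \<Rightarrow> 'w \<Rightarrow> 'v) \<Rightarrow> bool" where
  "once_reinforced_walk E \<delta> x0 M X \<longleftrightarrow>
     prob_space M \<and>
     (\<forall>n. X n \<in> measurable M (count_space UNIV)) \<and>
     (AE \<omega> in M. X 0 \<omega> = x0) \<and>
     (\<forall>n u. AE \<omega> in M.
        real_cond_exp M (history_algebra M X n) (indicator {\<omega>'\<in>space M. X (Suc n) \<omega>' = u}) \<omega> =
        step_prob E \<delta> (traversed_edges X n \<omega>) (X n \<omega>) u)"

text \<open>The law of \<open>X\<^sub>i\<close> for an index \<open>i\<close> uniform in \<open>{0..<n}\<close>, i.e. the average of the Dirac masses at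
  \<open>X\<^sub>0, \<dots>, X\<^sub>n\<^sub>-\<^sub>1\<close> (see \<open>pmf_empirical_measure\<close>). The value at \<open>n = 0\<close> is irrelevant.\<close>

definition empirical_measure :: "(nat \<Rightarrow> 'w \<Rightarrow> 'v) \<Rightarrow> nat \<Rightarrow> 'w \<Rightarrow> 'v pmf" where
  "empirical_measure X n \<omega> = map_pmf (\<lambda>i. X i \<omega>) (pmf_of_set {..<n})"

lemma pmf_empirical_measure:
  assumes "n \<ge> 1"
  shows "pmf (empirical_measure X n \<omega>) x = 1 / real n * (\<Sum>i<n. pmf (return_pmf (X i \<omega>)) x)"
proof -
  have ne: "{..<n} \<noteq> {}" using assms by (simp add: lessThan_empty_iff)
  have "pmf (empirical_measure X n \<omega>) x = real (card {i\<in>{..<n}. X i \<omega> = x}) / real n"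
    using ne unfolding empirical_measure_def
    by (simp add: pmf_map measure_pmf_of_set vimage_def Int_def)
  also have "real (card {i\<in>{..<n}. X i \<omega> = x}) = (\<Sum>i<n. if X i \<omega> = x then 1 else 0)"
    by (simp add: sum.If_cases Int_def)
  also have "\<dots> = (\<Sum>i<n. pmf (return_pmf (X i \<omega>)) x)"
    by (rule sum.cong) (auto simp: indicator_def)
  finally show ?thesis by simp
qed

section \<open>Large deviation principle\<close>

text \<open>On the finite discrete space \<open>'v\<close> every real function is bounded and continuous, so the weak
  topology is the coarsest one making all maps \<open>\<mu> \<mapsto> \<integral>f d\<mu>\<close> continuous.\<close>

definition weak_topology :: "'v::finite pmf topology" where
  "weak_topology =
     pullback_topology UNIV (\<lambda>\<mu> f. measure_pmf.expectation \<mu> f) (powertop_real UNIV)"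

text \<open>The second conjunct is lower semicontinuity.\<close>

definition good_rate_function :: "'b topology \<Rightarrow> ('b \<Rightarrow> ereal) \<Rightarrow> bool" where
  "good_rate_function T I \<longleftrightarrow>
     (\<forall>x\<in>topspace T. 0 \<le> I x) \<and>
     (\<forall>a::real. openin T {x\<in>topspace T. ereal a < I x}) \<and>
     (\<forall>a::real. compactin T {x\<in>topspace T. I x \<le> ereal a}) \<and>
     (\<exists>x\<in>topspace T. I x \<noteq> \<infinity>)"

text \<open>Logarithm of a probability with \<open>log 0 = -\<infinity>\<close> (the library's real \<^const>\<open>ln\<close> has \<open>ln 0 = 0\<close>).\<close>

definition log_prob :: "real \<Rightarrow> ereal" where
  "log_prob p = (if p = 0 then -\<infinity> else ereal (ln p))"

text \<open>The events are meant to be measurable; they are for the empirical measures of a walk on a finite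
  set, which take only finitely many values for each \<open>n\<close>.\<close>

definition large_deviation_principle ::
    "'w measure \<Rightarrow> 'b topology \<Rightarrow> (nat \<Rightarrow> 'w \<Rightarrow> 'b) \<Rightarrow> ('b \<Rightarrow> ereal) \<Rightarrow> bool" where
  "large_deviation_principle M T \<xi> I \<longleftrightarrow>
     (\<forall>C. closedin T C \<longrightarrow>
        limsup (\<lambda>n. ereal (1 / real n) * log_prob (measure M {\<omega>\<in>space M. \<xi> n \<omega> \<in> C}))
          \<le> - (INF x\<in>C. I x)) \<and>
     (\<forall>U. openin T U \<longrightarrow>
        liminf (\<lambda>n. ereal (1 / real n) * log_prob (measure M {\<omega>\<in>space M. \<xi> n \<omega> \<in> U}))
          \<ge> - (INF x\<in>U. I x))"

section \<open>The rate function\<close>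

text \<open>Used on finite types only, where the real-valued integral always exists.\<close>

definition relative_entropy :: "'v::finite pmf \<Rightarrow> 'v pmf \<Rightarrow> ereal" where
  "relative_entropy \<gamma> \<rho> =
     (if absolutely_continuous (measure_pmf \<rho>) (measure_pmf \<gamma>)
      then ereal (\<integral>x. enn2real (RN_deriv (measure_pmf \<rho>) (measure_pmf \<gamma>) x) *
                     ln (enn2real (RN_deriv (measure_pmf \<rho>) (measure_pmf \<gamma>) x)) \<partial>measure_pmf \<rho>)
      else \<infinity>)"

text \<open>The probability measure \<open>p\<^sub>E\<^sub>'(x, \<cdot>)\<close>. It is meaningful when \<open>\<delta> > 0\<close> and \<open>x\<close> has a
  neighbour (see \<open>pmf_step_pmf\<close>), which always holds in a connected graph with at least two vertices.\<close>

definition step_pmf :: "'v::finite set set \<Rightarrow> real \<Rightarrow> 'v set set \<Rightarrow> 'v \<Rightarrow> 'v pmf" where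
  "step_pmf E \<delta> E' x = embed_pmf (step_prob E \<delta> E' x)"

lemma pmf_step_pmf:
  assumes "\<delta> > 0" "{x, z0} \<in> E"
  shows "pmf (step_pmf E \<delta> E' x) y = step_prob E \<delta> E' x y"
proof -
  let ?S = "\<Sum>z | {x, z} \<in> E. edge_weight \<delta> E' {x, z}"
  have pos: "edge_weight \<delta> E' e > 0" for e using assms(1) by (simp add: edge_weight_def)
  have S: "?S > 0" using assms(2) pos by (intro sum_pos) auto
  have nonneg: "step_prob E \<delta> E' x y \<ge> 0" for y
    using S less_imp_le[OF pos] by (auto simp: step_prob_def intro!: divide_nonneg_pos)
  have "(\<Sum>y\<in>UNIV. step_prob E \<delta> E' x y) = (\<Sum>y | {x, y} \<in> E. edge_weight \<delta> E' {x, y} / ?S)"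
    by (simp add: step_prob_def sum.If_cases)
  also have "\<dots> = 1" using S by (simp flip: sum_divide_distrib)
  finally have "(\<integral>\<^sup>+y. ennreal (step_prob E \<delta> E' x y) \<partial>count_space UNIV) = 1"
    using nonneg by (simp add: nn_integral_count_space_finite)
  then show ?thesis unfolding step_pmf_def by (intro pmf_embed_pmf nonneg)
qed

definition edge_sequences :: "'v set set \<Rightarrow> 'v \<Rightarrow> (nat \<Rightarrow> 'v set set) set" where
  "edge_sequences E x0 = {F.
     (\<forall>k\<in>{1..card E}. F k \<subseteq> E \<and> card (F k) = k) \<and>
     (\<exists>v. F 1 = {{x0, v}}) \<and>
     (\<forall>k\<in>{1..<card E}. F k \<subseteq> F (Suc k) \<and>
        (\<forall>e\<in>F (Suc k) - F k. \<exists>f\<in>F k. e \<inter> f \<noteq> {}))}"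

text \<open>The set of endpoints of the edges in \<open>E'\<close> is \<open>\<Union>E'\<close>. A kernel is total on \<open>'v\<close>, but is
  constrained, and below evaluated, on \<open>\<Union>E'\<close> only.\<close>

definition transition_kernels :: "'v set set \<Rightarrow> ('v \<Rightarrow> 'v pmf) set" where
  "transition_kernels E' = {q. \<forall>x\<in>\<Union>E'. \<forall>y. pmf (q x) y > 0 \<longrightarrow> {x, y} \<in> E'}"

text \<open>\<open>bind_pmf \<nu> q\<close> is the measure \<open>\<nu>q\<close>.\<close>

definition invariant_distribution :: "'v pmf \<Rightarrow> ('v \<Rightarrow> 'v pmf) \<Rightarrow> bool" where
  "invariant_distribution \<nu> q \<longleftrightarrow> bind_pmf \<nu> q = \<nu>"

text \<open>Families indexed by \<open>1 \<le> k \<le> card E\<close> are functions on \<^typ>\<open>nat\<close> whose other values are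
  irrelevant.\<close>

definition admissible_families :: "'v::finite set set \<Rightarrow> 'v \<Rightarrow> 'v pmf \<Rightarrow>
    ((nat \<Rightarrow> 'v pmf) \<times> (nat \<Rightarrow> real) \<times> (nat \<Rightarrow> 'v set set) \<times> (nat \<Rightarrow> 'v \<Rightarrow> 'v pmf)) set" where
  "admissible_families E x0 \<nu> = {(N, r, F, q).
     F \<in> edge_sequences E x0 \<and>
     (\<forall>k\<in>{1..card E}. r k \<ge> 0) \<and> (\<Sum>k=1..card E. r k) = 1 \<and>
     (\<forall>k\<in>{1..card E}. q k \<in> transition_kernels (F k) \<and>
        set_pmf (N k) \<subseteq> \<Union>(F k) \<and> invariant_distribution (N k) (q k)) \<and>
     (\<forall>x. (\<Sum>k=1..card E. r k * pmf (N k) x) = pmf \<nu> x)}"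

text \<open>The integral against \<open>\<nu>\<^sub>k\<close> is a finite sum over the vertices. In \<^typ>\<open>ereal\<close>,
  \<open>0 * \<infinity> = 0\<close> and \<open>INF\<close> over the empty set is \<open>\<infinity>\<close>.\<close>

definition orrw_rate :: "'v::finite set set \<Rightarrow> real \<Rightarrow> 'v \<Rightarrow> 'v pmf \<Rightarrow> ereal" where
  "orrw_rate E \<delta> x0 \<nu> =
     (INF (N, r, F, q) \<in> admissible_families E x0 \<nu>.
        \<Sum>k=1..card E. ereal (r k) *
          (\<Sum>x\<in>UNIV. ereal (pmf (N k) x) * relative_entropy (q k x) (step_pmf E \<delta> (F k) x)))"

end

theory Submission
  imports Defs
begin

text \<open>The pair of the set of traversed edges and the position is a finite Markov chain, and the
  occupation measure is a marginal of its empirical flow, which counts the steps out of each state.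
  The upper bound is the method of types: the paths with prescribed step counts are compared with the
  chain whose kernel is read off from these counts, there are only polynomially many step counts,
  and limits of empirical flows are balanced, hence charge no step that traverses a new edge. What
  remains is a stationary pair law for each member of an increasing sequence of edge sets, that is,
  a family in the definition of the rate function, whose cost becomes a continuous functional of the
  flow on a compact set. For the lower bound, a flow charging all admissible directed edges is
  realised stage by stage with the tilted kernel of the stage; the law of large numbers for the
  tilted chain is the upper bound applied to that chain, whose action vanishes only at its
  stationary flow. The passages between stages take boundedly many steps and cost nothing on the
  exponential scale.\<close>

section \<open>Path weights and step counts\<close>

text \<open>The pair chain never returns to an edge set it has left, so it is not irreducible, and a
  mixture of flows belonging to different edge sequences may fail to be a limiting flow. The set of
  admissible flows is a finite union of compact convex sets, one for each choice of the stages.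
  Convexity is therefore used only inside one fixed edge sequence: mixing with a flow that charges
  every admissible directed edge gives each stage positive mass and an irreducible tilted chain, and
  continuity of the action makes this perturbation harmless. That continuity holds on the whole
  space, boundary included, because the action is built from t ln t with \<open>ln 0 = 0\<close>;
  forbidden steps are excluded by support conditions on the flows and not by infinite values. The
  action is homogeneous of degree one. This is why one functional serves for counts, for frequencies
  and for the unnormalised stages, and why the weights \<open>r k\<close> of a family leave no
  logarithm behind.\<close>

primrec path_weight :: "('s \<Rightarrow> 'y \<Rightarrow> 's) \<Rightarrow> ('s \<Rightarrow> 'y \<Rightarrow> real) \<Rightarrow> 's \<Rightarrow> 'y list \<Rightarrow> real" where
  "path_weight f K s [] = 1"
| "path_weight f K s (y # ys) = K s y * path_weight f K (f s y) ys"

text \<open>A step is recorded by the state it leaves and the letter it reads, since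
  \<open>f\<close> determines the next state. The coordinates of a flow are then exactly the
  arguments of \<open>K\<close>.\<close>

primrec step_count :: "('s \<Rightarrow> 'y \<Rightarrow> 's) \<Rightarrow> 's \<Rightarrow> 'y list \<Rightarrow> 's \<times> 'y \<Rightarrow> nat" where
  "step_count f s [] p = 0"
| "step_count f s (y # ys) p = of_bool (p = (s, y)) + step_count f (f s y) ys p"

definition step_freq :: "('s \<Rightarrow> 'y \<Rightarrow> 's) \<Rightarrow> 's \<Rightarrow> 'y list \<Rightarrow> real ^ ('s::finite \<times> 'y::finite)" where
  "step_freq f s ys = (\<chi> p. real (step_count f s ys p) / real (length ys))"

definition paths :: "nat \<Rightarrow> 'y list set" where
  "paths n = {ys. length ys = n}"

lemma finite_paths [simp]: "finite (paths n :: 'y::finite list set)"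
  using finite_lists_length_eq[of "UNIV :: 'y set" n] by (simp add: paths_def)

lemma paths_0 [simp]: "paths 0 = {[]}"
  by (auto simp: paths_def)

lemma sum_paths_Suc:
  fixes g :: "'y::finite list \<Rightarrow> 'a::comm_monoid_add"
  shows "(\<Sum>ys\<in>paths (Suc n). g ys) = (\<Sum>y\<in>UNIV. \<Sum>ys\<in>paths n. g (y # ys))"
proof -
  have "paths (Suc n) = (\<lambda>(y, ys). y # ys) ` (UNIV \<times> (paths n :: 'y list set))"
    by (auto simp: paths_def length_Suc_conv image_iff)
  moreover have "inj_on (\<lambda>(y, ys). y # ys) (UNIV \<times> (paths n :: 'y list set))"
    by (auto simp: inj_on_def)
  ultimately show ?thesis
    by (simp add: sum.reindex sum.cartesian_product case_prod_unfold)
qed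

lemma sum_paths_add:
  fixes g :: "'y::finite list \<Rightarrow> 'a::comm_monoid_add"
  shows "(\<Sum>ys\<in>paths (m + n). g ys) = (\<Sum>xs\<in>paths m. \<Sum>ys\<in>paths n. g (xs @ ys))"
  by (induction m arbitrary: g) (simp_all add: sum_paths_Suc)

lemma path_weight_nonneg:
  assumes "\<And>s y. 0 \<le> K s y"
  shows "0 \<le> path_weight f K s ys"
  using assms by (induction ys arbitrary: s) auto

lemma path_weight_append:
  "path_weight f K s (xs @ ys) = path_weight f K s xs * path_weight f K (foldl f s xs) ys"
  by (induction xs arbitrary: s) auto

lemma step_count_append:
  "step_count f s (xs @ ys) p = step_count f s xs p + step_count f (foldl f s xs) ys p"
  by (induction xs arbitrary: s) auto

lemma sum_path_weight_le_1:
  fixes K :: "'s \<Rightarrow> 'y::finite \<Rightarrow> real"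
  assumes "\<And>s y. 0 \<le> K s y" "\<And>s. (\<Sum>y\<in>UNIV. K s y) \<le> 1"
  shows "(\<Sum>ys\<in>paths n. path_weight f K s ys) \<le> 1"
proof (induction n arbitrary: s)
  case (Suc n)
  have "(\<Sum>ys\<in>paths (Suc n). path_weight f K s ys)
      = (\<Sum>y\<in>UNIV. K s y * (\<Sum>ys\<in>paths n. path_weight f K (f s y) ys))"
    by (simp add: sum_paths_Suc sum_distrib_left)
  also have "\<dots> \<le> (\<Sum>y\<in>UNIV. K s y * 1)"
    by (intro sum_mono mult_left_mono Suc assms)
  finally show ?case using assms(2)[of s] by simp
qed auto

text \<open>Total mass one is asked for only on a set that the kernel cannot leave, so that kernels
  which are stochastic on one stage and zero elsewhere are covered.\<close>

lemma sum_path_weight_eq_1: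
  fixes K :: "'s \<Rightarrow> 'y::finite \<Rightarrow> real"
  assumes "s \<in> A" "\<And>s. s \<in> A \<Longrightarrow> (\<Sum>y\<in>UNIV. K s y) = 1"
    and "\<And>s y. s \<in> A \<Longrightarrow> K s y \<noteq> 0 \<Longrightarrow> f s y \<in> A"
  shows "(\<Sum>ys\<in>paths n. path_weight f K s ys) = 1"
  using assms(1)
proof (induction n arbitrary: s)
  case (Suc n)
  have "(\<Sum>ys\<in>paths (Suc n). path_weight f K s ys)
      = (\<Sum>y\<in>UNIV. K s y * (\<Sum>ys\<in>paths n. path_weight f K (f s y) ys))"
    by (simp add: sum_paths_Suc sum_distrib_left)
  also have "\<dots> = (\<Sum>y\<in>UNIV. K s y * 1)"
    by (rule sum.cong, simp) (metis Suc.IH Suc.prems assms(3) mult_eq_0_iff)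
  finally show ?case using assms(2) Suc.prems by simp
qed auto

text \<open>The weight depends on the step counts alone, for every kernel at once: this is what
  makes the comparison of two kernels on a type class possible. A step that is not made contributes
  1 even where \<open>K\<close> vanishes, by \<open>0 ^ 0 = 1\<close>.\<close>

lemma path_weight_eq_prod:
  fixes K :: "'s::finite \<Rightarrow> 'y::finite \<Rightarrow> real"
  shows "path_weight f K s ys = (\<Prod>p\<in>UNIV. K (fst p) (snd p) ^ step_count f s ys p)"
proof (induction ys arbitrary: s)
  case (Cons y ys)
  have "(\<Prod>p\<in>UNIV. K (fst p) (snd p) ^ step_count f s (y # ys) p)
      = (\<Prod>p\<in>UNIV. if p = (s, y) then K s y else 1) *
        (\<Prod>p\<in>UNIV. K (fst p) (snd p) ^ step_count f (f s y) ys p)"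
    unfolding prod.distrib[symmetric] by (rule prod.cong) auto
  then show ?case using Cons by (simp add: prod.delta)
qed auto

lemma sum_step_count:
  fixes s :: "'s::finite" and ys :: "'y::finite list"
  shows "(\<Sum>p\<in>UNIV. step_count f s ys p) = length ys"
  by (induction ys arbitrary: s) (simp_all add: sum.distrib sum.delta of_bool_def)

lemma step_count_le_length:
  fixes s :: "'s::finite" and ys :: "'y::finite list"
  shows "step_count f s ys p \<le> length ys"
  using member_le_sum[of p UNIV "step_count f s ys"] by (simp add: sum_step_count)

lemma path_weight_pos_imp:
  assumes "path_weight f K s ys \<noteq> 0" "step_count f s ys p > 0"
  shows "K (fst p) (snd p) \<noteq> 0"
  using assms by (induction ys arbitrary: s) (auto split: if_splits simp: of_bool_def)

lemma sum_step_freq: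
  assumes "ys \<noteq> []"
  shows "(\<Sum>p\<in>UNIV. step_freq f s ys $ p) = 1"
  using assms
  by (simp add: step_freq_def flip: sum_divide_distrib of_nat_sum) (simp add: sum_step_count)

section \<open>The action functional\<close>

definition outflow :: "real ^ ('s::finite \<times> 'y::finite) \<Rightarrow> 's \<Rightarrow> real" where
  "outflow \<mu> s = (\<Sum>y\<in>UNIV. \<mu> $ (s, y))"

definition inflow :: "('s \<Rightarrow> 'y \<Rightarrow> 's) \<Rightarrow> real ^ ('s::finite \<times> 'y::finite) \<Rightarrow> 's \<Rightarrow> real" where
  "inflow f \<mu> s = (\<Sum>p\<in>UNIV. of_bool (f (fst p) (snd p) = s) * \<mu> $ p)"

text \<open>The relative entropy of the conditional law of the next letter with respect to
  \<open>K\<close>, averaged over the states. In this expanded form continuity is visible. Where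
  \<open>K\<close> vanishes, \<open>ln 0 = 0\<close> keeps the value finite, so it is the true cost
  only for flows supported by \<open>K\<close>.\<close>

definition action :: "('s \<Rightarrow> 'y \<Rightarrow> real) \<Rightarrow> real ^ ('s::finite \<times> 'y::finite) \<Rightarrow> real" where
  "action K \<mu> = (\<Sum>p\<in>UNIV. \<mu> $ p * ln (\<mu> $ p) - \<mu> $ p * ln (K (fst p) (snd p)))
     - (\<Sum>s\<in>UNIV. outflow \<mu> s * ln (outflow \<mu> s))"

lemma sum_outflow: "(\<Sum>s\<in>UNIV. outflow \<mu> s) = (\<Sum>p\<in>UNIV. \<mu> $ p)"
  by (simp add: outflow_def sum.cartesian_product UNIV_Times_UNIV)

lemma sum_outflow_mult: "(\<Sum>s\<in>UNIV. outflow \<mu> s * h s) = (\<Sum>p\<in>UNIV. \<mu> $ p * h (fst p))"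
  by (simp add: outflow_def sum.cartesian_product UNIV_Times_UNIV sum_distrib_right case_prod_unfold)

lemma action_alt:
  "action K \<mu> = (\<Sum>p\<in>UNIV. \<mu> $ p * (ln (\<mu> $ p) - ln (outflow \<mu> (fst p)) - ln (K (fst p) (snd p))))"
  unfolding action_def sum_outflow_mult by (simp add: algebra_simps sum_subtractf sum.distrib)

lemma sum_inflow_mult:
  "(\<Sum>z\<in>UNIV. inflow f \<mu> z * h z) = (\<Sum>p\<in>UNIV. \<mu> $ p * h (f (fst p) (snd p)))"
proof -
  have "(\<Sum>z\<in>UNIV. inflow f \<mu> z * h z)
      = (\<Sum>p\<in>UNIV. \<Sum>z\<in>UNIV. of_bool (f (fst p) (snd p) = z) * \<mu> $ p * h z)"
    unfolding inflow_def sum_distrib_right by (rule sum.swap)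
  also have "\<dots> = (\<Sum>p\<in>UNIV. \<Sum>z\<in>UNIV. if f (fst p) (snd p) = z then \<mu> $ p * h z else 0)"
    by (intro sum.cong refl) auto
  finally show ?thesis by (simp add: sum.delta)
qed

lemma outflow_ge: "(\<And>p. 0 \<le> \<mu> $ p) \<Longrightarrow> \<mu> $ (s, y) \<le> outflow \<mu> s"
  unfolding outflow_def by (rule member_le_sum) auto

text \<open>Only the ratio of a coordinate to its outflow enters the logarithms. This passes from
  step counts to step frequencies.\<close>

lemma action_scale:
  assumes "c > 0" and "\<And>p. 0 \<le> \<mu> $ p"
  shows "action K (c *\<^sub>R \<mu>) = c * action K \<mu>"
proof -
  have o: "outflow (c *\<^sub>R \<mu>) s = c * outflow \<mu> s" for s
    by (simp add: outflow_def sum_distrib_left)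
  have "c * \<mu> $ p * (ln (c * \<mu> $ p) - ln (c * outflow \<mu> (fst p)) - k)
     = c * (\<mu> $ p * (ln (\<mu> $ p) - ln (outflow \<mu> (fst p)) - k))" for p k
  proof (cases "\<mu> $ p = 0")
    case False
    then have "\<mu> $ p > 0" using assms(2)[of p] by linarith
    moreover have "outflow \<mu> (fst p) > 0"
      using outflow_ge[of \<mu> "fst p" "snd p"] assms(2) calculation by simp
    ultimately show ?thesis using assms(1) by (simp add: ln_mult)
  qed auto
  then show ?thesis
    unfolding action_alt o sum_distrib_left vector_scaleR_component real_scaleR_def
    by (intro sum.cong refl)
qed

lemma isCont_xlnx: "isCont (\<lambda>t::real. t * ln t) t"
proof (cases "t = 0")
  case True
  have r: "((\<lambda>t::real. t * ln t) \<longlongrightarrow> 0) (at_right 0)" by real_asymp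
  \<comment> \<open>By \<open>ln_minus\<close> the function t ln t is odd, so its left limit at 0
    follows from the right one. Two-sided continuity frees \<open>continuous_on_action\<close> from
    sign conditions.\<close>
  have l: "((\<lambda>t::real. t * ln t) \<longlongrightarrow> 0) (at_left 0)"
    using tendsto_minus[OF r] by (simp add: filterlim_at_left_to_right ln_minus)
  show ?thesis using l r True by (simp add: isCont_def filterlim_split_at)
next
  case False
  then show ?thesis by (intro continuous_intros) auto
qed


lemma continuous_on_action: "continuous_on A (action K)"
proof -
  have x: "continuous_on UNIV (\<lambda>t::real. t * ln t)"
    by (simp add: continuous_on_eq_continuous_at isCont_xlnx)
  have c: "continuous_on A (\<lambda>\<mu>. g \<mu> * ln (g \<mu>))" if "continuous_on A g"
    for g :: "real ^ ('a \<times> 'b) \<Rightarrow> real"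
    using continuous_on_compose2[OF x that] by simp
  show ?thesis
    unfolding action_def outflow_def by (intro continuous_intros c)
qed

text \<open>This is ln t \<le> t - 1 at t = b / a, together with its case of equality.\<close>

lemma xlnx_ge_diff:
  fixes a b :: real
  assumes "0 \<le> a" "0 \<le> b" "a \<noteq> 0 \<Longrightarrow> b \<noteq> 0"
  shows "a - b \<le> a * (ln a - ln b)" "a * (ln a - ln b) = a - b \<Longrightarrow> a = b"
proof -
  have "a - b \<le> a * (ln a - ln b) \<and> (a * (ln a - ln b) = a - b \<longrightarrow> a = b)"
  proof (cases "a = 0")
    case False
    then have ab: "a > 0" "b > 0" using assms by auto
    have l: "ln (b / a) = ln b - ln a" using ab by (simp add: ln_div)
    have le: "ln (b / a) \<le> b / a - 1" using ab by (intro ln_le_minus_one) simp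
    have "a * (b / a - 1) = b - a" using ab by (simp add: field_simps)
    moreover have "a * ln (b / a) \<le> a * (b / a - 1)" using le ab by simp
    moreover have "b / a = 1" if "a * ln (b / a) = a * (b / a - 1)"
      using that ab by (intro ln_eq_minus_one) auto
    ultimately show ?thesis using ab by (auto simp: l algebra_simps)
  qed (use assms in auto)
  then show "a - b \<le> a * (ln a - ln b)" "a * (ln a - ln b) = a - b \<Longrightarrow> a = b" by auto
qed

lemma action_relative_entropy:
  assumes "\<And>p. 0 \<le> \<mu> $ p" "\<And>p. \<mu> $ p \<noteq> 0 \<Longrightarrow> 0 < K (fst p) (snd p)"
  shows "action K \<mu>
    = (\<Sum>p\<in>UNIV. \<mu> $ p * (ln (\<mu> $ p) - ln (outflow \<mu> (fst p) * K (fst p) (snd p))))"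
  unfolding action_alt
proof (rule sum.cong)
  fix p
  show "\<mu> $ p * (ln (\<mu> $ p) - ln (outflow \<mu> (fst p)) - ln (K (fst p) (snd p)))
      = \<mu> $ p * (ln (\<mu> $ p) - ln (outflow \<mu> (fst p) * K (fst p) (snd p)))"
  proof (cases "\<mu> $ p = 0")
    case False
    then have "\<mu> $ p > 0" using assms(1)[of p] by linarith
    then have "outflow \<mu> (fst p) > 0"
      using outflow_ge[of \<mu> "fst p" "snd p"] assms(1) by simp
    then show ?thesis using assms(2)[OF False] by (simp add: ln_mult)
  qed auto
qed auto

text \<open>Gibbs' inequality for a kernel that may lose mass: the action is the sum of the
  nonnegative terms \<open>?d p\<close> plus the mass lost by \<open>K\<close>. If it is zero, every
  single \<open>?d p\<close> is zero, and the equality case of \<open>xlnx_ge_diff\<close>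
  applies.\<close>

lemma action_nonneg:
  fixes \<mu> :: "real ^ ('s::finite \<times> 'y::finite)"
  assumes "\<And>p. 0 \<le> \<mu> $ p" "\<And>p. \<mu> $ p \<noteq> 0 \<Longrightarrow> 0 < K (fst p) (snd p)"
    and K: "\<And>s y. 0 \<le> K s y" "\<And>s. (\<Sum>y\<in>UNIV. K s y) \<le> 1"
  shows "0 \<le> action K \<mu>"
    and "action K \<mu> = 0 \<Longrightarrow> \<mu> $ (s, y) = outflow \<mu> s * K s y"
proof -
  let ?b = "\<lambda>p. outflow \<mu> (fst p) * K (fst p) (snd p)"
  let ?d = "\<lambda>p. \<mu> $ p * (ln (\<mu> $ p) - ln (?b p)) - (\<mu> $ p - ?b p)"
  have o: "0 \<le> outflow \<mu> s" for s unfolding outflow_def by (intro sum_nonneg assms)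
  have b0: "0 \<le> ?b p" for p using o K by simp
  have b1: "?b p \<noteq> 0" if "\<mu> $ p \<noteq> 0" for p
  proof -
    have "0 < \<mu> $ p" using that assms(1)[of p] by linarith
    also have "\<mu> $ p \<le> outflow \<mu> (fst p)"
      using outflow_ge[of \<mu> "fst p" "snd p", OF assms(1)] by simp
    finally show ?thesis using assms(2)[OF that] by simp
  qed
  have d: "0 \<le> ?d p" for p using xlnx_ge_diff(1)[OF assms(1) b0 b1] by simp
  have "(\<Sum>p\<in>UNIV. ?b p) = (\<Sum>s\<in>UNIV. outflow \<mu> s * (\<Sum>y\<in>UNIV. K s y))"
    by (simp add: sum_distrib_left sum.cartesian_product UNIV_Times_UNIV case_prod_unfold)
  also have "\<dots> \<le> (\<Sum>s\<in>UNIV. outflow \<mu> s * 1)"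
    by (intro sum_mono mult_left_mono o K)
  finally have sb: "(\<Sum>p\<in>UNIV. ?b p) \<le> (\<Sum>p\<in>UNIV. \<mu> $ p)"
    by (simp add: sum_outflow)
  have a: "action K \<mu> = (\<Sum>p\<in>UNIV. ?d p) + ((\<Sum>p\<in>UNIV. \<mu> $ p) - (\<Sum>p\<in>UNIV. ?b p))"
    by (subst action_relative_entropy[of \<mu> K]) (use assms in \<open>auto simp: sum_subtractf\<close>)
  have sd: "0 \<le> (\<Sum>p\<in>UNIV. ?d p)" by (rule sum_nonneg) (rule d)
  show "0 \<le> action K \<mu>" using a sb sd by linarith
  show "\<mu> $ (s, y) = outflow \<mu> s * K s y" if "action K \<mu> = 0"
  proof -
    have "(\<Sum>p\<in>UNIV. ?d p) = 0" using a sb sd that by linarith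
    then have "?d (s, y) = 0" using d by (subst (asm) sum_nonneg_eq_0_iff) auto
    then show ?thesis 
      using xlnx_ge_diff(2)[of "\<mu> $ (s, y)" "outflow \<mu> s * K s y"]
        assms(1)[of "(s, y)"] b0[of "(s, y)"] b1[of "(s, y)"] by simp
  qed
qed

section \<open>The method of types\<close>

text \<open>The paths with given step counts are compared with the empirical kernel of these counts, under
  which they all have the same weight and total weight at most one.\<close>

lemma type_weight_le:
  fixes K :: "'s::finite \<Rightarrow> 'y::finite \<Rightarrow> real" and N :: "'s \<times> 'y \<Rightarrow> nat"
  assumes K: "\<And>s y. 0 \<le> K s y"
  shows "(\<Sum>ys\<in>{ys\<in>paths n. step_count f s ys = N}. path_weight f K s ys)
    \<le> exp (- action K (\<chi> p. real (N p)))"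
proof (cases "\<forall>p. N p > 0 \<longrightarrow> K (fst p) (snd p) > 0")
  case False
  then obtain p where p: "N p > 0" "K (fst p) (snd p) = 0"
    using K by (metis less_eq_real_def)
  have "path_weight f K s ys = 0" if "step_count f s ys = N" for ys
    using path_weight_pos_imp[of f K s ys p] that p by auto
  then have "(\<Sum>ys\<in>{ys\<in>paths n. step_count f s ys = N}. path_weight f K s ys) = 0"
    by (intro sum.neutral) auto
  then show ?thesis by simp
next
  case Kpos: True
  let ?T = "{ys\<in>paths n. step_count f s ys = N}"
  let ?\<mu> = "\<chi> p. real (N p) :: real ^ ('s \<times> 'y)"
  \<comment> \<open>At a state without departures, division by zero gives a zero row. Thus
    \<open>q\<close> is merely substochastic, which suffices for a total weight of at most
    one.\<close>
  define q where "q s y = real (N (s, y)) / outflow ?\<mu> s" for s y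
  have o0: "0 \<le> outflow ?\<mu> s" for s unfolding outflow_def by (intro sum_nonneg) auto
  have q0: "0 \<le> q s y" for s y using o0 by (simp add: q_def)
  have q1: "(\<Sum>y\<in>UNIV. q s y) \<le> 1" for s
    by (simp add: q_def outflow_def flip: sum_divide_distrib)
  have opos: "outflow ?\<mu> (fst p) > 0" if "N p > 0" for p
  proof -
    have "?\<mu> $ (fst p, snd p) \<le> outflow ?\<mu> (fst p)"
      by (rule outflow_ge) simp
    then show ?thesis using that by simp
  qed
  have qpos: "q (fst p) (snd p) > 0" if "N p > 0" for p
    using opos[OF that] that by (simp add: q_def)
  define B where "B = (\<Prod>p\<in>UNIV. q (fst p) (snd p) ^ N p)"
  define A where "A = (\<Prod>p\<in>UNIV. K (fst p) (snd p) ^ N p)"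
  have Bpos: "B > 0" unfolding B_def
    by (rule prod_pos) (metis qpos zero_less_power gr0I power_0 zero_less_one)
  have "(\<Sum>ys\<in>?T. path_weight f q s ys) \<le> (\<Sum>ys\<in>paths n. path_weight f q s ys)"
    by (rule sum_mono2) (auto intro: path_weight_nonneg q0)
  also have "\<dots> \<le> 1" by (rule sum_path_weight_le_1[OF q0 q1])
  finally have "card ?T * B \<le> 1"
    by (simp add: path_weight_eq_prod B_def)
  then have card: "card ?T \<le> 1 / B" using Bpos by (simp add: field_simps)
  have "A = exp (\<Sum>p\<in>UNIV. real (N p) * ln (K (fst p) (snd p)))"
    unfolding A_def exp_sum[OF finite]
  proof (rule prod.cong)
    fix p show "K (fst p) (snd p) ^ N p = exp (real (N p) * ln (K (fst p) (snd p)))"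
      using Kpos by (cases "N p = 0") (simp_all add: exp_of_nat_mult)
  qed auto
  moreover have "B = exp (\<Sum>p\<in>UNIV. real (N p) * ln (q (fst p) (snd p)))"
    unfolding B_def exp_sum[OF finite]
  proof (rule prod.cong)
    fix p show "q (fst p) (snd p) ^ N p = exp (real (N p) * ln (q (fst p) (snd p)))"
      using qpos by (cases "N p = 0") (simp_all add: exp_of_nat_mult)
  qed auto
  \<comment> \<open>The likelihood ratio of \<open>K\<close> to \<open>q\<close> is constant on the
    type, and its logarithm is minus the action of the counts.\<close>
  ultimately have "A / B = exp (\<Sum>p\<in>UNIV. real (N p) * (ln (K (fst p) (snd p)) - ln (q (fst p) (snd p))))"
    by (simp add: sum_subtractf algebra_simps flip: exp_diff)
  also have "(\<Sum>p\<in>UNIV. real (N p) * (ln (K (fst p) (snd p)) - ln (q (fst p) (snd p))))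
      = - action K ?\<mu>"
    unfolding action_alt sum_negf[symmetric]
  proof (rule sum.cong)
    fix p
    show "real (N p) * (ln (K (fst p) (snd p)) - ln (q (fst p) (snd p))) =
       - (?\<mu> $ p * (ln (?\<mu> $ p) - ln (outflow ?\<mu> (fst p)) - ln (K (fst p) (snd p))))"
    proof (cases "N p = 0")
      case False
      have "ln (q (fst p) (snd p)) = ln (real (N p)) - ln (outflow ?\<mu> (fst p))"
        using opos[of p] False by (simp add: q_def ln_div)
      then show ?thesis by simp argo
    qed auto
  qed auto
  finally have AB: "A / B = exp (- action K ?\<mu>)" .
  have A0: "0 \<le> A" unfolding A_def using K by (intro prod_nonneg zero_le_power) auto
  have "(\<Sum>ys\<in>?T. path_weight f K s ys) = card ?T * A"
    by (simp add: path_weight_eq_prod A_def)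
  also have "\<dots> \<le> 1 / B * A"
    using card A0 by (rule mult_right_mono)
  finally show ?thesis using AB by simp
qed

text \<open>The paths only have to be possible, not likely. The properties of such limits therefore
  follow from counting along single paths, without probability estimates.\<close>

definition limit_flow ::
    "('s \<Rightarrow> 'y \<Rightarrow> 's) \<Rightarrow> ('s \<Rightarrow> 'y \<Rightarrow> real) \<Rightarrow> 's \<Rightarrow> real ^ ('s::finite \<times> 'y::finite) \<Rightarrow> bool" where
  "limit_flow f K s \<mu> \<longleftrightarrow> (\<exists>ys :: nat \<Rightarrow> 'y list.
     (\<forall>j. path_weight f K s (ys j) \<noteq> 0) \<and>
     filterlim (\<lambda>j. length (ys j)) at_top sequentially \<and>
     (\<lambda>j. step_freq f s (ys j)) \<longlonglongrightarrow> \<mu>)"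

lemma step_freq_bounds: "0 \<le> step_freq f s ys $ p" "step_freq f s ys $ p \<le> 1"
  using step_count_le_length[of f s ys p]
  by (auto simp: step_freq_def intro: divide_le_eq_1[THEN iffD2])

text \<open>A step count has values in 0, ..., n, so there are at most (n + 1)^d types, with d the
  number of pairs of state and letter. Paths of weight zero are discarded first, so that
  \<open>c\<close> need bound the action on possible paths only.\<close>

lemma path_sum_le_types:
  fixes K :: "'s::finite \<Rightarrow> 'y::finite \<Rightarrow> real"
  assumes K: "\<And>s y. 0 \<le> K s y" and n: "n > 0"
    and c: "\<And>ys. length ys = n \<Longrightarrow> P ys \<Longrightarrow> path_weight f K s ys \<noteq> 0 \<Longrightarrow>
      c \<le> action K (step_freq f s ys)"
  shows "(\<Sum>ys\<in>{ys\<in>paths n. P ys}. path_weight f K s ys)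
    \<le> real (n + 1) ^ CARD('s \<times> 'y) * exp (- (real n * c))"
proof -
  let ?S = "{ys\<in>paths n. P ys \<and> path_weight f K s ys \<noteq> 0}"
  let ?I = "step_count f s ` ?S"
  have "?I \<subseteq> PiE UNIV (\<lambda>_. {..n})"
  proof
    fix N assume "N \<in> ?I"
    then obtain ys where "length ys = n" "N = step_count f s ys" by (auto simp: paths_def)
    then show "N \<in> PiE UNIV (\<lambda>_. {..n})" using step_count_le_length[of f s ys] by auto
  qed
  then have "card ?I \<le> card (PiE (UNIV :: ('s \<times> 'y) set) (\<lambda>_. {..n}))"
    by (intro card_mono finite_PiE) auto
  also have "\<dots> = (n + 1) ^ CARD('s \<times> 'y)" by (simp add: card_PiE)
  finally have card: "real (card ?I) \<le> real (n + 1) ^ CARD('s \<times> 'y)"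
    by (simp flip: of_nat_power of_nat_Suc)
  have "(\<Sum>ys\<in>{ys\<in>paths n. P ys}. path_weight f K s ys) = (\<Sum>ys\<in>?S. path_weight f K s ys)"
    by (rule sum.mono_neutral_right) auto
  also have "\<dots> = (\<Sum>N\<in>?I. \<Sum>ys\<in>{ys\<in>?S. step_count f s ys = N}. path_weight f K s ys)"
    by (rule sum.image_gen) simp
  also have "\<dots> \<le> (\<Sum>N\<in>?I. exp (- (real n * c)))"
  proof (rule sum_mono)
    fix N assume "N \<in> ?I"
    then obtain ys where ys: "ys \<in> ?S" "N = step_count f s ys" by auto
    have l: "length ys = n" using ys by (simp add: paths_def)
    have "(\<chi> p. real (N p)) = real n *\<^sub>R step_freq f s ys"
      using n l ys by (simp add: vec_eq_iff step_freq_def)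
    then have "action K (\<chi> p. real (N p)) = real n * action K (step_freq f s ys)"
      using n by (simp add: action_scale step_freq_bounds)
    moreover have "c \<le> action K (step_freq f s ys)" using c[of ys] ys l by auto
    ultimately have le: "real n * c \<le> action K (\<chi> p. real (N p))"
      using n by simp
    have "(\<Sum>ys\<in>{ys\<in>?S. step_count f s ys = N}. path_weight f K s ys)
        \<le> (\<Sum>ys\<in>{ys\<in>paths n. step_count f s ys = N}. path_weight f K s ys)"
      by (rule sum_mono2) (auto intro: path_weight_nonneg K)
    also have "\<dots> \<le> exp (- action K (\<chi> p. real (N p)))" by (rule type_weight_le[OF K])
    finally show "(\<Sum>ys\<in>{ys\<in>?S. step_count f s ys = N}. path_weight f K s ys) \<le> exp (- (real n * c))"
      using le by (meson exp_le_cancel_iff neg_le_iff_le order_trans)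
  qed
  also have "\<dots> = real (card ?I) * exp (- (real n * c))" by simp
  also have "\<dots> \<le> real (n + 1) ^ CARD('s \<times> 'y) * exp (- (real n * c))"
    using card by (intro mult_right_mono) auto
  finally show ?thesis .
qed

text \<open>If no rate above \<open>c\<close> worked, then each rate \<open>c + e j\<close> would
  fail at arbitrarily large lengths, hence some long possible path would have action at most
  \<open>c\<close> up to vanishing errors. Compactness of the unit box turns these paths into a
  limiting flow in \<open>C\<close> with action at most \<open>c\<close>. So a strict inequality at
  each limiting flow already yields a uniform gap.\<close>

lemma path_sum_decay:
  fixes K :: "'s::finite \<Rightarrow> 'y::finite \<Rightarrow> real" and C :: "(real ^ ('s \<times> 'y)) set"
  assumes K: "\<And>s y. 0 \<le> K s y" and C: "closed C"
    and lim: "\<And>\<mu>. \<mu> \<in> C \<Longrightarrow> limit_flow f K s \<mu> \<Longrightarrow> c < action K \<mu>"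
  shows "\<exists>c'>c. \<forall>\<^sub>F n in sequentially.
    (\<Sum>ys\<in>{ys\<in>paths n. step_freq f s ys \<in> C}. path_weight f K s ys) \<le> exp (- (real n * c'))"
proof (rule ccontr)
  assume contra: "\<not> ?thesis"
  define d where "d = CARD('s \<times> 'y)"
  \<comment> \<open>Chosen so that, for positive l, \<open>exp (l * h l)\<close> is the polynomial
    bound on the number of types; it tends to 0.\<close>
  define h where "h l = real d * (ln (real l + 1) / real l)" for l :: nat
  define e where "e j = 1 / real (Suc j)" for j
  have "\<exists>ys. length ys \<ge> Suc j \<and> step_freq f s ys \<in> C \<and> path_weight f K s ys \<noteq> 0 \<and>
      action K (step_freq f s ys) \<le> c + e j + h (length ys)" for j
  proof -
    have "\<not> (\<forall>\<^sub>F n in sequentially.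
      (\<Sum>ys\<in>{ys\<in>paths n. step_freq f s ys \<in> C}. path_weight f K s ys) \<le> exp (- (real n * (c + e j))))"
      using contra by (auto simp: e_def)
    then obtain n where n: "n \<ge> Suc j" and big:
      "(\<Sum>ys\<in>{ys\<in>paths n. step_freq f s ys \<in> C}. path_weight f K s ys) > exp (- (real n * (c + e j)))"
      unfolding eventually_sequentially by (meson not_le)
    have "\<exists>ys. length ys = n \<and> step_freq f s ys \<in> C \<and> path_weight f K s ys \<noteq> 0 \<and>
      action K (step_freq f s ys) < c + e j + h n"
    proof (rule ccontr)
      assume "\<not> ?thesis"
      then have "(\<Sum>ys\<in>{ys\<in>paths n. step_freq f s ys \<in> C}. path_weight f K s ys)
          \<le> real (n + 1) ^ CARD('s \<times> 'y) * exp (- (real n * (c + e j + h n)))"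
        using n by (intro path_sum_le_types K) (auto simp: not_less)
      also have "real (n + 1) ^ CARD('s \<times> 'y) = exp (real n * h n)"
        unfolding d_def[symmetric]
        using n by (simp add: h_def exp_of_nat_mult add.commute)
      also have "exp (real n * h n) * exp (- (real n * (c + e j + h n))) = exp (- (real n * (c + e j)))"
        by (simp add: algebra_simps flip: exp_add)
      finally show False using big by simp
    qed
    then show ?thesis using n by (metis less_imp_le)
  qed
  then obtain ys where ys: "\<And>j. length (ys j) \<ge> Suc j" "\<And>j. step_freq f s (ys j) \<in> C"
    "\<And>j. path_weight f K s (ys j) \<noteq> 0"
    "\<And>j. action K (step_freq f s (ys j)) \<le> c + e j + h (length (ys j))"
    by metis
  have "compact (cbox 0 1 \<inter> C)" using C by (intro compact_Int_closed compact_cbox)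
  moreover have "\<forall>j. step_freq f s (ys j) \<in> cbox 0 1 \<inter> C"
    using ys by (simp add: mem_box_cart step_freq_bounds)
  ultimately obtain \<mu> r where \<mu>: "\<mu> \<in> C" and r: "strict_mono r"
    and conv: "((\<lambda>j. step_freq f s (ys j)) \<circ> r) \<longlonglongrightarrow> \<mu>"
    unfolding compact_def by (metis IntE)
  have len: "filterlim (\<lambda>j. length (ys (r j))) at_top sequentially"
  proof (rule filterlim_at_top_mono[OF filterlim_ident])
    have "j \<le> length (ys (r j))" for j
      using ys(1)[of "r j"] seq_suble[OF r, of j] by simp
    then show "\<forall>\<^sub>F j in sequentially. j \<le> length (ys (r j))" by simp
  qed
  have "limit_flow f K s \<mu>"
    unfolding limit_flow_def
    by (rule exI[of _ "ys \<circ> r"]) (use ys(3) len conv in \<open>simp_all add: o_def\<close>)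
  then have "c < action K \<mu>" using lim \<mu> by simp
  moreover have "action K \<mu> \<le> c + 0 + 0"
  proof (rule LIMSEQ_le)
    show "(\<lambda>j. action K (step_freq f s (ys (r j)))) \<longlonglongrightarrow> action K \<mu>"
      by (rule isCont_tendsto_compose[OF _ conv[unfolded o_def]])
        (use continuous_on_action[of UNIV K] in \<open>simp add: continuous_on_eq_continuous_at\<close>)
    have "(\<lambda>j. e (r j)) \<longlonglongrightarrow> 0"
      unfolding e_def using LIMSEQ_subseq_LIMSEQ[OF LIMSEQ_inverse_real_of_nat r]
      by (simp add: o_def inverse_eq_divide)
    moreover have "(\<lambda>l. ln (real l + 1) / real l) \<longlonglongrightarrow> 0" by real_asymp
    then have "h \<longlonglongrightarrow> 0" unfolding h_def by (rule tendsto_mult_right_zero)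
    then have "(\<lambda>j. h (length (ys (r j)))) \<longlonglongrightarrow> 0"
      using len by (rule filterlim_compose)
    ultimately show "(\<lambda>j. c + e (r j) + h (length (ys (r j)))) \<longlonglongrightarrow> c + 0 + 0"
      by (intro tendsto_intros)
  qed (use ys(4) in blast)
  ultimately show False by simp
qed

section \<open>Support and balance of limiting flows\<close>

lemma step_count_balance:
  fixes s :: "'s::finite" and ys :: "'y::finite list"
  shows "(\<Sum>y\<in>UNIV. step_count f s ys (z, y)) + of_bool (z = foldl f s ys)
    = (\<Sum>p\<in>UNIV. of_bool (f (fst p) (snd p) = z) * step_count f s ys p) + of_bool (z = s)"
proof (induction ys arbitrary: s)
  case (Cons y ys)
  have "(\<Sum>p\<in>UNIV. of_bool (f (fst p) (snd p) = z) * of_bool (p = (s, y)))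
      = (\<Sum>p\<in>UNIV. if p = (s, y) then of_bool (f s y = z) else (0::nat))"
    by (rule sum.cong) auto
  moreover have "(\<Sum>y'\<in>UNIV. of_bool (z = s \<and> y' = y)) = (\<Sum>y'\<in>UNIV. if y' = y then of_bool (z = s) else (0::nat))"
    by (rule sum.cong) auto
  ultimately show ?case using Cons[of "f s y"]
    by (simp add: sum.distrib distrib_left sum.delta eq_commute[of z "f s y"])
qed simp

text \<open>There are finitely many coordinates, so far along the sequence one path makes all
  charged steps. For the walk this puts all charged edge sets into a single increasing
  sequence.\<close>

lemma limit_flow_realized:
  fixes \<mu> :: "real ^ ('s::finite \<times> 'y::finite)"
  assumes "limit_flow f K s \<mu>"
  shows "\<exists>ys. path_weight f K s ys \<noteq> 0 \<and> (\<forall>p. \<mu> $ p \<noteq> 0 \<longrightarrow> step_count f s ys p > 0)"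
proof -
  obtain ys where ys: "\<And>j. path_weight f K s (ys j) \<noteq> 0"
    and conv: "(\<lambda>j. step_freq f s (ys j)) \<longlonglongrightarrow> \<mu>"
    using assms by (auto simp: limit_flow_def)
  have "\<forall>\<^sub>F j in sequentially. \<mu> $ p \<noteq> 0 \<longrightarrow> step_count f s (ys j) p > 0" for p
  proof (cases "\<mu> $ p = 0")
    case False
    have "(\<lambda>j. step_freq f s (ys j) $ p) \<longlonglongrightarrow> \<mu> $ p" using conv by (rule tendsto_vec_nth)
    then have "\<forall>\<^sub>F j in sequentially. step_freq f s (ys j) $ p \<noteq> 0"
      using False by (rule tendsto_imp_eventually_ne)
    then show ?thesis by eventually_elim (auto simp: step_freq_def)
  qed simp
  then have "\<forall>\<^sub>F j in sequentially. \<forall>p. \<mu> $ p \<noteq> 0 \<longrightarrow> step_count f s (ys j) p > 0"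
    by (simp add: eventually_all_finite)
  then obtain j where "\<forall>p. \<mu> $ p \<noteq> 0 \<longrightarrow> step_count f s (ys j) p > 0"
    unfolding eventually_sequentially by blast
  then show ?thesis using ys by blast
qed

lemma limit_flow_properties:
  fixes \<mu> :: "real ^ ('s::finite \<times> 'y::finite)"
  assumes "limit_flow f K s \<mu>"
  shows "0 \<le> \<mu> $ p" "(\<Sum>p\<in>UNIV. \<mu> $ p) = 1" "\<mu> $ p \<noteq> 0 \<Longrightarrow> K (fst p) (snd p) \<noteq> 0"
    "outflow \<mu> z = inflow f \<mu> z"
proof -
  obtain ys where ys: "\<And>j. path_weight f K s (ys j) \<noteq> 0"
    and len: "filterlim (\<lambda>j. length (ys j)) at_top sequentially"
    and conv: "(\<lambda>j. step_freq f s (ys j)) \<longlonglongrightarrow> \<mu>"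
    using assms by (auto simp: limit_flow_def)
  have conv': "(\<lambda>j. step_freq f s (ys j) $ p) \<longlonglongrightarrow> \<mu> $ p" for p
    using conv by (rule tendsto_vec_nth)
  show "0 \<le> \<mu> $ p" using conv'[of p] by (rule LIMSEQ_le_const) (simp add: step_freq_bounds)
  have ne: "\<forall>\<^sub>F j in sequentially. ys j \<noteq> []"
    using len[unfolded filterlim_at_top, rule_format, of 1] by eventually_elim auto
  have "(\<lambda>j. \<Sum>p\<in>UNIV. step_freq f s (ys j) $ p) \<longlonglongrightarrow> (\<Sum>p\<in>UNIV. \<mu> $ p)"
    by (intro tendsto_sum conv')
  moreover have "(\<lambda>j. \<Sum>p\<in>UNIV. step_freq f s (ys j) $ p) \<longlonglongrightarrow> 1"
    by (rule tendsto_eventually) (rule eventually_mono[OF ne], rule sum_step_freq)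
  ultimately show "(\<Sum>p\<in>UNIV. \<mu> $ p) = 1" by (rule LIMSEQ_unique)
  show "K (fst p) (snd p) \<noteq> 0" if "\<mu> $ p \<noteq> 0"
    using limit_flow_realized[OF assms] path_weight_pos_imp that by metis
  \<comment> \<open>Departures from \<open>z\<close> and arrivals at \<open>z\<close> along a path
    differ only through its two end points, so the defect is at most one over the length.\<close>
  have "outflow (step_freq f s y) z - inflow f (step_freq f s y) z
      = (of_bool (z = s) - of_bool (z = foldl f s y)) / real (length y)" for y
  proof -
    have "outflow (step_freq f s y) z = real (\<Sum>x\<in>UNIV. step_count f s y (z, x)) / real (length y)"
      by (simp add: outflow_def step_freq_def sum_divide_distrib)
    moreover have "inflow f (step_freq f s y) z
        = real (\<Sum>p\<in>UNIV. of_bool (f (fst p) (snd p) = z) * step_count f s y p) / real (length y)"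
      unfolding of_nat_sum sum_divide_distrib by (simp add: inflow_def step_freq_def)
    moreover have bal: "real (\<Sum>x\<in>UNIV. step_count f s y (z, x)) + of_bool (z = foldl f s y)
        = real (\<Sum>p\<in>UNIV. of_bool (f (fst p) (snd p) = z) * step_count f s y p) + of_bool (z = s)"
      using arg_cong[OF step_count_balance[of f s y z], of real]
      by (simp only: of_nat_add of_nat_of_bool)
    moreover have "real (\<Sum>x\<in>UNIV. step_count f s y (z, x))
        - real (\<Sum>p\<in>UNIV. of_bool (f (fst p) (snd p) = z) * step_count f s y p)
        = of_bool (z = s) - of_bool (z = foldl f s y)"
      using bal by linarith
    ultimately show ?thesis by (simp only: diff_divide_distrib[symmetric])
  qed
  then have bound: "norm (outflow (step_freq f s (ys j)) z - inflow f (step_freq f s (ys j)) z)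
      \<le> 1 / real (length (ys j))" for j
    by (auto simp: divide_right_mono)
  have "((\<lambda>l. 1 / real l) \<longlongrightarrow> 0) sequentially" by real_asymp
  then have "(\<lambda>j. 1 / real (length (ys j))) \<longlonglongrightarrow> 0"
    using len by (rule filterlim_compose)
  then have "(\<lambda>j. outflow (step_freq f s (ys j)) z - inflow f (step_freq f s (ys j)) z) \<longlonglongrightarrow> 0"
    by (rule tendsto_0_le[where K = 1]) (use bound in simp)
  moreover have "(\<lambda>j. outflow (step_freq f s (ys j)) z - inflow f (step_freq f s (ys j)) z)
      \<longlonglongrightarrow> outflow \<mu> z - inflow f \<mu> z"
    unfolding outflow_def inflow_def by (intro tendsto_intros conv')
  ultimately have "outflow \<mu> z - inflow f \<mu> z = 0" by (rule LIMSEQ_unique[rotated])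
  then show "outflow \<mu> z = inflow f \<mu> z" by simp
qed

section \<open>Concentration under a tilted kernel\<close>

lemma closed_far: "closed {\<mu> :: real ^ 'p::finite. \<exists>p. \<epsilon> \<le> \<bar>\<mu> $ p - \<pi> $ p\<bar>}"
proof -
  have "closed {\<mu> :: real ^ 'p. \<epsilon> \<le> \<bar>\<mu> $ p - \<pi> $ p\<bar>}" for p
    by (intro closed_Collect_le continuous_intros)
  then have "closed (\<Union>p. {\<mu> :: real ^ 'p. \<epsilon> \<le> \<bar>\<mu> $ p - \<pi> $ p\<bar>})"
    by (intro closed_UN) auto
  moreover have "(\<Union>p. {\<mu> :: real ^ 'p. \<epsilon> \<le> \<bar>\<mu> $ p - \<pi> $ p\<bar>}) = {\<mu>. \<exists>p. \<epsilon> \<le> \<bar>\<mu> $ p - \<pi> $ p\<bar>}"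
    by auto
  ultimately show ?thesis by simp
qed

lemma foldl_in_closed_set:
  assumes "s \<in> A" "\<And>s y. s \<in> A \<Longrightarrow> K s y \<noteq> 0 \<Longrightarrow> f s y \<in> A" "path_weight f K s ys \<noteq> 0"
  shows "foldl f s ys \<in> A"
  using assms(1,3) by (induction ys arbitrary: s) (auto simp: assms(2))

text \<open>The path law with kernel \<open>Q\<close> is concentrated near the only zero \<open>\<pi>\<close> of its action, by
  \<open>path_sum_decay\<close>; changing the kernel from \<open>Q\<close> to \<open>K\<close> costs \<open>\<Sum>\<pi> ln (Q/K)\<close> per step.\<close>

lemma tilted_lower_bound:
  fixes K Q :: "'s::finite \<Rightarrow> 'y::finite \<Rightarrow> real"
  assumes K: "\<And>s y. 0 \<le> K s y" and Q: "\<And>s y. 0 \<le> Q s y" and QK: "\<And>s y. Q s y \<noteq> 0 \<Longrightarrow> K s y \<noteq> 0"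
    and Q1: "\<And>s. (\<Sum>y\<in>UNIV. Q s y) \<le> 1"
    and A: "s \<in> A" "\<And>s. s \<in> A \<Longrightarrow> (\<Sum>y\<in>UNIV. Q s y) = 1"
      "\<And>s y. s \<in> A \<Longrightarrow> Q s y \<noteq> 0 \<Longrightarrow> f s y \<in> A"
    and unique: "\<And>\<mu>. limit_flow f Q s \<mu> \<Longrightarrow> (\<And>s y. \<mu> $ (s, y) = outflow \<mu> s * Q s y) \<Longrightarrow> \<mu> = \<pi>"
    and \<epsilon>: "\<epsilon> > 0"
  defines "a \<equiv> (\<Sum>p\<in>UNIV. \<pi> $ p * (ln (Q (fst p) (snd p)) - ln (K (fst p) (snd p))))"
  shows "\<forall>\<^sub>F m in sequentially. exp (- (real m * (a + \<epsilon>))) \<le>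
    (\<Sum>ys\<in>{ys\<in>paths m. (\<forall>p. \<bar>step_freq f s ys $ p - \<pi> $ p\<bar> \<le> \<epsilon>) \<and> foldl f s ys \<in> A}.
      path_weight f K s ys)"
proof -
  let ?l = "\<lambda>p. ln (Q (fst p) (snd p)) - ln (K (fst p) (snd p))"
  define C where "C = (\<Sum>p\<in>UNIV. \<bar>?l p\<bar>)"
  have C0: "0 \<le> C" unfolding C_def by (rule sum_nonneg) auto
  \<comment> \<open>One half of \<open>\<epsilon>\<close> pays for the fluctuation of the
    log-likelihood ratio, at most \<open>\<eta> * C\<close> per step; the other half absorbs the
    factor 1/2 that concentration leaves. The summand 1 excludes a zero denominator and ensures
    \<open>\<eta> \<le> \<epsilon>\<close>.\<close>
  define \<eta> where "\<eta> = \<epsilon> / (2 * (1 + C))"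
  have \<eta>: "\<eta> > 0" "\<eta> \<le> \<epsilon>" "\<eta> * C \<le> \<epsilon> / 2"
    using \<epsilon> C0 by (auto simp: \<eta>_def field_simps mult_nonneg_nonneg)
  let ?far = "{\<mu>. \<exists>p. \<eta> \<le> \<bar>\<mu> $ p - \<pi> $ p\<bar>}"
  have "\<exists>c'>0. \<forall>\<^sub>F n in sequentially.
    (\<Sum>ys\<in>{ys\<in>paths n. step_freq f s ys \<in> ?far}. path_weight f Q s ys) \<le> exp (- (real n * c'))"
  proof (rule path_sum_decay[OF Q closed_far])
    fix \<mu> assume far: "\<mu> \<in> ?far" and lim: "limit_flow f Q s \<mu>"
    have pos: "0 < Q (fst p) (snd p)" if "\<mu> $ p \<noteq> 0" for p
      using limit_flow_properties(3)[OF lim that] Q[of "fst p" "snd p"] by simp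
    have "\<mu> \<noteq> \<pi>" using far \<eta>(1) by auto
    \<comment> \<open>A zero action would make \<open>\<mu>\<close> a flow with kernel
      \<open>Q\<close>, which \<open>unique\<close> identifies with \<open>\<pi>\<close>.\<close>
    then have "\<exists>s y. \<mu> $ (s, y) \<noteq> outflow \<mu> s * Q s y" using unique lim by blast
    then show "0 < action Q \<mu>"
      using action_nonneg[of \<mu> Q, OF limit_flow_properties(1)[OF lim] pos Q Q1] by (metis less_le)
  qed
  then obtain c' where "c' > 0" and decay: "\<forall>\<^sub>F n in sequentially.
    (\<Sum>ys\<in>{ys\<in>paths n. step_freq f s ys \<in> ?far}. path_weight f Q s ys) \<le> exp (- (real n * c'))"
    by blast
  have "((\<lambda>n. exp (- (real n * c'))) \<longlongrightarrow> 0) sequentially"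
    using \<open>c' > 0\<close> by real_asymp
  then have "\<forall>\<^sub>F n in sequentially. exp (- (real n * c')) < 1 / 2"
    by (rule order_tendstoD) simp
  moreover have "\<forall>\<^sub>F n in sequentially. exp (- (real n * (\<epsilon> / 2))) < 1 / 2"
  proof -
    have "((\<lambda>n. exp (- (real n * (\<epsilon> / 2)))) \<longlongrightarrow> 0) sequentially"
      using \<epsilon> by real_asymp
    then show ?thesis by (rule order_tendstoD) simp
  qed
  ultimately show ?thesis using decay
  proof eventually_elim
    case (elim m)
    let ?F = "{ys\<in>paths m. step_freq f s ys \<in> ?far}"
    let ?N = "{ys\<in>paths m. step_freq f s ys \<notin> ?far}"
    let ?G = "{ys\<in>paths m. (\<forall>p. \<bar>step_freq f s ys $ p - \<pi> $ p\<bar> \<le> \<epsilon>) \<and> foldl f s ys \<in> A}"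
    have "(\<Sum>ys\<in>?F \<union> ?N. path_weight f Q s ys)
        = (\<Sum>ys\<in>?F. path_weight f Q s ys) + (\<Sum>ys\<in>?N. path_weight f Q s ys)"
      by (rule sum.union_disjoint) auto
    moreover have "?F \<union> ?N = paths m" by auto
    moreover have "(\<Sum>ys\<in>paths m. path_weight f Q s ys) = 1"
      by (rule sum_path_weight_eq_1[OF A])
    ultimately have half: "1 / 2 \<le> (\<Sum>ys\<in>?N. path_weight f Q s ys)"
      using elim by simp
    have "exp (- (real m * (a + \<epsilon>))) = exp (- (real m * (\<epsilon> / 2))) * exp (- (real m * (a + \<epsilon> / 2)))"
      by (simp add: field_simps flip: exp_add)
    also have "\<dots> \<le> 1 / 2 * exp (- (real m * (a + \<epsilon> / 2)))"
      using elim by (intro mult_right_mono) auto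
    also have "\<dots> \<le> (\<Sum>ys\<in>?N. path_weight f Q s ys) * exp (- (real m * (a + \<epsilon> / 2)))"
      using half by (intro mult_right_mono) auto
    \<comment> \<open>On paths of nonzero weight under \<open>Q\<close> both kernels are positive at
      every step made, so the logarithms are genuine; such paths also end in
      \<open>A\<close>.\<close>
    also have "\<dots> = (\<Sum>ys\<in>{ys\<in>?N. path_weight f Q s ys \<noteq> 0}.
        path_weight f Q s ys * exp (- (real m * (a + \<epsilon> / 2))))"
      unfolding sum_distrib_right by (rule sum.mono_neutral_right) auto
    also have "\<dots> \<le> (\<Sum>ys\<in>{ys\<in>?N. path_weight f Q s ys \<noteq> 0}. path_weight f K s ys)"
    proof (rule sum_mono)
      fix ys assume "ys \<in> {ys\<in>?N. path_weight f Q s ys \<noteq> 0}"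
      then have len: "length ys = m" and near: "\<And>p. \<bar>step_freq f s ys $ p - \<pi> $ p\<bar> \<le> \<eta>"
        and nz: "path_weight f Q s ys \<noteq> 0"
        by (auto simp: paths_def not_le less_imp_le)
      let ?n = "step_count f s ys"
      have "path_weight f K s ys = path_weight f Q s ys * exp (- (\<Sum>p\<in>UNIV. real (?n p) * ?l p))"
        unfolding path_weight_eq_prod sum_negf[symmetric] exp_sum[OF finite] prod.distrib[symmetric]
      proof (rule prod.cong)
        fix p
        show "K (fst p) (snd p) ^ ?n p
          = Q (fst p) (snd p) ^ ?n p * exp (- (real (?n p) * ?l p))"
        proof (cases "?n p = 0")
          case False
          then have "Q (fst p) (snd p) > 0" "K (fst p) (snd p) > 0"
            using path_weight_pos_imp[OF nz, of p] Q[of "fst p" "snd p"] K[of "fst p" "snd p"]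
              QK[of "fst p" "snd p"] by auto
          then have "K (fst p) (snd p) = Q (fst p) (snd p) * exp (- ?l p)"
            by (simp add: exp_diff)
          then have "K (fst p) (snd p) ^ ?n p = Q (fst p) (snd p) ^ ?n p * exp (- ?l p) ^ ?n p"
            by (metis power_mult_distrib)
          also have "exp (- ?l p) ^ ?n p = exp (real (?n p) * - ?l p)"
            by (rule exp_of_nat_mult[symmetric])
          finally show ?thesis by (simp only: mult_minus_right)
        qed simp
      qed auto
      moreover have "(\<Sum>p\<in>UNIV. real (?n p) * ?l p) \<le> real m * (a + \<epsilon> / 2)"
      proof -
        have "(\<Sum>p\<in>UNIV. real (?n p) * ?l p) = (\<Sum>p\<in>UNIV. real m * (step_freq f s ys $ p * ?l p))"
          using len by (cases "m = 0") (simp_all add: step_freq_def)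
        also have "\<dots> = real m * (\<Sum>p\<in>UNIV. step_freq f s ys $ p * ?l p)"
          by (rule sum_distrib_left[symmetric])
        also have "(\<Sum>p\<in>UNIV. step_freq f s ys $ p * ?l p)
            = a + (\<Sum>p\<in>UNIV. (step_freq f s ys $ p - \<pi> $ p) * ?l p)"
          by (simp add: a_def left_diff_distrib sum_subtractf)
        also have "(\<Sum>p\<in>UNIV. (step_freq f s ys $ p - \<pi> $ p) * ?l p) \<le> (\<Sum>p\<in>UNIV. \<eta> * \<bar>?l p\<bar>)"
        proof (rule sum_mono)
          fix p
          have "(step_freq f s ys $ p - \<pi> $ p) * ?l p \<le> \<bar>step_freq f s ys $ p - \<pi> $ p\<bar> * \<bar>?l p\<bar>"
            unfolding abs_mult[symmetric] by (rule abs_ge_self)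
          also have "\<dots> \<le> \<eta> * \<bar>?l p\<bar>" using near by (intro mult_right_mono) auto
          finally show "(step_freq f s ys $ p - \<pi> $ p) * ?l p \<le> \<eta> * \<bar>?l p\<bar>" .
        qed
        also have "\<dots> = \<eta> * C" by (simp only: C_def sum_distrib_left)
        also have "\<dots> \<le> \<epsilon> / 2" by (rule \<eta>)
        finally show ?thesis by (simp add: mult_left_mono)
      qed
      ultimately show "path_weight f Q s ys * exp (- (real m * (a + \<epsilon> / 2))) \<le> path_weight f K s ys"
        using path_weight_nonneg[of Q f s ys, OF Q] by (simp add: mult_left_mono)
    qed
    also have "\<dots> \<le> (\<Sum>ys\<in>?G. path_weight f K s ys)"
    proof (rule sum_mono2)
      show "{ys\<in>?N. path_weight f Q s ys \<noteq> 0} \<subseteq> ?G"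
      proof
        fix ys assume ys: "ys \<in> {ys\<in>?N. path_weight f Q s ys \<noteq> 0}"
        then have "\<And>p. \<bar>step_freq f s ys $ p - \<pi> $ p\<bar> < \<eta>" by (auto simp: not_le)
        then have "\<forall>p. \<bar>step_freq f s ys $ p - \<pi> $ p\<bar> \<le> \<epsilon>"
          using \<eta>(2) by (meson less_imp_le order_trans)
        moreover have "foldl f s ys \<in> A" using ys foldl_in_closed_set[of s A Q f ys] A by blast
        ultimately show "ys \<in> ?G" using ys by blast
      qed
    qed (auto intro: path_weight_nonneg K)
    finally show ?case .
  qed
qed

section \<open>Concatenation of lower bounds\<close>

text \<open>The tolerance \<open>\<eta>\<close> in the number of steps makes these bounds composable.\<close>

definition lower_rate :: "('s \<Rightarrow> 'y \<Rightarrow> 's) \<Rightarrow> ('s \<Rightarrow> 'y \<Rightarrow> real) \<Rightarrow> 's \<Rightarrow> real \<Rightarrow>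
    real ^ ('s::finite \<times> 'y::finite) \<Rightarrow> real \<Rightarrow> bool" where
  "lower_rate f K s R V a \<longleftrightarrow> (\<forall>\<epsilon>>0. \<exists>\<eta>>0. \<forall>\<^sub>F n in sequentially. \<forall>m.
     \<bar>real m - real n * R\<bar> \<le> \<eta> * real n \<longrightarrow>
     exp (- (real n * (a + \<epsilon>))) \<le>
     (\<Sum>ys\<in>{ys\<in>paths m. \<forall>p. \<bar>real (step_count f s ys p) - real n * V $ p\<bar> \<le> \<epsilon> * real n}.
       path_weight f K s ys))"

text \<open>The end of the recursion: with \<open>\<eta> = \<epsilon>\<close>, at most
  \<open>\<epsilon> * n\<close> surplus steps remain. They cannot raise a count above the tolerance,
  so every path is good and the total weight is one.\<close>

lemma lower_rate_zero:
  fixes K :: "'s::finite \<Rightarrow> 'y::finite \<Rightarrow> real"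
  assumes "\<And>s. (\<Sum>y\<in>UNIV. K s y) = 1"
  shows "lower_rate f K s 0 0 0"
  unfolding lower_rate_def
proof (intro allI impI)
  fix \<epsilon> :: real assume \<epsilon>: "\<epsilon> > 0"
  have "exp (- (real n * (0 + \<epsilon>))) \<le>
     (\<Sum>ys\<in>{ys\<in>paths m. \<forall>p. \<bar>real (step_count f s ys p) - real n * 0 $ p\<bar> \<le> \<epsilon> * real n}.
       path_weight f K s ys)" if "\<bar>real m - real n * 0\<bar> \<le> \<epsilon> * real n" for n m
  proof -
    have "{ys\<in>paths m. \<forall>p. \<bar>real (step_count f s ys p) - real n * 0 $ p\<bar> \<le> \<epsilon> * real n} = paths m"
    proof -
      have "real (step_count f s ys p) \<le> \<epsilon> * real n" if "length ys = m" for ys p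
        using step_count_le_length[of f s ys p] that \<open>\<bar>real m - real n * 0\<bar> \<le> \<epsilon> * real n\<close> by simp
      then show ?thesis by (auto simp: paths_def)
    qed
    then show ?thesis
      using sum_path_weight_eq_1[of s UNIV K f m] assms \<epsilon> by simp
  qed
  then show "\<exists>\<eta>>0. \<forall>\<^sub>F n in sequentially. \<forall>m. \<bar>real m - real n * 0\<bar> \<le> \<eta> * real n \<longrightarrow>
     exp (- (real n * (0 + \<epsilon>))) \<le>
     (\<Sum>ys\<in>{ys\<in>paths m. \<forall>p. \<bar>real (step_count f s ys p) - real n * 0 $ p\<bar> \<le> \<epsilon> * real n}.
       path_weight f K s ys)"
    using \<epsilon> by (intro exI[of _ \<epsilon>]) auto
qed

text \<open>The Markov property in the form that weights multiply along concatenations; words of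
  fixed lengths are cut in a unique way, so nothing is counted twice. \<open>P2\<close> may depend
  on the prefix because the suffix starts where the prefix ends.\<close>

lemma sum_paths_append_ge:
  fixes K :: "'s::finite \<Rightarrow> 'y::finite \<Rightarrow> real"
  assumes K: "\<And>s y. 0 \<le> K s y" and G: "G \<subseteq> paths m1"
    and b: "\<And>xs. xs \<in> G \<Longrightarrow>
      b \<le> (\<Sum>ys\<in>{ys\<in>paths m2. P2 xs ys}. path_weight f K (foldl f s xs) ys)"
    and P: "\<And>xs ys. xs \<in> G \<Longrightarrow> length ys = m2 \<Longrightarrow> P2 xs ys \<Longrightarrow> P (xs @ ys)"
  shows "(\<Sum>xs\<in>G. path_weight f K s xs) * b \<le> (\<Sum>ys\<in>{ys\<in>paths (m1 + m2). P ys}. path_weight f K s ys)"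
proof -
  let ?w = "path_weight f K s"
  have w0: "0 \<le> path_weight f K s' ys" for s' ys by (rule path_weight_nonneg[OF K])
  have "(\<Sum>xs\<in>G. ?w xs) * b \<le>
      (\<Sum>xs\<in>G. ?w xs * (\<Sum>ys\<in>{ys\<in>paths m2. P2 xs ys}. path_weight f K (foldl f s xs) ys))"
    unfolding sum_distrib_right by (intro sum_mono mult_left_mono b w0)
  also have "\<dots> = (\<Sum>xs\<in>G. \<Sum>ys\<in>{ys\<in>paths m2. P2 xs ys}. ?w (xs @ ys))"
    by (simp add: sum_distrib_left path_weight_append)
  also have "\<dots> \<le> (\<Sum>xs\<in>G. \<Sum>ys\<in>paths m2. if P (xs @ ys) then ?w (xs @ ys) else 0)"
  proof (rule sum_mono)
    fix xs assume xs: "xs \<in> G"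
    have "(\<Sum>ys\<in>{ys\<in>paths m2. P2 xs ys}. ?w (xs @ ys))
        = (\<Sum>ys\<in>{ys\<in>paths m2. P2 xs ys}. if P (xs @ ys) then ?w (xs @ ys) else 0)"
      using P[OF xs] by (intro sum.cong) (auto simp: paths_def)
    also have "\<dots> \<le> (\<Sum>ys\<in>paths m2. if P (xs @ ys) then ?w (xs @ ys) else 0)"
      by (rule sum_mono2) (auto simp: w0)
    finally show "(\<Sum>ys\<in>{ys\<in>paths m2. P2 xs ys}. ?w (xs @ ys))
      \<le> (\<Sum>ys\<in>paths m2. if P (xs @ ys) then ?w (xs @ ys) else 0)" .
  qed
  also have "\<dots> \<le> (\<Sum>xs\<in>paths m1. \<Sum>ys\<in>paths m2. if P (xs @ ys) then ?w (xs @ ys) else 0)"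
    using G by (intro sum_mono2 finite_paths sum_nonneg) (auto simp: w0)
  also have "\<dots> = (\<Sum>ys\<in>paths (m1 + m2). if P ys then ?w ys else 0)"
    by (rule sum_paths_add[symmetric])
  also have "\<dots> = (\<Sum>ys\<in>{ys\<in>paths (m1 + m2). P ys}. ?w ys)"
    by (rule sum.inter_filter[symmetric]) simp
  finally show ?thesis .
qed

lemma eventually_real_ge: "\<forall>\<^sub>F n in sequentially. c \<le> real n"
  using filterlim_real_sequentially by (simp add: filterlim_at_top)

text \<open>Length and weight of \<open>bs\<close> do not depend on n, so the spare
  \<open>\<epsilon> / 2\<close> absorbs both. \<open>R > 0\<close> leaves room for the prefix in
  \<open>m\<close> steps once n is large.\<close>

lemma lower_rate_prefix:
  fixes K :: "'s::finite \<Rightarrow> 'y::finite \<Rightarrow> real"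
  assumes K: "\<And>s y. 0 \<le> K s y" and R: "R > 0"
    and bs: "path_weight f K s bs \<noteq> 0" and lr: "lower_rate f K (foldl f s bs) R V a"
  shows "lower_rate f K s R V a"
  unfolding lower_rate_def
proof (intro allI impI)
  fix \<epsilon> :: real assume \<epsilon>: "\<epsilon> > 0"
  let ?s = "foldl f s bs" and ?D = "real (length bs)"
  define w where "w = path_weight f K s bs"
  have w: "w > 0" using bs path_weight_nonneg[of K f s bs, OF K] by (simp add: w_def)
  obtain \<eta> where \<eta>: "\<eta> > 0" and ev: "\<forall>\<^sub>F n in sequentially. \<forall>m.
     \<bar>real m - real n * R\<bar> \<le> \<eta> * real n \<longrightarrow>
     exp (- (real n * (a + \<epsilon> / 2))) \<le>
     (\<Sum>ys\<in>{ys\<in>paths m. \<forall>p. \<bar>real (step_count f ?s ys p) - real n * V $ p\<bar> \<le> \<epsilon> / 2 * real n}.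
       path_weight f K ?s ys)"
    using lr \<epsilon> unfolding lower_rate_def by (meson half_gt_zero)
  \<comment> \<open>\<open>R / 2\<close> keeps \<open>m\<close> above \<open>n * (R / 2)\<close>,
    hence above the length of the prefix; \<open>\<eta> / 2\<close> reserves the other half of the
    tolerance for removing the prefix.\<close>
  define \<eta>' where "\<eta>' = min (\<eta> / 2) (R / 2)"
  have \<eta>': "\<eta>' > 0" "\<eta>' \<le> \<eta> / 2" "\<eta>' \<le> R / 2" using \<eta> R by (auto simp: \<eta>'_def)
  have "\<forall>\<^sub>F n in sequentially. \<forall>m. \<bar>real m - real n * R\<bar> \<le> \<eta>' * real n \<longrightarrow>
     exp (- (real n * (a + \<epsilon>))) \<le>
     (\<Sum>ys\<in>{ys\<in>paths m. \<forall>p. \<bar>real (step_count f s ys p) - real n * V $ p\<bar> \<le> \<epsilon> * real n}.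
       path_weight f K s ys)"
    using ev eventually_real_ge[of "?D / (R / 2)"] eventually_real_ge[of "?D / (\<eta> / 2)"]
      eventually_real_ge[of "?D / (\<epsilon> / 2)"] eventually_real_ge[of "- ln w / (\<epsilon> / 2)"]
  proof eventually_elim
    case (elim n)
    show ?case
    proof (intro allI impI)
      fix m assume mR: "\<bar>real m - real n * R\<bar> \<le> \<eta>' * real n"
      have D: "?D \<le> real n * (R / 2)" "?D \<le> real n * (\<eta> / 2)" "?D \<le> real n * (\<epsilon> / 2)"
        "- ln w \<le> real n * (\<epsilon> / 2)"
        using elim R \<eta> \<epsilon> by (simp_all only: pos_divide_le_eq half_gt_zero)
      have e2: "\<eta>' * real n \<le> real n * (R / 2)" "\<eta>' * real n \<le> real n * (\<eta> / 2)"
        using mult_right_mono[OF \<eta>'(3), of "real n"] mult_right_mono[OF \<eta>'(2), of "real n"]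
        by (simp_all add: mult.commute)
      have mlow: "real n * (R / 2) \<le> real m"
        using mR e2(1) by (simp add: abs_le_iff algebra_simps)
      define m2 where "m2 = m - length bs"
      have m: "m = length bs + m2" using D(1) mlow by (simp add: m2_def)
      have m2: "\<bar>real m2 - real n * R\<bar> \<le> \<eta> * real n"
        using mR D(2) e2(2) m by (simp add: abs_le_iff algebra_simps)
      let ?P2 = "\<lambda>ys. \<forall>p. \<bar>real (step_count f ?s ys p) - real n * V $ p\<bar> \<le> \<epsilon> / 2 * real n"
      let ?b = "exp (- (real n * (a + \<epsilon> / 2)))"
      have "(\<Sum>xs\<in>{bs}. path_weight f K s xs) * ?b \<le>
        (\<Sum>ys\<in>{ys\<in>paths (length bs + m2).
          \<forall>p. \<bar>real (step_count f s ys p) - real n * V $ p\<bar> \<le> \<epsilon> * real n}. path_weight f K s ys)"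
      proof (rule sum_paths_append_ge[where ?P2.0 = "\<lambda>_. ?P2"])
        fix xs ys :: "'y list"
        assume xs: "xs \<in> {bs}" and P2: "?P2 ys"
        show "\<forall>p. \<bar>real (step_count f s (xs @ ys) p) - real n * V $ p\<bar> \<le> \<epsilon> * real n"
        proof
          fix p
          have "\<bar>real (step_count f ?s ys p) - real n * V $ p\<bar> \<le> \<epsilon> / 2 * real n" using P2 by blast
          moreover have "real (step_count f s bs p) \<le> ?D" using step_count_le_length[of f s bs p] by simp
          moreover have "real (step_count f s (xs @ ys) p)
              = real (step_count f s bs p) + real (step_count f ?s ys p)"
            using xs by (simp add: step_count_append)
          moreover have "\<epsilon> * real n = 2 * (real n * (\<epsilon> / 2))" "\<epsilon> / 2 * real n = real n * (\<epsilon> / 2)"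
            by simp_all
          ultimately show "\<bar>real (step_count f s (xs @ ys) p) - real n * V $ p\<bar> \<le> \<epsilon> * real n"
            using D(3) by linarith
        qed
      qed (use elim(1) m2 K in \<open>auto simp: paths_def\<close>)
      moreover have "exp (- (real n * (a + \<epsilon>))) \<le> w * ?b"
      proof -
        have "w * ?b = exp (ln w - real n * (a + \<epsilon> / 2))" 
          using w by (simp only: diff_conv_add_uminus exp_add exp_ln)
        then show ?thesis using D(4) by (simp add: algebra_simps)
      qed
      ultimately show "exp (- (real n * (a + \<epsilon>))) \<le>
       (\<Sum>ys\<in>{ys\<in>paths m. \<forall>p. \<bar>real (step_count f s ys p) - real n * V $ p\<bar> \<le> \<epsilon> * real n}.
         path_weight f K s ys)" using m by (simp add: w_def)
    qed
  qed
  then show "\<exists>\<eta>>0. \<forall>\<^sub>F n in sequentially. \<forall>m. \<bar>real m - real n * R\<bar> \<le> \<eta> * real n \<longrightarrow>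
     exp (- (real n * (a + \<epsilon>))) \<le>
     (\<Sum>ys\<in>{ys\<in>paths m. \<forall>p. \<bar>real (step_count f s ys p) - real n * V $ p\<bar> \<le> \<epsilon> * real n}.
       path_weight f K s ys)" using \<eta>'(1) by blast
qed

text \<open>About \<open>n * r\<close> steps follow \<open>\<pi>\<close> and all others are left to
  \<open>rest\<close>. The state in which the stage ends is not controlled beyond lying in
  \<open>A\<close>, so \<open>rest\<close> must be available from every state of
  \<open>A\<close>.\<close>

lemma lower_rate_stage:
  fixes K :: "'s::finite \<Rightarrow> 'y::finite \<Rightarrow> real"
  assumes K: "\<And>s y. 0 \<le> K s y" and r: "0 < r" "r \<le> 1" and R: "0 \<le> R" and a1: "0 \<le> a1"
    and \<pi>: "\<And>p. 0 \<le> \<pi> $ p" "\<And>p. \<pi> $ p \<le> 1"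
    and stage: "\<And>\<epsilon>. \<epsilon> > 0 \<Longrightarrow> \<forall>\<^sub>F m in sequentially. exp (- (real m * (a1 + \<epsilon>))) \<le>
      (\<Sum>ys\<in>{ys\<in>paths m. (\<forall>p. \<bar>step_freq f s ys $ p - \<pi> $ p\<bar> \<le> \<epsilon>) \<and> foldl f s ys \<in> A}.
        path_weight f K s ys)"
    and rest: "\<And>s'. s' \<in> A \<Longrightarrow> lower_rate f K s' R V a"
  shows "lower_rate f K s (r + R) (r *\<^sub>R \<pi> + V) (r * a1 + a)"
  unfolding lower_rate_def
proof (intro allI impI)
  fix \<epsilon> :: real assume \<epsilon>: "\<epsilon> > 0"
  \<comment> \<open>Three errors of size \<open>\<delta> * n\<close> enter each count: the
    fluctuation within the stage, the inexact length of the stage, and the error of the rest. The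
    costs exceed their target by at most two of them.\<close>
  define \<delta> where "\<delta> = \<epsilon> / 4"
  have \<delta>: "\<delta> > 0" using \<epsilon> by (simp add: \<delta>_def)
  let ?ok = "\<lambda>\<eta> s' n. \<forall>m. \<bar>real m - real n * R\<bar> \<le> \<eta> * real n \<longrightarrow>
     exp (- (real n * (a + \<delta>))) \<le>
     (\<Sum>ys\<in>{ys\<in>paths m. \<forall>p. \<bar>real (step_count f s' ys p) - real n * V $ p\<bar> \<le> \<delta> * real n}.
       path_weight f K s' ys)"
  have "\<forall>s'\<in>A. \<exists>\<eta>>0. \<forall>\<^sub>F n in sequentially. ?ok \<eta> s' n"
    using rest \<delta> unfolding lower_rate_def by blast
  then have "\<exists>g. \<forall>s'\<in>A. g s' > 0 \<and> (\<forall>\<^sub>F n in sequentially. ?ok (g s') s' n)"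
    by (rule bchoice)
  then obtain g where g': "\<forall>s'\<in>A. g s' > 0 \<and> (\<forall>\<^sub>F n in sequentially. ?ok (g s') s' n)" ..
  have g: "g s' > 0" "\<forall>\<^sub>F n in sequentially. ?ok (g s') s' n" if "s' \<in> A" for s'
    using bspec[OF g' that] by (rule conjunct1, rule conjunct2)
  \<comment> \<open>\<open>A\<close> is finite, so one tolerance serves all end states; the inserted
    1 covers an empty \<open>A\<close>.\<close>
  define \<eta> where "\<eta> = Min (insert 1 (g ` A))"
  have \<eta>: "\<eta> > 0" "\<And>s'. s' \<in> A \<Longrightarrow> \<eta> \<le> g s'"
    using g(1) by (auto simp: \<eta>_def)
  have ev: "\<forall>\<^sub>F n in sequentially. \<forall>s'\<in>A. ?ok (g s') s' n"
    using g(2) by (intro eventually_ball_finite) auto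
  \<comment> \<open>A third of \<open>\<eta>\<close> each for the deviation of \<open>m\<close>, for
    the shortening of the stage and for rounding. \<open>r / 2\<close> makes the length of the stage
    tend to infinity, and \<open>\<delta> / 2\<close> keeps it within \<open>\<delta> * n\<close> of
    \<open>n * r\<close>.\<close>
  define \<eta>' where "\<eta>' = min (\<eta> / 3) (min (r / 2) (\<delta> / 2))"
  have \<eta>': "\<eta>' > 0" "\<eta>' \<le> \<eta> / 3" "\<eta>' \<le> r / 2" "\<eta>' \<le> \<delta> / 2"
    using \<eta> r \<delta> by (auto simp: \<eta>'_def)
  \<comment> \<open>The stage is shortened by \<open>\<eta>' * n\<close> so that it fits into every
    allowed \<open>m\<close>, even when \<open>R = 0\<close>.\<close>
  define m1 where "m1 n = nat \<lfloor>real n * (r - \<eta>')\<rfloor>" for n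
  have m1: "real (m1 n) \<le> real n * (r - \<eta>')" "real n * (r - \<eta>') - 1 < real (m1 n)" for n
  proof -
    have "0 \<le> real n * (r - \<eta>')" using \<eta>'(3) r by simp
    then show "real (m1 n) \<le> real n * (r - \<eta>')" "real n * (r - \<eta>') - 1 < real (m1 n)"
      unfolding m1_def by linarith+
  qed
  have "filterlim (\<lambda>n. real n * (r - \<eta>') - 1) at_top sequentially"
    using \<eta>'(3) r by real_asymp
  then have "filterlim (\<lambda>n. real (m1 n)) at_top sequentially"
    by (rule filterlim_at_top_mono) (auto intro!: always_eventually less_imp_le m1)
  then have "filterlim m1 at_top sequentially"
    by (simp add: filterlim_sequentially_iff_filterlim_real)
  then have ev1: "\<forall>\<^sub>F n in sequentially. exp (- (real (m1 n) * (a1 + \<delta>))) \<le>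
      (\<Sum>ys\<in>{ys\<in>paths (m1 n). (\<forall>p. \<bar>step_freq f s ys $ p - \<pi> $ p\<bar> \<le> \<delta>) \<and> foldl f s ys \<in> A}.
        path_weight f K s ys)"
    using stage[OF \<delta>] by (rule eventually_compose_filterlim[rotated])
  have "\<forall>\<^sub>F n in sequentially. \<forall>m. \<bar>real m - real n * (r + R)\<bar> \<le> \<eta>' * real n \<longrightarrow>
     exp (- (real n * (r * a1 + a + \<epsilon>))) \<le>
     (\<Sum>ys\<in>{ys\<in>paths m. \<forall>p. \<bar>real (step_count f s ys p) - real n * (r *\<^sub>R \<pi> + V) $ p\<bar> \<le> \<epsilon> * real n}.
       path_weight f K s ys)"
    using ev ev1 eventually_real_ge[of "1 / (\<eta> / 3)"] eventually_real_ge[of "1 / (\<delta> / 2)"]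
  proof eventually_elim
    case (elim n)
    show ?case
    proof (intro allI impI)
      fix m assume mR: "\<bar>real m - real n * (r + R)\<bar> \<le> \<eta>' * real n"
      have D: "1 \<le> real n * (\<eta> / 3)" "1 \<le> real n * (\<delta> / 2)"
        using elim(3,4) \<eta>(1) \<delta> by (simp_all add: pos_divide_le_eq)
      have e: "\<eta>' * real n \<le> real n * (\<eta> / 3)" "\<eta>' * real n \<le> real n * (\<delta> / 2)"
        using mult_right_mono[OF \<eta>'(2), of "real n"] mult_right_mono[OF \<eta>'(4), of "real n"]
        by (simp_all add: mult.commute)
      have nR: "0 \<le> real n * R" using R by simp
      have n\<eta>': "0 \<le> real n * \<eta>'" using \<eta>'(1) by simp
      have "real (m1 n) \<le> real m"
        using m1(1)[of n] mR nR by (simp add: abs_le_iff algebra_simps)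
      define m2 where "m2 = m - m1 n"
      have m: "m = m1 n + m2" using \<open>real (m1 n) \<le> real m\<close> by (simp add: m2_def)
      have m2: "\<bar>real m2 - real n * R\<bar> \<le> g s' * real n" if "s' \<in> A" for s'
      proof -
        have "\<bar>real m2 - real n * R\<bar> \<le> \<eta> * real n"
          using mR m1[of n] D(1) e(1) m by (simp add: abs_le_iff algebra_simps)
        also have "\<dots> \<le> g s' * real n" using \<eta>(2)[OF that] by (rule mult_right_mono) simp
        finally show ?thesis .
      qed
      let ?G = "{ys\<in>paths (m1 n). (\<forall>p. \<bar>step_freq f s ys $ p - \<pi> $ p\<bar> \<le> \<delta>) \<and> foldl f s ys \<in> A}"
      let ?b = "exp (- (real n * (a + \<delta>)))"
      have "exp (- (real n * (r * a1 + a + \<epsilon>))) \<le> exp (- (real (m1 n) * (a1 + \<delta>))) * ?b"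
      proof -
        have "real (m1 n) \<le> real n * r"
          using m1(1)[of n] n\<eta>' by (simp add: algebra_simps)
        then have "real (m1 n) * (a1 + \<delta>) \<le> real n * r * (a1 + \<delta>)"
          using a1 \<delta> by (intro mult_right_mono) auto
        also have "\<dots> \<le> real n * (r * a1 + \<delta>)"
        proof -
          have "r * \<delta> \<le> 1 * \<delta>" using r \<delta> by (intro mult_right_mono) auto
          then have "real n * (r * \<delta>) \<le> real n * \<delta>" by (intro mult_left_mono) auto
          then show ?thesis by (simp add: algebra_simps)
        qed
        finally have "real (m1 n) * (a1 + \<delta>) + real n * (a + \<delta>) \<le> real n * (r * a1 + a + \<epsilon>)"
          using mult_nonneg_nonneg[OF less_imp_le[OF \<epsilon>], of "real n"]
          by (simp add: \<delta>_def algebra_simps)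
        then show ?thesis by (simp flip: exp_add)
      qed
      also have "\<dots> \<le> (\<Sum>xs\<in>?G. path_weight f K s xs) * ?b"
        using elim(2) by (rule mult_right_mono) simp
      also have "\<dots> \<le> (\<Sum>ys\<in>{ys\<in>paths (m1 n + m2).
          \<forall>p. \<bar>real (step_count f s ys p) - real n * (r *\<^sub>R \<pi> + V) $ p\<bar> \<le> \<epsilon> * real n}.
          path_weight f K s ys)"
      proof (rule sum_paths_append_ge[OF K, where ?P2.0 = "\<lambda>xs ys.
          \<forall>p. \<bar>real (step_count f (foldl f s xs) ys p) - real n * V $ p\<bar> \<le> \<delta> * real n"])
        fix xs assume "xs \<in> ?G"
        then show "?b \<le> (\<Sum>ys\<in>{ys\<in>paths m2.
          \<forall>p. \<bar>real (step_count f (foldl f s xs) ys p) - real n * V $ p\<bar> \<le> \<delta> * real n}.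
          path_weight f K (foldl f s xs) ys)"
          using elim(1) m2 by blast
      next
        fix xs ys
        assume xs: "xs \<in> ?G" and ys: "\<forall>p. \<bar>real (step_count f (foldl f s xs) ys p) - real n * V $ p\<bar> \<le> \<delta> * real n"
        show "\<forall>p. \<bar>real (step_count f s (xs @ ys) p) - real n * (r *\<^sub>R \<pi> + V) $ p\<bar> \<le> \<epsilon> * real n"
        proof
          fix p
          have len: "length xs = m1 n" using xs by (simp add: paths_def)
          have "real (step_count f s xs p) - real (m1 n) * \<pi> $ p
              = real (m1 n) * (step_freq f s xs $ p - \<pi> $ p)"
            using len by (cases "m1 n = 0") (simp_all add: step_freq_def algebra_simps)
          then have "\<bar>real (step_count f s xs p) - real (m1 n) * \<pi> $ p\<bar>
              = real (m1 n) * \<bar>step_freq f s xs $ p - \<pi> $ p\<bar>"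
            by (simp add: abs_mult)
          also have "\<dots> \<le> real n * \<delta>"
          proof (rule mult_mono)
            show "real (m1 n) \<le> real n"
            proof -
              have "real n * (r - \<eta>') \<le> real n * 1" using r \<eta>' by (intro mult_left_mono) auto
              then show ?thesis using m1(1)[of n] by simp
            qed
            show "\<bar>step_freq f s xs $ p - \<pi> $ p\<bar> \<le> \<delta>" using xs by blast
          qed simp_all
          finally have 1: "\<bar>real (step_count f s xs p) - real (m1 n) * \<pi> $ p\<bar> \<le> real n * \<delta>" .
          have "\<bar>real (m1 n) - real n * r\<bar> \<le> real n * \<delta>"
            using m1[of n] e(2) D(2) n\<eta>' by (simp add: abs_le_iff algebra_simps)
          then have "\<bar>real (m1 n) - real n * r\<bar> * \<pi> $ p \<le> real n * \<delta> * 1"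
            using \<pi>[of p] \<delta> by (intro mult_mono) auto
          then have 2: "\<bar>real (m1 n) * \<pi> $ p - real n * r * \<pi> $ p\<bar> \<le> real n * \<delta>"
            using \<pi>(1)[of p] by (simp add: abs_mult flip: left_diff_distrib)
          have 3: "\<bar>real (step_count f (foldl f s xs) ys p) - real n * V $ p\<bar> \<le> \<delta> * real n"
            using ys by blast
          have 4: "\<epsilon> * real n = 4 * (real n * \<delta>)" "\<delta> * real n = real n * \<delta>" "0 \<le> real n * \<delta>"
            using \<delta> by (simp_all add: \<delta>_def)
          have "real (step_count f s (xs @ ys) p) - real n * (r *\<^sub>R \<pi> + V) $ p
            = (real (step_count f s xs p) - real (m1 n) * \<pi> $ p)
            + (real (m1 n) * \<pi> $ p - real n * r * \<pi> $ p)
            + (real (step_count f (foldl f s xs) ys p) - real n * V $ p)"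
            by (simp add: step_count_append algebra_simps)
          then show "\<bar>real (step_count f s (xs @ ys) p) - real n * (r *\<^sub>R \<pi> + V) $ p\<bar> \<le> \<epsilon> * real n"
            using 1 2 3 4 by linarith
        qed
      qed auto
      finally show "exp (- (real n * (r * a1 + a + \<epsilon>))) \<le>
       (\<Sum>ys\<in>{ys\<in>paths m. \<forall>p. \<bar>real (step_count f s ys p) - real n * (r *\<^sub>R \<pi> + V) $ p\<bar> \<le> \<epsilon> * real n}.
         path_weight f K s ys)" using m by simp
    qed
  qed
  then show "\<exists>\<eta>>0. \<forall>\<^sub>F n in sequentially. \<forall>m. \<bar>real m - real n * (r + R)\<bar> \<le> \<eta> * real n \<longrightarrow>
     exp (- (real n * (r * a1 + a + \<epsilon>))) \<le>
     (\<Sum>ys\<in>{ys\<in>paths m. \<forall>p. \<bar>real (step_count f s ys p) - real n * (r *\<^sub>R \<pi> + V) $ p\<bar> \<le> \<epsilon> * real n}.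
       path_weight f K s ys)" using \<eta>'(1) by blast
qed

section \<open>Traversed edges and positions\<close>

definition orrw_next :: "'v set set \<times> 'v \<Rightarrow> 'v \<Rightarrow> 'v set set \<times> 'v" where
  "orrw_next s y = (insert {snd s, y} (fst s), y)"

definition orrw_kernel :: "'v::finite set set \<Rightarrow> real \<Rightarrow> 'v set set \<times> 'v \<Rightarrow> 'v \<Rightarrow> real" where
  "orrw_kernel E \<delta> s y = step_prob E \<delta> (fst s) (snd s) y"

text \<open>The value \<open>{x0}\<close> at the empty list puts the first edge under the same
  incidence condition as all later ones.\<close>

definition reach :: "'v \<Rightarrow> 'v set list \<Rightarrow> 'v set" where
  "reach x0 es = (if es = [] then {x0} else \<Union>(set es))"

text \<open>The shape of the list of edges in their order of first traversal. Its prefixes become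
  the sets of an edge sequence.\<close>

inductive growing :: "'v set set \<Rightarrow> 'v \<Rightarrow> 'v set list \<Rightarrow> bool" for E x0 where
  growing_Nil: "growing E x0 []"
| growing_snoc: "growing E x0 es \<Longrightarrow> e \<in> E \<Longrightarrow> e \<notin> set es \<Longrightarrow> e \<inter> reach x0 es \<noteq> {} \<Longrightarrow>
    growing E x0 (es @ [e])"

text \<open>A charged step stays inside its edge set \<open>S\<close>, so balance at
  \<open>(S, x)\<close> involves only arrivals from states with the same \<open>S\<close>. All
  conditions are closed, and for fixed \<open>F\<close> they are convex.\<close>

definition admissible_flows ::
    "'v::finite set set \<Rightarrow> (nat \<Rightarrow> 'v set set) \<Rightarrow> (real ^ (('v set set \<times> 'v) \<times> 'v)) set" where
  "admissible_flows E F = {\<mu>. (\<forall>p. 0 \<le> \<mu> $ p) \<and> (\<Sum>p\<in>UNIV. \<mu> $ p) = 1 \<and>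
     (\<forall>S x y. \<mu> $ ((S, x), y) \<noteq> 0 \<longrightarrow> S \<in> F ` {1..card E} \<and> {x, y} \<in> S) \<and>
     (\<forall>S x. outflow \<mu> (S, x) = (\<Sum>y\<in>UNIV. \<mu> $ ((S, y), x)))}"

lemma compact_admissible_flows: "compact (admissible_flows E F)"
proof -
  \<comment> \<open>A support condition only forbids mass: it is vacuous, or it says that one
    coordinate vanishes.\<close>
  have "closed {\<mu> :: real ^ (('a set set \<times> 'a) \<times> 'a). \<mu> $ p \<noteq> 0 \<longrightarrow> Q}" for p Q
    by (cases Q) (auto intro!: closed_Collect_eq continuous_intros)
  then have c: "closed {\<mu> :: real ^ (('a set set \<times> 'a) \<times> 'a).
      \<forall>S x y. \<mu> $ ((S, x), y) \<noteq> 0 \<longrightarrow> S \<in> F ` {1..card E} \<and> {x, y} \<in> S}"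
    by (intro closed_Collect_all)
  have "closed (admissible_flows E F)"
    unfolding admissible_flows_def outflow_def
    by (intro closed_Collect_conj closed_Collect_all closed_Collect_le closed_Collect_eq c
        continuous_intros)
  moreover have "admissible_flows E F \<subseteq> cbox 0 1"
  proof
    fix \<mu> assume \<mu>: "\<mu> \<in> admissible_flows E F"
    have "\<mu> $ p \<le> 1" for p
      using member_le_sum[of p UNIV "\<lambda>p. \<mu> $ p"] \<mu> by (auto simp: admissible_flows_def)
    then show "\<mu> \<in> cbox 0 1" using \<mu> by (simp add: mem_box_cart admissible_flows_def)
  qed
  ultimately show ?thesis
    by (meson bounded_cbox bounded_subset compact_eq_bounded_closed)
qed

lemma growing_nth:
  assumes "growing E x0 es" "k < length es"
  shows "es ! k \<in> E \<and> es ! k \<notin> set (take k es) \<and> es ! k \<inter> reach x0 (take k es) \<noteq> {}"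
  using assms
proof (induction rule: growing.induct)
  case (growing_snoc es e)
  then show ?case by (cases "k = length es") (auto simp: nth_append)
qed simp

lemma growing_distinct: "growing E x0 es \<Longrightarrow> distinct es \<and> set es \<subseteq> E"
  by (induction rule: growing.induct) auto

lemma growing_edge_sequence:
  assumes g: "growing E x0 es" and len: "length es = card E" and E: "simple_graph E" "E \<noteq> {}"
    and "finite E"
  shows "(\<lambda>k. set (take k es)) \<in> edge_sequences E x0"
proof -
  have d: "distinct es" "set es \<subseteq> E" using growing_distinct[OF g] by auto
  have ne: "es \<noteq> []" using len E \<open>finite E\<close> by auto
  have 1: "set (take k es) \<subseteq> E \<and> card (set (take k es)) = k" if "k \<in> {1..card E}" for k
  proof -
    have "set (take k es) \<subseteq> set es" by (rule set_take_subset)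
    then show ?thesis using that d len by (auto simp: distinct_card[OF distinct_take] min_def)
  qed
  have 2: "\<exists>v. set (take 1 es) = {{x0, v}}"
  proof -
    have "take 1 es = [es ! 0]" using ne by (cases es) auto
    moreover have e0: "es ! 0 \<in> E" "x0 \<in> es ! 0" using growing_nth[OF g, of 0] ne by (auto simp: reach_def)
    moreover obtain a b where "es ! 0 = {a, b}"
      using E(1) e0 by (auto simp: simple_graph_def card_2_iff)
    ultimately show ?thesis by auto
  qed
  have 3: "set (take k es) \<subseteq> set (take (Suc k) es) \<and>
      (\<forall>e\<in>set (take (Suc k) es) - set (take k es). \<exists>f\<in>set (take k es). e \<inter> f \<noteq> {})"
    if k: "k \<in> {1..<card E}" for k
  proof -
    have k': "k < length es" using k len by simp
    have t: "take k es \<noteq> []" using k k' by auto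
    have "take (Suc k) es = take k es @ [es ! k]" using k' by (rule take_Suc_conv_app_nth)
    then show ?thesis using growing_nth[OF g k'] t by (auto simp: reach_def)
  qed
  show ?thesis
    unfolding edge_sequences_def mem_Collect_eq using 1 2 3 by (intro conjI ballI) simp_all
qed

text \<open>Flows are indexed by edge sets and families by stages; the cardinality of
  \<open>F k\<close> recovers the stage from the set.\<close>

lemma edge_sequence_inj:
  assumes "F \<in> edge_sequences E x0"
  shows "inj_on F {1..card E}"
proof (rule inj_onI)
  have c: "card (F k) = k" if "k \<in> {1..card E}" for k
    using assms that by (auto simp: edge_sequences_def)
  fix j k assume jk: "j \<in> {1..card E}" "k \<in> {1..card E}" "F j = F k"
  show "j = k" using c[OF jk(1)] c[OF jk(2)] unfolding jk(3) by (rule trans[OF sym])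
qed

lemma rtrancl_edges_mono:
  assumes "(x, y) \<in> {(u, v). {u, v} \<in> S}\<^sup>*" "S \<subseteq> T"
  shows "(x, y) \<in> {(u, v). {u, v} \<in> T}\<^sup>*"
  by (rule subsetD[OF rtrancl_mono assms(1)]) (use assms(2) in auto)

text \<open>Each new edge meets an earlier one. Both directions are carried along so that any two
  vertices of a stage can be joined through \<open>x0\<close>.\<close>

lemma edge_sequence_connected:
  assumes F: "F \<in> edge_sequences E x0" and E: "simple_graph E" and k: "k \<in> {1..card E}"
  shows "\<forall>x\<in>\<Union>(F k). (x0, x) \<in> {(u, v). {u, v} \<in> F k}\<^sup>* \<and> (x, x0) \<in> {(u, v). {u, v} \<in> F k}\<^sup>*"
  using k
proof (induction k)
  case (Suc k)
  show ?case
  proof (cases "k = 0")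
    case True
    then obtain v where v: "F (Suc k) = {{x0, v}}" using F by (auto simp: edge_sequences_def)
    have "(x0, v) \<in> {(u, v). {u, v} \<in> F (Suc k)}\<^sup>*" "(v, x0) \<in> {(u, v). {u, v} \<in> F (Suc k)}\<^sup>*"
      unfolding v by (rule r_into_rtrancl, simp add: insert_commute)+
    then show ?thesis by (auto simp: v)
  next
    case False
    then have k: "k \<in> {1..<card E}" "k \<in> {1..card E}" using Suc.prems by auto
    have sub: "F k \<subseteq> F (Suc k)" "F (Suc k) \<subseteq> E"
      and new: "\<And>e. e \<in> F (Suc k) - F k \<Longrightarrow> \<exists>f\<in>F k. e \<inter> f \<noteq> {}"
      using F k Suc.prems unfolding edge_sequences_def by blast+
    let ?R = "{(u, v). {u, v} \<in> F (Suc k)}\<^sup>*"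
    have old: "(x0, x) \<in> ?R \<and> (x, x0) \<in> ?R" if "x \<in> \<Union>(F k)" for x
      using Suc.IH[OF k(2), THEN bspec, OF that] rtrancl_edges_mono[OF _ sub(1)] by blast
    show ?thesis
    proof
      fix x assume "x \<in> \<Union>(F (Suc k))"
      then obtain e where e: "e \<in> F (Suc k)" "x \<in> e" by blast
      show "(x0, x) \<in> ?R \<and> (x, x0) \<in> ?R"
      proof (cases "e \<in> F k")
        case True
        then show ?thesis using old e by blast
      next
        case False
        then obtain f z where z: "f \<in> F k" "z \<in> e" "z \<in> f" using new e by blast
        have "card e = 2" using e sub E by (auto simp: simple_graph_def)
        then obtain a b where ab: "e = {a, b}" by (auto simp: card_2_iff)
        have "(z, x) \<in> ?R \<and> (x, z) \<in> ?R"
          using e z ab by (auto intro!: r_into_rtrancl simp: insert_commute)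
        moreover have "(x0, z) \<in> ?R \<and> (z, x0) \<in> ?R" using old z by blast
        ultimately show ?thesis by (meson rtrancl_trans)
      qed
    qed
  qed
qed simp

text \<open>Traversing an old edge leaves the edge set unchanged. A charged step along a new edge
  would instead arrive from a strictly smaller set, which \<open>old\<close> excludes.\<close>

lemma inflow_orrw_next:
  fixes \<mu> :: "real ^ (('v::finite set set \<times> 'v) \<times> 'v)"
  assumes old: "\<And>S x y. \<mu> $ ((S, x), y) \<noteq> 0 \<Longrightarrow> {x, y} \<in> S"
  shows "inflow orrw_next \<mu> (S, x) = (\<Sum>y\<in>UNIV. \<mu> $ ((S, y), x))"
proof -
  have "inflow orrw_next \<mu> (S, x) = (\<Sum>s\<in>UNIV. \<Sum>y\<in>UNIV. of_bool (orrw_next s y = (S, x)) * \<mu> $ (s, y))"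
    by (simp only: inflow_def sum.cartesian_product UNIV_Times_UNIV case_prod_unfold prod.collapse)
  also have "\<dots> = (\<Sum>s\<in>UNIV. \<Sum>y\<in>UNIV. if y = x then of_bool (fst s = S) * \<mu> $ (s, x) else 0)"
  proof (intro sum.cong refl)
    fix s :: "'v set set \<times> 'v" and y
    show "of_bool (orrw_next s y = (S, x)) * \<mu> $ (s, y)
        = (if y = x then of_bool (fst s = S) * \<mu> $ (s, x) else 0)"
    proof (cases "\<mu> $ (s, y) = 0")
      case False
      then have "{snd s, y} \<in> fst s" using old[of "fst s" "snd s" y] by simp
      then show ?thesis by (auto simp: orrw_next_def insert_absorb)
    qed auto
  qed
  also have "\<dots> = (\<Sum>s\<in>UNIV. of_bool (fst s = S) * \<mu> $ (s, x))" by simp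
  also have "\<dots> = (\<Sum>T\<in>UNIV. \<Sum>y\<in>UNIV. of_bool (T = S) * \<mu> $ ((T, y), x))"
    by (simp only: sum.cartesian_product UNIV_Times_UNIV case_prod_unfold prod.collapse)
  also have "\<dots> = (\<Sum>T\<in>UNIV. if T = S then \<Sum>y\<in>UNIV. \<mu> $ ((S, y), x) else 0)"
    by (intro sum.cong refl) auto
  also have "\<dots> = (\<Sum>y\<in>UNIV. \<mu> $ ((S, y), x))" by simp
  finally show ?thesis .
qed

section \<open>The walk on a connected graph and its limiting flows\<close>

locale once_reinforced =
  fixes E :: "'v::finite set set" and x0 :: 'v and \<delta> :: real
  assumes simple: "simple_graph E" and connected: "connected_graph E"
    and card_V: "CARD('v) \<ge> 3" and \<delta>_pos: "\<delta> > 0"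
begin

abbreviation "K \<equiv> orrw_kernel E \<delta>"
abbreviation "b \<equiv> card E"

lemma neighbour_closed_eq_UNIV:
  assumes "x \<in> A" "\<And>u v. u \<in> A \<Longrightarrow> {u, v} \<in> E \<Longrightarrow> v \<in> A"
  shows "A = UNIV"
proof -
  have "y \<in> A" for y
  proof -
    have "(x, y) \<in> {(u, v). {u, v} \<in> E}\<^sup>*" using connected by (simp add: connected_graph_def)
    then show ?thesis by (induction) (use assms in auto)
  qed
  then show ?thesis by auto
qed

lemma ex_neighbour: "\<exists>z. {x, z} \<in> E"
proof (rule ccontr)
  assume "\<not> ?thesis"
  then have "{x} = UNIV" by (intro neighbour_closed_eq_UNIV) auto
  then have "CARD('v) = card {x}" by simp
  then show False using card_V by simp
qed

lemma Union_E: "\<Union>E = UNIV"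
  using ex_neighbour by blast

lemma E_ne: "E \<noteq> {}" and b_pos: "b \<ge> 1"
proof -
  show "E \<noteq> {}" using ex_neighbour by blast
  then show "b \<ge> 1" by (simp add: Suc_le_eq card_gt_0_iff)
qed

lemma step_prob_denom_pos: "0 < (\<Sum>z | {x, z} \<in> E. edge_weight \<delta> S {x, z})"
  using ex_neighbour[of x] \<delta>_pos by (intro sum_pos) (auto simp: edge_weight_def)

lemma step_prob_nonneg: "0 \<le> step_prob E \<delta> S x y"
  using step_prob_denom_pos[of S x] \<delta>_pos by (auto simp: step_prob_def edge_weight_def)

lemma step_prob_pos_iff: "0 < step_prob E \<delta> S x y \<longleftrightarrow> {x, y} \<in> E"
  using step_prob_denom_pos[of S x] \<delta>_pos by (auto simp: step_prob_def edge_weight_def)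

lemma sum_step_prob: "(\<Sum>y\<in>UNIV. step_prob E \<delta> S x y) = 1"
proof -
  have "(\<Sum>y\<in>UNIV. step_prob E \<delta> S x y)
      = (\<Sum>y | {x, y} \<in> E. edge_weight \<delta> S {x, y} / (\<Sum>z | {x, z} \<in> E. edge_weight \<delta> S {x, z}))"
    by (simp add: step_prob_def sum.If_cases)
  then show ?thesis using step_prob_denom_pos[of S x] by (simp flip: sum_divide_distrib)
qed

lemma kernel_nonneg: "0 \<le> K s y"
  by (simp add: orrw_kernel_def step_prob_nonneg)

lemma kernel_pos_iff: "0 < K s y \<longleftrightarrow> {snd s, y} \<in> E"
  by (simp add: orrw_kernel_def step_prob_pos_iff)

lemma kernel_nz_iff: "K s y \<noteq> 0 \<longleftrightarrow> {snd s, y} \<in> E"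
  using kernel_pos_iff[of s y] kernel_nonneg[of s y] by linarith

lemma sum_kernel: "(\<Sum>y\<in>UNIV. K s y) = 1"
  by (simp add: orrw_kernel_def sum_step_prob)

text \<open>A path may leave edges untouched, while an edge sequence has \<open>b\<close> members.
  As long as an edge is missing, connectedness supplies a missing edge that meets the reached
  vertices.\<close>

lemma growing_extend:
  assumes "growing E x0 es"
  shows "\<exists>zs. growing E x0 (es @ zs) \<and> length (es @ zs) = b"
  using assms
proof (induction "b - length es" arbitrary: es)
  case 0
  have "length es \<le> b"
    using growing_distinct[OF "0.prems"] by (metis card_mono distinct_card finite_code)
  then show ?case using 0 by (intro exI[of _ "[]"]) simp
next
  case (Suc n)
  have d: "distinct es" "set es \<subseteq> E" using growing_distinct[OF Suc.prems] by auto
  have "card (set es) < b" using Suc.hyps(2) d by (simp add: distinct_card)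
  then have ex: "\<exists>e\<in>E. e \<notin> set es" using d(2) by (metis less_irrefl subsetI subset_antisym)
  have "\<exists>e\<in>E. e \<notin> set es \<and> e \<inter> reach x0 es \<noteq> {}"
  proof (rule ccontr)
    assume no: "\<not> ?thesis"
    have "es \<noteq> []"
    proof
      assume "es = []"
      obtain z where "{x0, z} \<in> E" using ex_neighbour by blast
      then show False using no \<open>es = []\<close> by (auto simp: reach_def)
    qed
    then obtain x where x: "x \<in> reach x0 es"
    proof -
      have "hd es \<in> E" using d(2) \<open>es \<noteq> []\<close> by auto
      then have "hd es \<noteq> {}" using simple by (auto simp: simple_graph_def)
      then show ?thesis using that \<open>es \<noteq> []\<close> unfolding reach_def by (metis UnionI all_not_in_conv list.set_sel(1))
    qed
    have "reach x0 es = UNIV"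
    proof (rule neighbour_closed_eq_UNIV[OF x])
      fix u v assume "u \<in> reach x0 es" "{u, v} \<in> E"
      then show "v \<in> reach x0 es" using no \<open>es \<noteq> []\<close> by (auto simp: reach_def)
    qed
    moreover obtain e where "e \<in> E" "e \<notin> set es" using ex by blast
    moreover have "e \<noteq> {}" using \<open>e \<in> E\<close> simple by (auto simp: simple_graph_def)
    ultimately show False using no by auto
  qed
  then obtain e where "growing E x0 (es @ [e])" using growing_snoc[OF Suc.prems] by blast
  then have "\<exists>zs. growing E x0 ((es @ [e]) @ zs) \<and> length ((es @ [e]) @ zs) = b"
    using Suc.hyps(2) by (intro Suc.hyps(1)) auto
  then show ?case by (metis append.assoc)
qed

lemma edge_sequences_ne: "edge_sequences E x0 \<noteq> {}"
proof -
  obtain zs where "growing E x0 zs" "length zs = b" using growing_extend[OF growing_Nil] by auto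
  then show ?thesis using growing_edge_sequence simple E_ne by (metis empty_iff finite_code)
qed

text \<open>Recording each edge at its first traversal gives a growing list, and the edge set of
  every state from which a step is made is a prefix of it. The induction needs the start at an
  arbitrary list \<open>es\<close> and a vertex reached by it.\<close>

lemma path_edge_sequence:
  assumes "growing E x0 es" "x \<in> reach x0 es" "path_weight orrw_next K (set es, x) ys \<noteq> 0"
  shows "\<exists>zs. growing E x0 (es @ zs) \<and> length (es @ zs) = b \<and>
    (\<forall>p. step_count orrw_next (set es, x) ys p > 0 \<longrightarrow> (\<exists>k\<le>b. fst (fst p) = set (take k (es @ zs))))"
  using assms
proof (induction ys arbitrary: es x)
  case Nil
  then show ?case using growing_extend[OF Nil.prems(1)] by simp
next
  case (Cons y ys)
  have xy: "{x, y} \<in> E" and w: "path_weight orrw_next K (insert {x, y} (set es), y) ys \<noteq> 0"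
    using Cons.prems(3) kernel_nz_iff[of "(set es, x)" y]
    by (simp_all add: orrw_next_def[of "(set es, x)"])
  have "\<exists>zs. growing E x0 (es @ zs) \<and> length (es @ zs) = b \<and>
    (\<forall>p. step_count orrw_next (insert {x, y} (set es), y) ys p > 0 \<longrightarrow>
      (\<exists>k\<le>b. fst (fst p) = set (take k (es @ zs))))"
  proof (cases "{x, y} \<in> set es")
    case True
    then have "y \<in> reach x0 es" by (auto simp: reach_def)
    then show ?thesis using Cons.IH[OF Cons.prems(1), of y] w True by (simp add: insert_absorb)
  next
    case False
    have g: "growing E x0 (es @ [{x, y}])"
      using Cons.prems xy False by (intro growing_snoc) auto
    have r: "y \<in> reach x0 (es @ [{x, y}])" by (simp add: reach_def)
    obtain zs where "growing E x0 ((es @ [{x, y}]) @ zs)" "length ((es @ [{x, y}]) @ zs) = b"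
      "\<forall>p. step_count orrw_next (insert {x, y} (set es), y) ys p > 0 \<longrightarrow>
        (\<exists>k\<le>b. fst (fst p) = set (take k ((es @ [{x, y}]) @ zs)))"
      using Cons.IH[OF g r] w by auto
    then show ?thesis by (intro exI[of _ "{x, y} # zs"]) auto
  qed
  then obtain zs where zs: "growing E x0 (es @ zs)" "length (es @ zs) = b"
    "\<And>p. step_count orrw_next (insert {x, y} (set es), y) ys p > 0 \<Longrightarrow>
      \<exists>k\<le>b. fst (fst p) = set (take k (es @ zs))" by blast
  have "\<exists>k\<le>b. fst (fst p) = set (take k (es @ zs))"
    if "step_count orrw_next (set es, x) (y # ys) p > 0" for p
  proof (cases "p = ((set es, x), y)")
    case True
    then show ?thesis using zs(2) by (intro exI[of _ "length es"]) auto
  next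
    case False
    then show ?thesis using that zs(3)[of p] by (simp add: orrw_next_def)
  qed
  then show ?case using zs by blast
qed

text \<open>The number of traversed edges never decreases, and its mean increment vanishes in a
  balanced flow, so a limiting flow does not charge the steps that traverse a new edge.\<close>

lemma limit_flow_admissible:
  assumes lim: "limit_flow orrw_next K ({}, x0) \<mu>"
  shows "\<exists>F\<in>edge_sequences E x0. \<mu> \<in> admissible_flows E F"
proof -
  note props = limit_flow_properties[OF lim]
  let ?h = "\<lambda>s :: 'v set set \<times> 'v. real (card (fst s))"
  let ?d = "\<lambda>p. ?h (orrw_next (fst p) (snd p)) - ?h (fst p)"
  have "(\<Sum>p\<in>UNIV. \<mu> $ p * ?d p) = 0"
    using sum_inflow_mult[of orrw_next \<mu> ?h] sum_outflow_mult[of \<mu> ?h] props(4)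
    by (simp add: right_diff_distrib sum_subtractf)
  moreover have d0: "0 \<le> ?d p" for p
    by (simp add: orrw_next_def card_insert_le)
  ultimately have zero: "\<mu> $ p * ?d p = 0" for p
    using sum_nonneg_eq_0_iff[of UNIV "\<lambda>p. \<mu> $ p * ?d p"] props(1)
    by (metis (no_types, lifting) UNIV_I finite mult_nonneg_nonneg)
  have old: "{x, y} \<in> S" if "\<mu> $ ((S, x), y) \<noteq> 0" for S x y
  proof (rule ccontr)
    assume "{x, y} \<notin> S"
    then show False using zero[of "((S, x), y)"] that by (simp add: orrw_next_def)
  qed
  obtain ys where ys: "path_weight orrw_next K ({}, x0) ys \<noteq> 0"
    "\<And>p. \<mu> $ p \<noteq> 0 \<Longrightarrow> step_count orrw_next ({}, x0) ys p > 0"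
    using limit_flow_realized[OF lim] by blast
  obtain es where es: "growing E x0 es" "length es = b"
    "\<And>p. step_count orrw_next ({}, x0) ys p > 0 \<Longrightarrow> \<exists>k\<le>b. fst (fst p) = set (take k es)"
  proof -
    have "x0 \<in> reach x0 []" "path_weight orrw_next K (set [], x0) ys \<noteq> 0"
      using ys(1) by (simp_all add: reach_def)
    from path_edge_sequence[OF growing_Nil this] obtain zs where
      "growing E x0 ([] @ zs)" "length ([] @ zs) = b"
      "\<forall>p. step_count orrw_next (set [], x0) ys p > 0 \<longrightarrow> (\<exists>k\<le>b. fst (fst p) = set (take k ([] @ zs)))"
      by blast
    then show ?thesis unfolding append_Nil list.set(1) using that by blast
  qed
  let ?F = "\<lambda>k. set (take k es)"
  have F: "?F \<in> edge_sequences E x0"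
    by (rule growing_edge_sequence[OF es(1,2) simple E_ne finite])
  have supp: "S \<in> ?F ` {1..b}" if nz: "\<mu> $ ((S, x), y) \<noteq> 0" for S x y
  proof -
    obtain k where k: "k \<le> b" "S = ?F k" using es(3)[OF ys(2)[OF nz]] by auto
    \<comment> \<open>A charged step lies in its own edge set, so the empty prefix is
      excluded.\<close>
    moreover have "k \<noteq> 0" using k old[OF nz] by (cases k) auto
    ultimately show ?thesis by (auto simp: image_iff Suc_le_eq)
  qed
  have "outflow \<mu> (S, x) = (\<Sum>y\<in>UNIV. \<mu> $ ((S, y), x))" for S x
  proof -
    have "outflow \<mu> (S, x) = inflow orrw_next \<mu> (S, x)" by (rule props(4))
    also have "\<dots> = (\<Sum>y\<in>UNIV. \<mu> $ ((S, y), x))" using old by (rule inflow_orrw_next)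
    finally show ?thesis .
  qed
  then have "\<mu> \<in> admissible_flows E ?F"
    using props(1,2) supp old by (auto simp: admissible_flows_def)
  then show ?thesis using F by blast
qed

end

section \<open>The lower bound for positive flows\<close>

context once_reinforced begin

lemma edge_sequenceD:
  assumes F: "F \<in> edge_sequences E x0" and k: "k \<in> {1..b}"
  shows "F k \<subseteq> E" "card (F k) = k"
  using assms by (auto simp: edge_sequences_def)

lemma new_edge:
  assumes F: "F \<in> edge_sequences E x0" and k: "k \<in> {1..<b}"
  shows "\<exists>a c. a \<in> \<Union>(F k) \<and> {a, c} \<in> E \<and> F (Suc k) = insert {a, c} (F k)"
proof -
  have sub: "F k \<subseteq> F (Suc k)" and new: "\<forall>e\<in>F (Suc k) - F k. \<exists>f\<in>F k. e \<inter> f \<noteq> {}"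
    using F k by (auto simp: edge_sequences_def)
  have c: "card (F k) = k" "card (F (Suc k)) = Suc k" "F (Suc k) \<subseteq> E"
    using edge_sequenceD[OF F, of k] edge_sequenceD[OF F, of "Suc k"] k by auto
  have "card (F (Suc k) - F k) = 1" using c sub by (simp add: card_Diff_subset)
  then obtain e where e: "F (Suc k) - F k = {e}" by (auto simp: card_1_singleton_iff)
  then obtain f a where a: "f \<in> F k" "a \<in> e" "a \<in> f" using new by blast
  have "e \<in> E" using e c by blast
  then have "card e = 2" using simple by (auto simp: simple_graph_def)
  then obtain c where "e = {a, c}" using a(2) by (auto simp: card_2_iff insert_commute)
  then show ?thesis using a e sub \<open>e \<in> E\<close> by (intro exI[of _ a] exI[of _ c]) auto
qed

lemma path_within:
  assumes "(x, a) \<in> {(u, v). {u, v} \<in> S}\<^sup>*" "S \<subseteq> E"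
  shows "\<exists>bs. path_weight orrw_next K (S, x) bs \<noteq> 0 \<and> foldl orrw_next (S, x) bs = (S, a)"
  using assms(1)
proof (induction rule: converse_rtrancl_induct)
  case base
  show ?case by (intro exI[of _ "[]"]) simp
next
  case (step x y)
  then obtain bs where bs: "path_weight orrw_next K (S, y) bs \<noteq> 0" "foldl orrw_next (S, y) bs = (S, a)"
    by blast
  have "{x, y} \<in> S" using step by simp
  then have "orrw_next (S, x) y = (S, y)" "K (S, x) y \<noteq> 0"
    using assms(2) by (auto simp: orrw_next_def insert_absorb kernel_nz_iff)
  then show ?case using bs by (intro exI[of _ "y # bs"]) simp
qed

text \<open>Walking inside the connected graph \<open>F k\<close> adds no edge, so an end point of
  the next edge can be reached first; then that edge is crossed.\<close>

lemma bridge: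
  assumes F: "F \<in> edge_sequences E x0" and k: "k \<in> {1..<b}" and x: "x \<in> \<Union>(F k)"
  shows "\<exists>bs y. path_weight orrw_next K (F k, x) bs \<noteq> 0 \<and> y \<in> \<Union>(F (Suc k)) \<and>
    foldl orrw_next (F k, x) bs = (F (Suc k), y)"
proof -
  have k': "k \<in> {1..b}" using k by simp
  obtain a c where ac: "a \<in> \<Union>(F k)" "{a, c} \<in> E" "F (Suc k) = insert {a, c} (F k)"
    using new_edge[OF F k] by blast
  have "(x, a) \<in> {(u, v). {u, v} \<in> F k}\<^sup>*"
    using edge_sequence_connected[OF F simple k'] x ac(1) by (meson rtrancl_trans)
  then obtain bs where bs: "path_weight orrw_next K (F k, x) bs \<noteq> 0"
    "foldl orrw_next (F k, x) bs = (F k, a)"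
    using path_within edge_sequenceD(1)[OF F k'] by blast
  have "K (F k, a) c \<noteq> 0" using ac(2) by (simp add: kernel_nz_iff)
  then show ?thesis
    using bs ac(3) by (intro exI[of _ "bs @ [c]"] exI[of _ c]) (auto simp: path_weight_append orrw_next_def)
qed

lemma first_step:
  assumes F: "F \<in> edge_sequences E x0"
  shows "\<exists>bs y. path_weight orrw_next K ({}, x0) bs \<noteq> 0 \<and> y \<in> \<Union>(F 1) \<and>
    foldl orrw_next ({}, x0) bs = (F 1, y)"
proof -
  obtain v where v: "F 1 = {{x0, v}}" using F by (auto simp: edge_sequences_def)
  then have "{x0, v} \<in> E" using edge_sequenceD(1)[OF F, of 1] b_pos by auto
  then have "K ({}, x0) v \<noteq> 0" by (simp add: kernel_nz_iff)
  then show ?thesis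
    using v by (intro exI[of _ "[v]"] exI[of _ v]) (auto simp: orrw_next_def)
qed

end

text \<open>Left unnormalised: its total mass is the fraction of time spent in the stage, and its
  action already carries this factor.\<close>

definition stage_flow :: "(nat \<Rightarrow> 'v set set) \<Rightarrow> real ^ (('v::finite set set \<times> 'v) \<times> 'v) \<Rightarrow> nat \<Rightarrow>
    real ^ (('v set set \<times> 'v) \<times> 'v)" where
  "stage_flow F \<mu> k = (\<chi> p. if fst (fst p) = F k then \<mu> $ p else 0)"

definition stage_mass :: "(nat \<Rightarrow> 'v set set) \<Rightarrow> real ^ (('v::finite set set \<times> 'v) \<times> 'v) \<Rightarrow> nat \<Rightarrow> real" where
  "stage_mass F \<mu> k = (\<Sum>p\<in>UNIV. stage_flow F \<mu> k $ p)"

lemma stage_flow_nth: "stage_flow F \<mu> k $ p = (if fst (fst p) = F k then \<mu> $ p else 0)"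
  by (simp add: stage_flow_def)

lemma outflow_stage_flow:
  "outflow (stage_flow F \<mu> k) s = (if fst s = F k then outflow \<mu> s else 0)"
  by (simp add: outflow_def stage_flow_def)

text \<open>Since \<open>x\<close> and \<open>y\<close> may be exchanged, both directions of every
  edge of \<open>F k\<close> are charged. This makes the tilted chain irreducible on the vertices of
  the stage, as the uniqueness of its stationary flow requires.\<close>

locale positive_flow = once_reinforced E x0 \<delta>
  for E :: "'v::finite set set" and x0 :: 'v and \<delta> :: real +
  fixes F :: "nat \<Rightarrow> 'v set set" and \<mu> :: "real ^ (('v set set \<times> 'v) \<times> 'v)"
  assumes F: "F \<in> edge_sequences E x0" and \<mu>: "\<mu> \<in> admissible_flows E F"
    and positive: "\<And>k x y. k \<in> {1..b} \<Longrightarrow> {x, y} \<in> F k \<Longrightarrow> 0 < \<mu> $ ((F k, x), y)"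
begin

lemma flow_nonneg: "0 \<le> \<mu> $ p"
  and flow_total: "(\<Sum>p\<in>UNIV. \<mu> $ p) = 1"
  and flow_support: "\<mu> $ ((S, x), y) \<noteq> 0 \<Longrightarrow> S \<in> F ` {1..b} \<and> {x, y} \<in> S"
  and flow_balance: "outflow \<mu> (S, x) = (\<Sum>y\<in>UNIV. \<mu> $ ((S, y), x))"
  using \<mu> unfolding admissible_flows_def by blast+

text \<open>The conditional law of the next vertex under \<open>\<mu>\<close>. Being zero off stage
  \<open>k\<close>, it prevents a flow with this kernel from charging another stage.\<close>

definition tilted :: "nat \<Rightarrow> 'v set set \<times> 'v \<Rightarrow> 'v \<Rightarrow> real" where
  "tilted k s y = (if fst s = F k then \<mu> $ (s, y) / outflow \<mu> s else 0)"

lemma outflow_nonneg: "0 \<le> outflow \<mu> s"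
  unfolding outflow_def by (intro sum_nonneg flow_nonneg)

lemma outflow_pos: "k \<in> {1..b} \<Longrightarrow> x \<in> \<Union>(F k) \<Longrightarrow> 0 < outflow \<mu> (F k, x)"
proof -
  assume k: "k \<in> {1..b}" and x: "x \<in> \<Union>(F k)"
  then obtain e where e: "e \<in> F k" "x \<in> e" by blast
  then have "card e = 2" using edge_sequenceD(1)[OF F k] simple by (auto simp: simple_graph_def)
  then obtain y where "e = {x, y}" using e(2) by (auto simp: card_2_iff insert_commute)
  then have "0 < \<mu> $ ((F k, x), y)" using positive[OF k] e(1) by simp
  also have "\<dots> \<le> outflow \<mu> (F k, x)" by (rule outflow_ge[OF flow_nonneg])
  finally show ?thesis .
qed

lemma tilted_nonneg: "0 \<le> tilted k s y"
  by (simp add: tilted_def flow_nonneg outflow_nonneg)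

lemma sum_tilted_le: "(\<Sum>y\<in>UNIV. tilted k s y) \<le> 1"
  by (cases "fst s = F k") (simp_all add: tilted_def outflow_def flip: sum_divide_distrib)

lemma tilted_nz: "tilted k s y \<noteq> 0 \<Longrightarrow> fst s = F k \<and> {snd s, y} \<in> F k"
  using flow_support[of "fst s" "snd s" y] by (auto simp: tilted_def split: if_splits)

lemma stage_mass_pos:
  assumes k: "k \<in> {1..b}"
  shows "0 < stage_mass F \<mu> k" "stage_mass F \<mu> k \<le> 1"
proof -
  have "F k \<noteq> {}" using edge_sequenceD(2)[OF F k] k by auto
  then obtain e where e: "e \<in> F k" by blast
  then have "card e = 2" using edge_sequenceD(1)[OF F k] simple by (auto simp: simple_graph_def)
  then obtain x y where "e = {x, y}" by (auto simp: card_2_iff)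
  then have "0 < stage_flow F \<mu> k $ ((F k, x), y)"
    using positive[OF k] e by (simp add: stage_flow_def)
  then show "0 < stage_mass F \<mu> k"
    unfolding stage_mass_def by (rule sum_pos2[rotated 2]) (auto simp: stage_flow_def flow_nonneg)
  have "stage_mass F \<mu> k \<le> (\<Sum>p\<in>UNIV. \<mu> $ p)"
    unfolding stage_mass_def by (rule sum_mono) (simp add: stage_flow_def flow_nonneg)
  then show "stage_mass F \<mu> k \<le> 1" by (simp add: flow_total)
qed

text \<open>The density of a balanced flow of the tilted chain with respect to \<open>\<mu>\<close> is harmonic, so the
  set where it is minimal is closed under adjacency.\<close>

lemma tilted_flow_unique:
  assumes k: "k \<in> {1..b}" and lim: "limit_flow orrw_next (tilted k) s \<nu>"
    and eq: "\<And>s y. \<nu> $ (s, y) = outflow \<nu> s * tilted k s y"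
  shows "\<nu> = (1 / stage_mass F \<mu> k) *\<^sub>R stage_flow F \<mu> k"
proof -
  let ?S = "F k" and ?V = "\<Union>(F k)"
  let ?w = "\<lambda>x. outflow \<mu> (F k, x)" and ?h = "\<lambda>x. outflow \<nu> (F k, x)"
  define \<rho> where "\<rho> x = ?h x / ?w x" for x
  have \<nu>: "\<nu> $ ((?S, x), y) = \<rho> x * \<mu> $ ((?S, x), y)" for x y
    using eq[of "(?S, x)" y] by (simp add: tilted_def \<rho>_def)
  have out: "\<nu> $ ((T, x), y) = 0" if "T \<noteq> ?S" for T x y
    using eq[of "(T, x)" y] that by (simp add: tilted_def)
  \<comment> \<open>Both flows are balanced at \<open>x\<close>; subtracting \<open>\<rho> x\<close>
    times the balance of \<open>\<mu>\<close> from that of \<open>\<nu>\<close> leaves weighted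
    differences over the arrivals.\<close>
  have harmonic: "(\<Sum>y\<in>UNIV. \<mu> $ ((?S, y), x) * (\<rho> y - \<rho> x)) = 0" if x: "x \<in> ?V" for x
  proof -
    have "?h x = inflow orrw_next \<nu> (?S, x)" by (rule limit_flow_properties(4)[OF lim])
    also have "\<dots> = (\<Sum>y\<in>UNIV. \<nu> $ ((?S, y), x))"
    proof (rule inflow_orrw_next)
      fix T u v assume "\<nu> $ ((T, u), v) \<noteq> 0"
      then have "tilted k (T, u) v \<noteq> 0" using eq[of "(T, u)" v] by auto
      then show "{u, v} \<in> T" using tilted_nz by fastforce
    qed
    finally have "?h x = (\<Sum>y\<in>UNIV. \<mu> $ ((?S, y), x) * \<rho> y)" by (simp add: \<nu> mult.commute)
    moreover have "?h x = (\<Sum>y\<in>UNIV. \<mu> $ ((?S, y), x) * \<rho> x)"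
    proof -
      have "(\<Sum>y\<in>UNIV. \<mu> $ ((?S, y), x) * \<rho> x) = ?w x * \<rho> x"
        by (simp only: flow_balance sum_distrib_right)
      then show ?thesis using outflow_pos[OF k x] by (simp add: \<rho>_def)
    qed
    ultimately show ?thesis by (simp add: right_diff_distrib sum_subtractf)
  qed
  define x1 where "x1 = arg_min_on \<rho> ?V"
  have "F k \<noteq> {}" using edge_sequenceD(2)[OF F k] k by auto
  then obtain e where e: "e \<in> F k" by blast
  then have "card e = 2" using edge_sequenceD(1)[OF F k] simple by (auto simp: simple_graph_def)
  then have "?V \<noteq> {}" using e by (metis Union_upper bot.extremum_uniqueI card.empty zero_neq_numeral)
  then have x1: "x1 \<in> ?V" "\<And>y. y \<in> ?V \<Longrightarrow> \<rho> x1 \<le> \<rho> y"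
    unfolding x1_def using arg_min_if_finite(1)[of ?V \<rho>] arg_min_least[of ?V _ \<rho>] by auto
  have adj: "y \<in> ?V \<and> \<rho> y = \<rho> x1" if "x \<in> ?V \<and> \<rho> x = \<rho> x1" "{x, y} \<in> ?S" for x y
  proof -
    \<comment> \<open>At a minimum all differences are nonnegative and their weighted sum is zero;
      the weight of the step from \<open>y\<close> to \<open>x\<close> is positive, so
      \<open>\<rho>\<close> takes the same value at \<open>y\<close>.\<close>
    have nonneg: "0 \<le> \<mu> $ ((?S, z), x) * (\<rho> z - \<rho> x)" for z
    proof (cases "\<mu> $ ((?S, z), x) = 0")
      case False
      then have "z \<in> ?V" using flow_support[of ?S z x] by blast
      then show ?thesis using x1(2) that(1) by (simp add: flow_nonneg)
    qed simp
    have "\<mu> $ ((?S, y), x) * (\<rho> y - \<rho> x) = 0"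
      using sum_nonneg_eq_0_iff[of UNIV "\<lambda>z. \<mu> $ ((?S, z), x) * (\<rho> z - \<rho> x)"]
        nonneg harmonic[of x] that(1) by simp
    moreover have "0 < \<mu> $ ((?S, y), x)" using positive[OF k, of y x] that(2) by (simp add: insert_commute)
    ultimately show ?thesis using that by auto
  qed
  have const: "\<rho> y = \<rho> x1" if "y \<in> ?V" for y
  proof -
    have "(x1, y) \<in> {(u, v). {u, v} \<in> ?S}\<^sup>*"
      using edge_sequence_connected[OF F simple k] x1(1) that by (meson rtrancl_trans)
    then have "y \<in> ?V \<and> \<rho> y = \<rho> x1"
    proof induction
      case (step u v)
      then show ?case using adj[of u v] by blast
    qed (use x1(1) in simp)
    then show ?thesis ..
  qed
  have \<nu>': "\<nu> = \<rho> x1 *\<^sub>R stage_flow F \<mu> k"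
  proof (simp only: vec_eq_iff, intro allI)
    fix p :: "('v set set \<times> 'v) \<times> 'v"
    obtain T x y where p: "p = ((T, x), y)" by (metis prod.collapse)
    show "\<nu> $ p = (\<rho> x1 *\<^sub>R stage_flow F \<mu> k) $ p"
    proof (cases "T = ?S")
      case True
      show ?thesis
      proof (cases "\<mu> $ ((?S, x), y) = 0")
        case False
        then have "x \<in> ?V" using flow_support[of ?S x y] by blast
        then show ?thesis using True by (simp add: p \<nu> stage_flow_def const)
      qed (use True in \<open>simp add: p \<nu> stage_flow_def\<close>)
    qed (simp add: p out stage_flow_def)
  qed
  \<comment> \<open>The total mass one of a limiting flow fixes the remaining constant.\<close>
  have "\<rho> x1 * stage_mass F \<mu> k = 1"
    using limit_flow_properties(2)[OF lim] unfolding \<nu>' by (simp add: stage_mass_def sum_distrib_left)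
  then have "\<rho> x1 = 1 / stage_mass F \<mu> k" using stage_mass_pos[OF k] by (simp add: field_simps)
  then show ?thesis using \<nu>' by simp
qed

lemma stage_flow_nonneg: "0 \<le> stage_flow F \<mu> k $ p"
  by (simp add: stage_flow_def flow_nonneg)

lemma stage_flow_support:
  assumes "k \<in> {1..b}" "stage_flow F \<mu> k $ p \<noteq> 0"
  shows "fst (fst p) = F k" "{snd (fst p), snd p} \<in> F k" "0 < K (fst p) (snd p)"
proof -
  show 1: "fst (fst p) = F k" using assms by (auto simp: stage_flow_def split: if_splits)
  have "p = ((F k, snd (fst p)), snd p)" using 1 by (simp add: prod_eq_iff)
  then have "\<mu> $ ((F k, snd (fst p)), snd p) \<noteq> 0"
    using assms(2) by (auto simp: stage_flow_def split: if_splits)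
  then show "{snd (fst p), snd p} \<in> F k" using flow_support by blast
  then show "0 < K (fst p) (snd p)" using edge_sequenceD(1)[OF F assms(1)] by (auto simp: kernel_pos_iff)
qed

text \<open>An instance of \<open>lower_rate_stage\<close> with the normalised stage flow as target.
  The kernel change costs \<open>a1\<close> per step, and the stage mass times \<open>a1\<close> is
  the action of the unnormalised flow.\<close>

lemma lower_rate_stage_flow:
  assumes k: "k \<in> {1..b}" and x: "x \<in> \<Union>(F k)" and R: "0 \<le> R"
    and rest: "\<And>y. y \<in> \<Union>(F k) \<Longrightarrow> lower_rate orrw_next K (F k, y) R V a"
  shows "lower_rate orrw_next K (F k, x) (stage_mass F \<mu> k + R) (stage_flow F \<mu> k + V)
    (action K (stage_flow F \<mu> k) + a)"
proof -
  let ?r = "stage_mass F \<mu> k" and ?\<mu> = "stage_flow F \<mu> k" and ?A = "{F k} \<times> \<Union>(F k)"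
  let ?\<pi> = "(1 / ?r) *\<^sub>R ?\<mu>"
  define a1 where "a1 = (\<Sum>p\<in>UNIV. ?\<pi> $ p * (ln (tilted k (fst p) (snd p)) - ln (K (fst p) (snd p))))"
  note r = stage_mass_pos[OF k]
  have ra1: "?r * a1 = action K ?\<mu>"
  proof -
    have "?r * a1 = (\<Sum>p\<in>UNIV. ?\<mu> $ p * (ln (tilted k (fst p) (snd p)) - ln (K (fst p) (snd p))))"
      using r by (simp add: a1_def sum_distrib_left)
    also have "\<dots> = action K ?\<mu>"
      unfolding action_alt
    proof (rule sum.cong)
      fix p
      show "?\<mu> $ p * (ln (tilted k (fst p) (snd p)) - ln (K (fst p) (snd p)))
        = ?\<mu> $ p * (ln (?\<mu> $ p) - ln (outflow ?\<mu> (fst p)) - ln (K (fst p) (snd p)))"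
      proof (cases "?\<mu> $ p = 0")
        case False
        note s = stage_flow_support[OF k False]
        have "0 < outflow \<mu> (F k, snd (fst p))" by (rule outflow_pos[OF k]) (use s in blast)
        then have o: "0 < outflow \<mu> (fst p)" using s(1) by (metis prod.collapse)
        have "0 < \<mu> $ p"
          using False flow_nonneg[of p] by (auto simp: stage_flow_def less_le split: if_splits)
        then have "ln (tilted k (fst p) (snd p)) = ln (\<mu> $ p) - ln (outflow \<mu> (fst p))"
          using o s(1) by (simp add: tilted_def ln_div)
        moreover have "?\<mu> $ p = \<mu> $ p" "outflow ?\<mu> (fst p) = outflow \<mu> (fst p)"
          using s(1) by (simp_all add: outflow_stage_flow stage_flow_nth)
        ultimately show ?thesis by presburger
      qed simp
    qed simp
    finally show ?thesis .
  qed
  have "0 \<le> action K ?\<mu>"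
    by (rule action_nonneg) (auto simp: stage_flow_nonneg kernel_nonneg sum_kernel stage_flow_support[OF k])
  then have "0 \<le> ?r * a1" using ra1 by simp
  then have a1: "0 \<le> a1" using r(1) by (simp add: zero_le_mult_iff)
  have \<pi>0: "0 \<le> ?\<pi> $ p" for p using r by (simp add: stage_flow_nonneg)
  have \<pi>1: "?\<pi> $ p \<le> 1" for p
  proof -
    have "?\<mu> $ p \<le> ?r" unfolding stage_mass_def by (rule member_le_sum) (auto simp: stage_flow_nonneg)
    then show ?thesis using r by (simp add: field_simps)
  qed
  have "lower_rate orrw_next K (F k, x) (?r + R) (?r *\<^sub>R ?\<pi> + V) (?r * a1 + a)"
  proof (rule lower_rate_stage[OF kernel_nonneg r R a1 \<pi>0 \<pi>1])
    fix \<epsilon> :: real assume "\<epsilon> > 0"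
    then show "\<forall>\<^sub>F m in sequentially. exp (- (real m * (a1 + \<epsilon>))) \<le>
      (\<Sum>ys\<in>{ys\<in>paths m. (\<forall>p. \<bar>step_freq orrw_next (F k, x) ys $ p - ?\<pi> $ p\<bar> \<le> \<epsilon>) \<and>
        foldl orrw_next (F k, x) ys \<in> ?A}. path_weight orrw_next K (F k, x) ys)"
      unfolding a1_def
    proof (intro tilted_lower_bound[where Q = "tilted k"] kernel_nonneg tilted_nonneg sum_tilted_le)
      fix s y assume "tilted k s y \<noteq> 0"
      then show "K s y \<noteq> 0"
        using tilted_nz[of k s y] edge_sequenceD(1)[OF F k] by (auto simp: kernel_nz_iff)
    next
      show "(F k, x) \<in> ?A" using x by simp
    next
      fix s assume "s \<in> ?A"
      then obtain z where "s = (F k, z)" "z \<in> \<Union>(F k)" by auto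
      then show "(\<Sum>y\<in>UNIV. tilted k s y) = 1"
        using outflow_pos[OF k, of z]
        by (simp add: tilted_def flip: sum_divide_distrib) (simp add: outflow_def)
    next
      fix s y assume "s \<in> ?A" "tilted k s y \<noteq> 0"
      then show "orrw_next s y \<in> ?A"
        using tilted_nz[of k s y] by (auto simp: orrw_next_def insert_absorb)
    qed (use tilted_flow_unique[OF k] in blast)
  qed (use rest in auto)
  then show ?thesis using r(1) ra1 by simp
qed

text \<open>A charged step belongs to exactly one stage, so masses, flows and actions of the stages
  add up to those of \<open>\<mu>\<close>.\<close>

lemma sum_stage:
  assumes "\<And>p. h p \<noteq> 0 \<Longrightarrow> \<mu> $ p \<noteq> 0"
  shows "(\<Sum>k=1..b. if fst (fst p) = F k then h p else (0::real)) = h p"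
proof (cases "h p = 0")
  case False
  then obtain j where j: "j \<in> {1..b}" "fst (fst p) = F j"
    using flow_support[of "fst (fst p)" "snd (fst p)" "snd p"] assms by auto
  have "(\<Sum>k=1..b. if fst (fst p) = F k then h p else 0) = (\<Sum>k=1..b. if k = j then h p else 0)"
  proof (rule sum.cong)
    fix k assume "k \<in> {1..b}"
    then have "fst (fst p) = F k \<longleftrightarrow> k = j"
      using inj_on_eq_iff[OF edge_sequence_inj[OF F]] j by metis
    then show "(if fst (fst p) = F k then h p else 0) = (if k = j then h p else 0)" by simp
  qed simp
  then show ?thesis using j by simp
qed (auto intro!: sum.neutral)

text \<open>Induction backwards from the last stage, after which no time remains. Every earlier
  stage is followed by a bridge, and the positive mass of the later stages supplies the condition
  \<open>R > 0\<close> of \<open>lower_rate_prefix\<close>. All start vertices are treated at once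
  because a stage may end at any of its vertices.\<close>

lemma lower_rate_from_stage:
  assumes "1 \<le> k" "k \<le> b"
  shows "\<forall>x\<in>\<Union>(F k). lower_rate orrw_next K (F k, x) (\<Sum>j=k..b. stage_mass F \<mu> j)
    (\<Sum>j=k..b. stage_flow F \<mu> j) (\<Sum>j=k..b. action K (stage_flow F \<mu> j))"
  using assms(2,1)
proof (induction k rule: inc_induct)
  case base
  show ?case
  proof
    fix x assume "x \<in> \<Union>(F b)"
    then have "lower_rate orrw_next K (F b, x) (stage_mass F \<mu> b + 0) (stage_flow F \<mu> b + 0)
        (action K (stage_flow F \<mu> b) + 0)"
      using b_pos by (intro lower_rate_stage_flow lower_rate_zero sum_kernel) auto
    then show "lower_rate orrw_next K (F b, x) (\<Sum>j=b..b. stage_mass F \<mu> j)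
      (\<Sum>j=b..b. stage_flow F \<mu> j) (\<Sum>j=b..b. action K (stage_flow F \<mu> j))" by simp
  qed
next
  case (step k)
  have k: "k \<in> {1..<b}" "k \<in> {1..b}" using step by auto
  let ?R = "\<Sum>j=Suc k..b. stage_mass F \<mu> j"
  have IH: "\<forall>x\<in>\<Union>(F (Suc k)). lower_rate orrw_next K (F (Suc k), x) ?R
    (\<Sum>j=Suc k..b. stage_flow F \<mu> j) (\<Sum>j=Suc k..b. action K (stage_flow F \<mu> j))"
    using step by simp
  have R: "0 < ?R" using k by (intro sum_pos stage_mass_pos) auto
  show ?case
  proof
    fix x assume x: "x \<in> \<Union>(F k)"
    have "lower_rate orrw_next K (F k, x) (stage_mass F \<mu> k + ?R)
      (stage_flow F \<mu> k + (\<Sum>j=Suc k..b. stage_flow F \<mu> j))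
      (action K (stage_flow F \<mu> k) + (\<Sum>j=Suc k..b. action K (stage_flow F \<mu> j)))"
    proof (rule lower_rate_stage_flow[OF k(2) x less_imp_le[OF R]])
      fix y assume "y \<in> \<Union>(F k)"
      then obtain bs z where bs: "path_weight orrw_next K (F k, y) bs \<noteq> 0" "z \<in> \<Union>(F (Suc k))"
        "foldl orrw_next (F k, y) bs = (F (Suc k), z)"
        using bridge[OF F k(1)] by blast
      show "lower_rate orrw_next K (F k, y) ?R (\<Sum>j=Suc k..b. stage_flow F \<mu> j)
          (\<Sum>j=Suc k..b. action K (stage_flow F \<mu> j))"
        by (rule lower_rate_prefix[OF kernel_nonneg R bs(1)]) (use bs(2) IH in \<open>simp only: bs(3)\<close>)
    qed
    then show "lower_rate orrw_next K (F k, x) (\<Sum>j=k..b. stage_mass F \<mu> j)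
      (\<Sum>j=k..b. stage_flow F \<mu> j) (\<Sum>j=k..b. action K (stage_flow F \<mu> j))"
      using k by (simp add: sum.atLeast_Suc_atMost)
  qed
qed

lemma lower_rate_flow: "lower_rate orrw_next K ({}, x0) 1 \<mu> (action K \<mu>)"
proof -
  have mass: "(\<Sum>j=1..b. stage_mass F \<mu> j) = 1"
    unfolding stage_mass_def stage_flow_def
    by (subst sum.swap) (simp add: sum_stage[of "\<lambda>p. \<mu> $ p"] flow_total del: One_nat_def)
  have flow: "(\<Sum>j=1..b. stage_flow F \<mu> j) = \<mu>"
    by (simp add: vec_eq_iff stage_flow_def sum_stage[of "\<lambda>p. \<mu> $ p"] del: One_nat_def)
  let ?g = "\<lambda>p. \<mu> $ p * (ln (\<mu> $ p) - ln (outflow \<mu> (fst p)) - ln (K (fst p) (snd p)))"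
  have "action K (stage_flow F \<mu> j) = (\<Sum>p\<in>UNIV. if fst (fst p) = F j then ?g p else 0)" for j
    unfolding action_alt by (intro sum.cong refl) (simp add: stage_flow_nth outflow_stage_flow)
  then have "(\<Sum>j=1..b. action K (stage_flow F \<mu> j))
      = (\<Sum>j=1..b. \<Sum>p\<in>UNIV. if fst (fst p) = F j then ?g p else 0)" by simp
  also have "\<dots> = (\<Sum>p\<in>UNIV. \<Sum>j=1..b. if fst (fst p) = F j then ?g p else 0)"
    by (rule sum.swap)
  also have "\<dots> = action K \<mu>"
    unfolding action_alt by (intro sum.cong refl sum_stage) auto
  finally have act: "(\<Sum>j=1..b. action K (stage_flow F \<mu> j)) = action K \<mu>" .
  obtain bs y where bs: "path_weight orrw_next K ({}, x0) bs \<noteq> 0" "y \<in> \<Union>(F 1)"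
    "foldl orrw_next ({}, x0) bs = (F 1, y)" using first_step[OF F] by blast
  show ?thesis
    by (rule lower_rate_prefix[OF kernel_nonneg _ bs(1)])
      (use lower_rate_from_stage[of 1] b_pos bs mass flow act in auto)
qed

end

section \<open>Families of measures and flows\<close>

text \<open>The density is the quotient of the mass functions. It is determined only up to null
  sets, but its values outside the support of \<open>\<rho>\<close> are multiplied by 0.\<close>

lemma relative_entropy_eq:
  assumes "set_pmf \<gamma> \<subseteq> set_pmf \<rho>"
  shows "relative_entropy \<gamma> \<rho> = ereal (\<Sum>x\<in>UNIV. pmf \<gamma> x * (ln (pmf \<gamma> x) - ln (pmf \<rho> x)))"
proof -
  define g where "g x = ennreal (pmf \<gamma> x / pmf \<rho> x)" for x
  have "density (measure_pmf \<rho>) g = density (count_space UNIV) (\<lambda>x. ennreal (pmf \<rho> x) * g x)"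
    unfolding measure_pmf_eq_density[of \<rho>] by (subst density_density_eq) auto
  also have "(\<lambda>x. ennreal (pmf \<rho> x) * g x) = (\<lambda>x. ennreal (pmf \<gamma> x))"
  proof
    fix x
    have "pmf \<rho> x * (pmf \<gamma> x / pmf \<rho> x) = pmf \<gamma> x"
      using assms by (auto simp: set_pmf_iff)
    then show "ennreal (pmf \<rho> x) * g x = ennreal (pmf \<gamma> x)"
      by (simp add: g_def flip: ennreal_mult)
  qed
  finally have d: "density (measure_pmf \<rho>) g = measure_pmf \<gamma>"
    by (simp add: measure_pmf_eq_density[of \<gamma>])
  have ac: "absolutely_continuous (measure_pmf \<rho>) (measure_pmf \<gamma>)"
    unfolding d[symmetric] by (rule absolutely_continuousI_density) simp
  have ae: "AE x in measure_pmf \<rho>. g x = RN_deriv (measure_pmf \<rho>) (measure_pmf \<gamma>) x"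
    by (rule measure_pmf.RN_deriv_unique) (simp_all add: d)
  have rn: "enn2real (RN_deriv (measure_pmf \<rho>) (measure_pmf \<gamma>) x) = pmf \<gamma> x / pmf \<rho> x"
    if "x \<in> set_pmf \<rho>" for x
  proof -
    have "RN_deriv (measure_pmf \<rho>) (measure_pmf \<gamma>) x = g x"
      using ae that by (simp add: AE_measure_pmf_iff)
    then show ?thesis by (simp add: g_def)
  qed
  have "(\<integral>x. enn2real (RN_deriv (measure_pmf \<rho>) (measure_pmf \<gamma>) x) *
      ln (enn2real (RN_deriv (measure_pmf \<rho>) (measure_pmf \<gamma>) x)) \<partial>measure_pmf \<rho>)
    = (\<Sum>x\<in>UNIV. pmf \<rho> x * (enn2real (RN_deriv (measure_pmf \<rho>) (measure_pmf \<gamma>) x) *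
      ln (enn2real (RN_deriv (measure_pmf \<rho>) (measure_pmf \<gamma>) x))))"
    by (subst integral_measure_pmf[of UNIV]) auto
  also have "\<dots> = (\<Sum>x\<in>UNIV. pmf \<gamma> x * (ln (pmf \<gamma> x) - ln (pmf \<rho> x)))"
  proof (rule sum.cong)
    fix x
    show "pmf \<rho> x * (enn2real (RN_deriv (measure_pmf \<rho>) (measure_pmf \<gamma>) x) *
      ln (enn2real (RN_deriv (measure_pmf \<rho>) (measure_pmf \<gamma>) x)))
      = pmf \<gamma> x * (ln (pmf \<gamma> x) - ln (pmf \<rho> x))"
    proof (cases "pmf \<rho> x = 0")
      case True
      then have "pmf \<gamma> x = 0" using assms by (auto simp: set_pmf_iff)
      then show ?thesis using True by simp
    next
      case False
      then have "0 < pmf \<rho> x" by (simp add: less_le)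
      show ?thesis
      proof (cases "pmf \<gamma> x = 0")
        case True
        then show ?thesis using False by (simp add: rn set_pmf_iff)
      next
        case g: False
        then have "0 < pmf \<gamma> x" by (simp add: less_le)
        then show ?thesis using False \<open>0 < pmf \<rho> x\<close> by (simp add: rn set_pmf_iff ln_div)
      qed
    qed
  qed simp
  finally show ?thesis using ac by (simp add: relative_entropy_def)
qed

lemma invariant_distribution_iff:
  fixes \<nu> :: "'v::finite pmf"
  shows "invariant_distribution \<nu> q \<longleftrightarrow> (\<forall>x. (\<Sum>y\<in>UNIV. pmf \<nu> y * pmf (q y) x) = pmf \<nu> x)"
proof -
  have "pmf (bind_pmf \<nu> q) x = (\<Sum>y\<in>UNIV. pmf \<nu> y * pmf (q y) x)" for x
    by (simp add: pmf_bind integral_measure_pmf[of UNIV])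
  then show ?thesis by (simp add: invariant_distribution_def pmf_eq_iff)
qed

lemma sum_pmf_UNIV: "(\<Sum>x\<in>UNIV. pmf p x) = 1" for p :: "'v::finite pmf"
  by (rule sum_pmf_eq_1) auto

lemma embed_pmf_finite:
  fixes h :: "'v::finite \<Rightarrow> real"
  assumes "\<And>x. 0 \<le> h x" "(\<Sum>x\<in>UNIV. h x) = 1"
  shows "pmf (embed_pmf h) x = h x"
  using assms by (intro pmf_embed_pmf) (simp_all add: nn_integral_count_space_finite)

text \<open>Disintegration of \<open>m\<close>: \<open>N\<close> is the normalised vector of row
  sums, \<open>q\<close> consists of the normalised rows, and equality of row and column sums is
  invariance.\<close>

lemma balanced_flow_kernel:
  fixes m :: "'v::finite \<Rightarrow> 'v \<Rightarrow> real"
  assumes S: "\<And>e. e \<in> S \<Longrightarrow> card e = 2"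
    and m0: "\<And>x y. 0 \<le> m x y" and supp: "\<And>x y. m x y \<noteq> 0 \<Longrightarrow> {x, y} \<in> S"
    and bal: "\<And>x. (\<Sum>y\<in>UNIV. m x y) = (\<Sum>y\<in>UNIV. m y x)"
    and r: "r = (\<Sum>x\<in>UNIV. \<Sum>y\<in>UNIV. m x y)" "0 < r"
  shows "\<exists>N q. q \<in> transition_kernels S \<and> set_pmf N \<subseteq> \<Union>S \<and> invariant_distribution N q \<and>
    (\<forall>x y. r * (pmf N x * pmf (q x) y) = m x y)"
proof -
  define h where "h x = (\<Sum>y\<in>UNIV. m x y)" for x
  have h0: "0 \<le> h x" for x unfolding h_def by (intro sum_nonneg m0)
  have hm: "m x y \<le> h x" for x y unfolding h_def by (rule member_le_sum) (auto simp: m0)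
  define N where "N = embed_pmf (\<lambda>x. h x / r)"
  have N: "pmf N x = h x / r" for x
    unfolding N_def using h0 r by (intro embed_pmf_finite) (auto simp: h_def simp flip: sum_divide_distrib)
  \<comment> \<open>A vertex of \<open>S\<close> without mass still needs a row supported on
    \<open>S\<close>; the point mass at any neighbour serves.\<close>
  define q where "q x = (if h x = 0 then return_pmf (SOME y. {x, y} \<in> S) else embed_pmf (\<lambda>y. m x y / h x))" for x
  have q: "pmf (q x) y = m x y / h x" if "h x \<noteq> 0" for x y
  proof -
    have "pmf (embed_pmf (\<lambda>y. m x y / h x)) y = m x y / h x"
      using h0 m0 that by (intro embed_pmf_finite) (auto simp flip: sum_divide_distrib h_def)
    then show ?thesis using that by (simp add: q_def)
  qed
  have prod: "r * (pmf N x * pmf (q x) y) = m x y" for x y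
  proof (cases "h x = 0")
    case True
    then show ?thesis using hm[of x y] m0[of x y] by (simp add: N)
  next
    case False
    then show ?thesis using r(2) by (simp add: N q)
  qed
  have "q \<in> transition_kernels S"
    unfolding transition_kernels_def
  proof (intro CollectI ballI allI impI)
    fix x y assume x: "x \<in> \<Union>S" and y: "0 < pmf (q x) y"
    show "{x, y} \<in> S"
    proof (cases "h x = 0")
      case True
      obtain e where e: "e \<in> S" "x \<in> e" using x by blast
      then obtain z where "e = {x, z}" using S[OF e(1)] by (auto simp: card_2_iff insert_commute)
      then have "{x, SOME y. {x, y} \<in> S} \<in> S" using e(1) by (metis someI)
      moreover have "y = (SOME y. {x, y} \<in> S)" using y True by (simp add: q_def indicator_def split: if_splits)
      ultimately show ?thesis by simp
    next
      case False
      then have "m x y \<noteq> 0" using y by (auto simp: q)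
      then show ?thesis by (rule supp)
    qed
  qed
  moreover have "set_pmf N \<subseteq> \<Union>S"
  proof
    fix x assume "x \<in> set_pmf N"
    then have "h x \<noteq> 0" by (auto simp: set_pmf_iff N)
    then obtain y where "m x y \<noteq> 0" unfolding h_def by (meson sum.neutral)
    then show "x \<in> \<Union>S" using supp[of x y] by blast
  qed
  moreover have "invariant_distribution N q"
    unfolding invariant_distribution_iff
  proof
    fix x
    have "(\<Sum>y\<in>UNIV. pmf N y * pmf (q y) x) = (\<Sum>y\<in>UNIV. m y x / r)"
      using r(2) by (intro sum.cong refl) (simp add: field_simps flip: prod)
    also have "\<dots> = h x / r" by (simp add: h_def bal flip: sum_divide_distrib)
    finally show "(\<Sum>y\<in>UNIV. pmf N y * pmf (q y) x) = pmf N x" by (simp add: N)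
  qed
  ultimately show ?thesis using prod by blast
qed

section \<open>Vertex marginals and the flow of a family\<close>

definition marginal :: "real ^ (('v::finite set set \<times> 'v) \<times> 'v) \<Rightarrow> real ^ 'v" where
  "marginal \<mu> = (\<chi> x. \<Sum>S\<in>UNIV. outflow \<mu> (S, x))"

definition pmf_vec :: "'v::finite pmf \<Rightarrow> real ^ 'v" where
  "pmf_vec \<nu> = (\<chi> x. pmf \<nu> x)"

lemma sum_flow_split:
  "(\<Sum>p\<in>UNIV. h p) = (\<Sum>S\<in>UNIV. \<Sum>x\<in>UNIV. \<Sum>y\<in>UNIV. h ((S, x), y))"
proof -
  have "(\<Sum>p\<in>UNIV. h p) = (\<Sum>s\<in>UNIV. \<Sum>y\<in>UNIV. h (s, y))"
    by (simp only: sum.cartesian_product UNIV_Times_UNIV case_prod_unfold prod.collapse)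
  also have "\<dots> = (\<Sum>S\<in>UNIV. \<Sum>x\<in>UNIV. \<Sum>y\<in>UNIV. h ((S, x), y))"
    by (simp only: sum.cartesian_product[of "\<lambda>S x. \<Sum>y\<in>UNIV. h ((S, x), y)"]
        UNIV_Times_UNIV case_prod_unfold prod.collapse)
  finally show ?thesis .
qed

lemma marginal_total: "(\<Sum>x\<in>UNIV. marginal \<mu> $ x) = (\<Sum>p\<in>UNIV. \<mu> $ p)"
  unfolding sum_flow_split[of "\<lambda>p. \<mu> $ p"] marginal_def outflow_def vec_lambda_beta
  by (rule sum.swap)

lemma continuous_on_marginal: "continuous_on A marginal"
  unfolding marginal_def outflow_def by (intro continuous_intros)

text \<open>The sum looks up the stage with the given edge set; for an edge sequence at most one
  summand is selected, since its sets are distinct.\<close>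

definition family_flow :: "nat \<Rightarrow> (nat \<Rightarrow> 'v pmf) \<Rightarrow> (nat \<Rightarrow> real) \<Rightarrow> (nat \<Rightarrow> 'v set set) \<Rightarrow>
    (nat \<Rightarrow> 'v \<Rightarrow> 'v pmf) \<Rightarrow> real ^ (('v::finite set set \<times> 'v) \<times> 'v)" where
  "family_flow n N r F q = (\<chi> p. \<Sum>k=1..n. if fst (fst p) = F k
     then r k * (pmf (N k) (snd (fst p)) * pmf (q k (snd (fst p))) (snd p)) else 0)"

context once_reinforced begin

lemma stage_sum:
  assumes F: "F \<in> edge_sequences E x0" and k: "k \<in> {1..b}"
  shows "(\<Sum>j=1..b. if F k = F j then h j else 0) = (h k :: 'b::comm_monoid_add)"
proof -
  have "(\<Sum>j=1..b. if F k = F j then h j else 0) = (\<Sum>j\<in>{1..b}. if j = k then h j else 0)"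
  proof (rule sum.cong)
    fix j assume "j \<in> {1..b}"
    then have "F k = F j \<longleftrightarrow> j = k" using inj_on_eq_iff[OF edge_sequence_inj[OF F]] k by metis
    then show "(if F k = F j then h j else 0) = (if j = k then h j else 0)" by simp
  qed simp
  also have "\<dots> = h k" by (simp only: sum.delta[OF finite_atLeastAtMost] k if_True)
  finally show ?thesis .
qed

lemma sum_edge_sequence:
  assumes F: "F \<in> edge_sequences E x0" and h: "\<And>S. S \<notin> F ` {1..b} \<Longrightarrow> h S = (0::real)"
  shows "(\<Sum>S\<in>UNIV. h S) = (\<Sum>k=1..b. h (F k))"
proof -
  have "(\<Sum>S\<in>UNIV. h S) = (\<Sum>S\<in>F ` {1..b}. h S)"
    by (rule sum.mono_neutral_right) (auto simp: h)
  then show ?thesis using sum.reindex[OF edge_sequence_inj[OF F], of h] by (simp only: o_def)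
qed

lemma family_flow_nth:
  assumes "F \<in> edge_sequences E x0" "k \<in> {1..b}"
  shows "family_flow b N r F q $ ((F k, x), y) = r k * (pmf (N k) x * pmf (q k x) y)"
  unfolding family_flow_def vec_lambda_beta fst_conv snd_conv
  using assms by (rule stage_sum)

lemma family_flow_outside: "S \<notin> F ` {1..b} \<Longrightarrow> family_flow b N r F q $ ((S, x), y) = 0"
  unfolding family_flow_def vec_lambda_beta fst_conv snd_conv by (rule sum.neutral) auto

lemma outflow_family_flow:
  assumes F: "F \<in> edge_sequences E x0" and k: "k \<in> {1..b}"
  shows "outflow (family_flow b N r F q) (F k, x) = r k * pmf (N k) x"
  by (simp add: outflow_def family_flow_nth[OF F k] sum_pmf_UNIV flip: sum_distrib_left)

lemma
  assumes fam: "(N, r, F, q) \<in> admissible_families E x0 \<nu>"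
  shows family_flow_admissible: "family_flow b N r F q \<in> admissible_flows E F"
    and marginal_family_flow: "marginal (family_flow b N r F q) = pmf_vec \<nu>"
    and family_cost: "(\<Sum>k=1..b. ereal (r k) *
          (\<Sum>x\<in>UNIV. ereal (pmf (N k) x) * relative_entropy (q k x) (step_pmf E \<delta> (F k) x)))
        = ereal (action K (family_flow b N r F q))"
proof -
  let ?\<mu> = "family_flow b N r F q"
  have F: "F \<in> edge_sequences E x0" and r0: "\<And>k. k \<in> {1..b} \<Longrightarrow> 0 \<le> r k"
    and r1: "(\<Sum>k=1..b. r k) = 1"
    and q: "\<And>k. k \<in> {1..b} \<Longrightarrow> q k \<in> transition_kernels (F k)"
    and N: "\<And>k. k \<in> {1..b} \<Longrightarrow> set_pmf (N k) \<subseteq> \<Union>(F k)"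
    and inv: "\<And>k. k \<in> {1..b} \<Longrightarrow> invariant_distribution (N k) (q k)"
    and \<nu>: "\<And>x. (\<Sum>k=1..b. r k * pmf (N k) x) = pmf \<nu> x"
    using fam by (auto simp: admissible_families_def)
  note nth = family_flow_nth[OF F] and out = outflow_family_flow[OF F]
  have out0: "outflow ?\<mu> (S, x) = 0" if "S \<notin> F ` {1..b}" for S x
    by (simp add: outflow_def family_flow_outside[OF that])
  have nonneg: "0 \<le> ?\<mu> $ p" for p
    unfolding family_flow_def vec_lambda_beta by (intro sum_nonneg) (simp add: r0)
  have qS: "{x, y} \<in> F k" if "k \<in> {1..b}" "pmf (N k) x \<noteq> 0" "pmf (q k x) y \<noteq> 0" for k x y
  proof -
    have "x \<in> \<Union>(F k)" using N[OF that(1)] that(2) by (auto simp: set_pmf_iff)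
    moreover have "0 < pmf (q k x) y" using that(3) by (simp add: less_le)
    ultimately show ?thesis using q[OF that(1)] unfolding transition_kernels_def by blast
  qed
  have marg: "marginal ?\<mu> $ x = pmf \<nu> x" for x
  proof -
    have "marginal ?\<mu> $ x = (\<Sum>k=1..b. outflow ?\<mu> (F k, x))"
      unfolding marginal_def vec_lambda_beta by (rule sum_edge_sequence[OF F]) (rule out0)
    also have "\<dots> = (\<Sum>k=1..b. r k * pmf (N k) x)" by (intro sum.cong refl out)
    finally show ?thesis by (simp only: \<nu>)
  qed
  then show "marginal ?\<mu> = pmf_vec \<nu>" by (simp add: vec_eq_iff pmf_vec_def)
  have "(\<Sum>p\<in>UNIV. ?\<mu> $ p) = 1"
    unfolding marginal_total[symmetric] marg by (rule sum_pmf_UNIV)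
  moreover have "S \<in> F ` {1..b} \<and> {x, y} \<in> S" if nz: "?\<mu> $ ((S, x), y) \<noteq> 0" for S x y
  proof -
    have S: "S \<in> F ` {1..b}" using nz family_flow_outside by metis
    then obtain k where k: "k \<in> {1..b}" "S = F k" by blast
    have "pmf (N k) x \<noteq> 0" "pmf (q k x) y \<noteq> 0" using nz nth[OF k(1)] k(2) by auto
    then show ?thesis using qS[OF k(1)] S k(2) by blast
  qed
  moreover have "outflow ?\<mu> (S, x) = (\<Sum>y\<in>UNIV. ?\<mu> $ ((S, y), x))" for S x
  proof (cases "S \<in> F ` {1..b}")
    case True
    then obtain k where k: "k \<in> {1..b}" "S = F k" by blast
    have "(\<Sum>y\<in>UNIV. ?\<mu> $ ((S, y), x)) = r k * (\<Sum>y\<in>UNIV. pmf (N k) y * pmf (q k y) x)"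
      by (simp only: k(2) nth[OF k(1)] sum_distrib_left)
    also have "\<dots> = r k * pmf (N k) x" using inv[OF k(1)] by (simp add: invariant_distribution_iff)
    finally show ?thesis by (simp only: k(2) out[OF k(1)])
  next
    case False
    then show ?thesis by (simp add: out0 family_flow_outside)
  qed
  ultimately show "?\<mu> \<in> admissible_flows E F" using nonneg by (auto simp: admissible_flows_def)
  let ?c = "\<lambda>k x. \<Sum>y\<in>UNIV. pmf (q k x) y * (ln (pmf (q k x) y) - ln (step_prob E \<delta> (F k) x y))"
  \<comment> \<open>Where \<open>N k\<close> has no mass the relative entropy may be infinite, but 0
    * \<infinity> = 0. Elsewhere \<open>q k x\<close> is supported on edges of \<open>F k\<close>,
    all of positive step probability. Hence every admissible family has finite cost.\<close>
  have ent: "ereal (pmf (N k) x) * relative_entropy (q k x) (step_pmf E \<delta> (F k) x)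
      = ereal (pmf (N k) x * ?c k x)" if k: "k \<in> {1..b}" for k x
  proof (cases "pmf (N k) x = 0")
    case False
    obtain z where z: "{x, z} \<in> E" using ex_neighbour by blast
    note p = pmf_step_pmf[OF \<delta>_pos z]
    have "set_pmf (q k x) \<subseteq> set_pmf (step_pmf E \<delta> (F k) x)"
    proof
      fix y assume "y \<in> set_pmf (q k x)"
      then have "{x, y} \<in> E" using qS[OF k False] edge_sequenceD(1)[OF F k] by (auto simp: set_pmf_iff)
      then show "y \<in> set_pmf (step_pmf E \<delta> (F k) x)"
        using step_prob_pos_iff[of "F k" x y] by (simp add: set_pmf_iff p)
    qed
    then show ?thesis by (simp add: relative_entropy_eq p)
  qed (simp add: zero_ereal_def[symmetric])
  have "(\<Sum>k=1..b. ereal (r k) *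
          (\<Sum>x\<in>UNIV. ereal (pmf (N k) x) * relative_entropy (q k x) (step_pmf E \<delta> (F k) x)))
      = (\<Sum>k=1..b. ereal (r k * (\<Sum>x\<in>UNIV. pmf (N k) x * ?c k x)))"
    by (intro sum.cong refl) (simp add: ent)
  also have "\<dots> = ereal (\<Sum>k=1..b. r k * (\<Sum>x\<in>UNIV. pmf (N k) x * ?c k x))" by simp
  also have "(\<Sum>k=1..b. r k * (\<Sum>x\<in>UNIV. pmf (N k) x * ?c k x)) = action K ?\<mu>"
  proof -
    let ?g = "\<lambda>p. ?\<mu> $ p * (ln (?\<mu> $ p) - ln (outflow ?\<mu> (fst p)) - ln (K (fst p) (snd p)))"
    have "action K ?\<mu> = (\<Sum>S\<in>UNIV. \<Sum>x\<in>UNIV. \<Sum>y\<in>UNIV. ?g ((S, x), y))"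
      unfolding action_alt by (rule sum_flow_split)
    also have "\<dots> = (\<Sum>k=1..b. \<Sum>x\<in>UNIV. \<Sum>y\<in>UNIV. ?g ((F k, x), y))"
      by (rule sum_edge_sequence[OF F]) (simp add: family_flow_outside)
    also have "\<dots> = (\<Sum>k=1..b. r k * (\<Sum>x\<in>UNIV. pmf (N k) x * ?c k x))"
    proof (rule sum.cong)
      fix k assume k: "k \<in> {1..b}"
      \<comment> \<open>The factor \<open>r k * pmf (N k) x\<close> is itself the outflow, so its
        logarithm cancels and only the conditional law remains.\<close>
      have "?g ((F k, x), y) = r k * (pmf (N k) x *
          (pmf (q k x) y * (ln (pmf (q k x) y) - ln (step_prob E \<delta> (F k) x y))))" for x y
      proof (cases "r k * pmf (N k) x = 0 \<or> pmf (q k x) y = 0")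
        case False
        then have "0 < r k * pmf (N k) x" "0 < pmf (q k x) y"
          using r0[OF k] by (auto simp: less_le)
        then have "ln (r k * pmf (N k) x * pmf (q k x) y) = ln (r k * pmf (N k) x) + ln (pmf (q k x) y)"
          by (rule ln_mult_pos)
        then show ?thesis
          by (simp add: nth[OF k] out[OF k] orrw_kernel_def mult.assoc)
      qed (auto simp: nth[OF k])
      then show "(\<Sum>x\<in>UNIV. \<Sum>y\<in>UNIV. ?g ((F k, x), y)) = r k * (\<Sum>x\<in>UNIV. pmf (N k) x * ?c k x)"
        by (simp only: sum_distrib_left)
    qed simp
    finally show ?thesis ..
  qed
  finally show "(\<Sum>k=1..b. ereal (r k) *
          (\<Sum>x\<in>UNIV. ereal (pmf (N k) x) * relative_entropy (q k x) (step_pmf E \<delta> (F k) x)))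
        = ereal (action K ?\<mu>)" .
qed

lemma edge_ex:
  assumes F: "F \<in> edge_sequences E x0" and k: "k \<in> {1..b}"
  shows "\<exists>x y. x \<noteq> y \<and> {x, y} \<in> F k"
proof -
  have "F k \<noteq> {}" using edge_sequenceD(2)[OF F k] k by auto
  then obtain e where e: "e \<in> F k" by blast
  then have "card e = 2" using edge_sequenceD(1)[OF F k] simple by (auto simp: simple_graph_def)
  then show ?thesis using e by (auto simp: card_2_iff)
qed

lemma flow_family:
  assumes F: "F \<in> edge_sequences E x0" and \<mu>: "\<mu> \<in> admissible_flows E F"
    and marg: "marginal \<mu> = pmf_vec \<nu>"
  shows "\<exists>N r q. (N, r, F, q) \<in> admissible_families E x0 \<nu> \<and> \<mu> = family_flow b N r F q"
proof -
  have nonneg: "\<And>p. 0 \<le> \<mu> $ p" and total: "(\<Sum>p\<in>UNIV. \<mu> $ p) = 1"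
    and supp: "\<And>S x y. \<mu> $ ((S, x), y) \<noteq> 0 \<Longrightarrow> S \<in> F ` {1..b} \<and> {x, y} \<in> S"
    and bal: "\<And>S x. outflow \<mu> (S, x) = (\<Sum>y\<in>UNIV. \<mu> $ ((S, y), x))"
    using \<mu> unfolding admissible_flows_def by blast+
  define r where "r k = (\<Sum>x\<in>UNIV. \<Sum>y\<in>UNIV. \<mu> $ ((F k, x), y))" for k
  have r0: "0 \<le> r k" for k unfolding r_def by (intro sum_nonneg nonneg)
  have "\<exists>N q. q \<in> transition_kernels (F k) \<and> set_pmf N \<subseteq> \<Union>(F k) \<and> invariant_distribution N q \<and>
    (\<forall>x y. r k * (pmf N x * pmf (q x) y) = \<mu> $ ((F k, x), y))" if k: "k \<in> {1..b}" for k
  proof -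
    have S: "card e = 2" if "e \<in> F k" for e
      using that edge_sequenceD(1)[OF F k] simple by (auto simp: simple_graph_def)
    show ?thesis
    proof (cases "r k = 0")
      case True
      have zero: "\<mu> $ ((F k, x), y) = 0" for x y
      proof -
        have "\<forall>x. (\<Sum>y\<in>UNIV. \<mu> $ ((F k, x), y)) = 0"
          using True unfolding r_def
          by (subst (asm) sum_nonneg_eq_0_iff) (auto intro: sum_nonneg nonneg)
        then show ?thesis
          using sum_nonneg_eq_0_iff[of UNIV "\<lambda>y. \<mu> $ ((F k, x), y)"] nonneg by auto
      qed
      \<comment> \<open>A stage without mass still needs a kernel and an invariant law; walking back
        and forth along one edge provides them.\<close>
      obtain a c where ac: "a \<noteq> c" "{a, c} \<in> F k" using edge_ex[OF F k] by blast
      let ?m = "\<lambda>x y. of_bool ({x, y} = {a, c}) :: real"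
      have "(\<Sum>y\<in>UNIV. ?m a y) \<ge> ?m a c" by (rule member_le_sum) auto
      moreover have "(\<Sum>x\<in>UNIV. \<Sum>y\<in>UNIV. ?m x y) \<ge> (\<Sum>y\<in>UNIV. ?m a y)"
        by (rule member_le_sum) (auto intro: sum_nonneg)
      ultimately have "0 < (\<Sum>x\<in>UNIV. \<Sum>y\<in>UNIV. ?m x y)" by simp
      then have "\<exists>N q. q \<in> transition_kernels (F k) \<and> set_pmf N \<subseteq> \<Union>(F k) \<and> invariant_distribution N q \<and>
        (\<forall>x y. (\<Sum>x\<in>UNIV. \<Sum>y\<in>UNIV. ?m x y) * (pmf N x * pmf (q x) y) = ?m x y)"
        using S ac(2)
        by (intro balanced_flow_kernel) (auto simp: insert_commute split: if_splits)
      then show ?thesis using True zero by auto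
    next
      case False
      then show ?thesis
        using r0[of k] S nonneg supp
        by (intro balanced_flow_kernel) (auto simp: r_def outflow_def simp flip: bal)
    qed
  qed
  then obtain N q where Nq: "\<And>k. k \<in> {1..b} \<Longrightarrow> q k \<in> transition_kernels (F k)"
    "\<And>k. k \<in> {1..b} \<Longrightarrow> set_pmf (N k) \<subseteq> \<Union>(F k)"
    "\<And>k. k \<in> {1..b} \<Longrightarrow> invariant_distribution (N k) (q k)"
    "\<And>k x y. k \<in> {1..b} \<Longrightarrow> r k * (pmf (N k) x * pmf (q k x) y) = \<mu> $ ((F k, x), y)"
    by metis
  have eq: "\<mu> = family_flow b N r F q"
  proof (simp only: vec_eq_iff, intro allI)
    fix p :: "('v set set \<times> 'v) \<times> 'v"
    obtain S x y where p: "p = ((S, x), y)" by (metis prod.collapse)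
    show "\<mu> $ p = family_flow b N r F q $ p"
    proof (cases "S \<in> F ` {1..b}")
      case True
      then obtain k where "k \<in> {1..b}" "S = F k" by blast
      then show ?thesis by (simp add: p family_flow_nth[OF F] Nq(4))
    next
      case False
      then show ?thesis using supp[of S x y] family_flow_outside[OF False] p by auto
    qed
  qed
  have "(\<Sum>k=1..b. r k) = (\<Sum>S\<in>UNIV. \<Sum>x\<in>UNIV. \<Sum>y\<in>UNIV. \<mu> $ ((S, x), y))"
    unfolding r_def by (rule sum_edge_sequence[OF F, symmetric]) (use supp in \<open>auto intro!: sum.neutral\<close>)
  then have r1: "(\<Sum>k=1..b. r k) = 1"
    using total unfolding sum_flow_split[of "\<lambda>p. \<mu> $ p"] by simp
  have "(\<Sum>k=1..b. r k * pmf (N k) x) = pmf \<nu> x" for x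
  proof -
    have "pmf \<nu> x = marginal \<mu> $ x" by (simp add: marg pmf_vec_def)
    also have "\<dots> = (\<Sum>k=1..b. outflow \<mu> (F k, x))"
      unfolding marginal_def vec_lambda_beta
      by (rule sum_edge_sequence[OF F]) (use supp in \<open>auto intro!: sum.neutral simp: outflow_def\<close>)
    also have "\<dots> = (\<Sum>k=1..b. r k * pmf (N k) x)"
      unfolding eq by (intro sum.cong refl outflow_family_flow[OF F])
    finally show ?thesis by simp
  qed
  then have "(N, r, F, q) \<in> admissible_families E x0 \<nu>"
    using F r0 r1 Nq unfolding admissible_families_def by simp
  then show ?thesis using eq by blast
qed

end

section \<open>The rate function\<close>

text \<open>Expectations depend continuously on the point masses (\<open>?up\<close>), and point
  masses are expectations of indicators (\<open>?down\<close>). So topological questions can be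
  moved to \<open>real ^ 'v\<close>.\<close>

lemma openin_weak_topology_iff: "openin weak_topology U \<longleftrightarrow> (\<exists>W. open W \<and> U = pmf_vec -` W)"
proof -
  let ?e = "\<lambda>\<mu> :: 'v::finite pmf. \<lambda>f :: 'v \<Rightarrow> real. measure_pmf.expectation \<mu> f"
  let ?up = "\<lambda>v :: real ^ 'v. \<lambda>f :: 'v \<Rightarrow> real. \<Sum>x\<in>UNIV. v $ x * f x"
  let ?down = "\<lambda>g :: ('v \<Rightarrow> real) \<Rightarrow> real. (\<chi> x. g (indicator {x})) :: real ^ 'v"
  have e: "?e \<mu> = ?up (pmf_vec \<mu>)" for \<mu>
    by (simp add: pmf_vec_def integral_measure_pmf[of UNIV])
  have p: "pmf_vec \<mu> = ?down (?e \<mu>)" for \<mu>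
    by (simp add: e vec_eq_iff indicator_def)
  have up: "continuous_on UNIV ?up"
    by (intro continuous_on_coordinatewise_then_product continuous_intros)
  have down: "continuous_on UNIV ?down"
    by (intro continuous_intros continuous_on_product_coordinates)
  have "openin weak_topology U \<longleftrightarrow> (\<exists>S. open S \<and> U = ?e -` S)"
    unfolding weak_topology_def openin_pullback_topology euclidean_product_topology
    by (simp only: Int_UNIV_right open_openin)
  also have "\<dots> \<longleftrightarrow> (\<exists>W. open W \<and> U = pmf_vec -` W)"
  proof
    assume "\<exists>S. open S \<and> U = ?e -` S"
    then obtain S where S: "open S" "U = ?e -` S" by blast
    have "open (?up -` S)" using open_vimage[OF S(1) up] .
    moreover have "U = pmf_vec -` (?up -` S)" unfolding S(2) using e by auto
    ultimately show "\<exists>W. open W \<and> U = pmf_vec -` W" by blast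
  next
    assume "\<exists>W. open W \<and> U = pmf_vec -` W"
    then obtain W where W: "open W" "U = pmf_vec -` W" by blast
    have "open (?down -` W)" using open_vimage[OF W(1) down] .
    moreover have "U = ?e -` (?down -` W)" unfolding W(2) vimage_def by (simp only: p mem_Collect_eq)
    ultimately show "\<exists>S. open S \<and> U = ?e -` S" by blast
  qed
  finally show ?thesis .
qed

lemma topspace_weak_topology [simp]: "topspace weak_topology = UNIV"
  by (auto simp: weak_topology_def topspace_pullback_topology)

lemma closedin_weak_topology:
  assumes "closedin weak_topology C"
  shows "\<exists>D. closed D \<and> C = pmf_vec -` D"
proof -
  obtain W where W: "open W" "- C = pmf_vec -` W"
    using assms unfolding closedin_def openin_weak_topology_iff
    by (auto simp: Compl_eq_Diff_UNIV)
  then have "C = pmf_vec -` (- W)" by auto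
  then show ?thesis using W(1) by (auto simp: closed_Compl)
qed

section \<open>Level sets as images of compact sets of flows\<close>

context once_reinforced begin

abbreviation "I \<equiv> orrw_rate E \<delta> x0"

definition all_flows :: "(real ^ (('v set set \<times> 'v) \<times> 'v)) set" where
  "all_flows = (\<Union>F\<in>edge_sequences E x0. admissible_flows E F)"

text \<open>Edge sequences are functions on \<open>nat\<close> with arbitrary values outside
  \<open>{1..b}\<close>, so there are infinitely many. Admissible flows depend on \<open>F\<close>
  only through the image of \<open>{1..b}\<close>, which leaves finitely many compact sets.\<close>

lemma compact_all_flows: "compact all_flows"
proof -
  let ?G = "\<lambda>\<S>. {\<mu> :: real ^ (('v set set \<times> 'v) \<times> 'v). (\<forall>p. 0 \<le> \<mu> $ p) \<and> (\<Sum>p\<in>UNIV. \<mu> $ p) = 1 \<and>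
     (\<forall>S x y. \<mu> $ ((S, x), y) \<noteq> 0 \<longrightarrow> S \<in> \<S> \<and> {x, y} \<in> S) \<and>
     (\<forall>S x. outflow \<mu> (S, x) = (\<Sum>y\<in>UNIV. \<mu> $ ((S, y), x)))}"
  have "admissible_flows E F = ?G (F ` {1..b})" for F by (simp add: admissible_flows_def)
  then have "admissible_flows E ` edge_sequences E x0 \<subseteq> range ?G" by auto
  then have "finite (admissible_flows E ` edge_sequences E x0)"
    by (rule finite_subset) simp
  then show ?thesis
    unfolding all_flows_def by (intro compact_Union) (auto intro: compact_admissible_flows)
qed

lemma all_flowsD:
  assumes "\<mu> \<in> all_flows"
  shows "0 \<le> \<mu> $ p" "(\<Sum>p\<in>UNIV. \<mu> $ p) = 1"
    "\<mu> $ ((S, x), y) \<noteq> 0 \<Longrightarrow> {x, y} \<in> S \<and> S \<subseteq> E"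
    "outflow \<mu> (S, x) = (\<Sum>y\<in>UNIV. \<mu> $ ((S, y), x))"
proof -
  obtain F where F: "F \<in> edge_sequences E x0" and \<mu>: "\<mu> \<in> admissible_flows E F"
    using assms by (auto simp: all_flows_def)
  show "0 \<le> \<mu> $ p" "(\<Sum>p\<in>UNIV. \<mu> $ p) = 1" "outflow \<mu> (S, x) = (\<Sum>y\<in>UNIV. \<mu> $ ((S, y), x))"
    using \<mu> unfolding admissible_flows_def by blast+
  assume "\<mu> $ ((S, x), y) \<noteq> 0"
  then have "S \<in> F ` {1..b}" "{x, y} \<in> S" using \<mu> unfolding admissible_flows_def by blast+
  then show "{x, y} \<in> S \<and> S \<subseteq> E" using edge_sequenceD(1)[OF F] by blast
qed

lemma action_all_flows_nonneg: "\<mu> \<in> all_flows \<Longrightarrow> 0 \<le> action K \<mu>"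
proof (rule action_nonneg)
  fix p assume "\<mu> \<in> all_flows" "\<mu> $ p \<noteq> 0"
  then show "0 < K (fst p) (snd p)"
    using all_flowsD(3)[of \<mu> "fst (fst p)" "snd (fst p)" "snd p"] by (auto simp: kernel_pos_iff)
qed (auto simp: all_flowsD(1) kernel_nonneg sum_kernel)

lemma ex_pmf_marginal:
  assumes "\<mu> \<in> all_flows"
  shows "\<exists>\<nu>. pmf_vec \<nu> = marginal \<mu>"
proof -
  have "0 \<le> marginal \<mu> $ x" for x
    unfolding marginal_def outflow_def vec_lambda_beta by (intro sum_nonneg all_flowsD(1)[OF assms])
  moreover have "(\<Sum>x\<in>UNIV. marginal \<mu> $ x) = 1"
    by (simp add: marginal_total all_flowsD(2)[OF assms])
  ultimately have "pmf (embed_pmf (\<lambda>x. marginal \<mu> $ x)) x = marginal \<mu> $ x" for x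
    by (rule embed_pmf_finite)
  then have "pmf_vec (embed_pmf (\<lambda>x. marginal \<mu> $ x)) = marginal \<mu>"
    by (simp add: vec_eq_iff pmf_vec_def)
  then show ?thesis by blast
qed

lemma rate_le_action:
  assumes "\<mu> \<in> all_flows" "marginal \<mu> = pmf_vec \<nu>"
  shows "I \<nu> \<le> ereal (action K \<mu>)"
proof -
  obtain F where F: "F \<in> edge_sequences E x0" "\<mu> \<in> admissible_flows E F"
    using assms by (auto simp: all_flows_def)
  obtain N r q where fam: "(N, r, F, q) \<in> admissible_families E x0 \<nu>" "\<mu> = family_flow b N r F q"
    using flow_family[OF F assms(2)] by blast
  show ?thesis
    unfolding orrw_rate_def fam(2) family_cost[OF fam(1), symmetric]
    by (rule INF_lower2[OF fam(1)]) simp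
qed

text \<open>Families for \<open>\<nu>\<close> and flows with marginal \<open>\<nu>\<close>
  correspond with equal cost, so the infimum is taken of a continuous function over a compact fibre
  of \<open>marginal\<close>, nonempty when the rate is finite.\<close>

lemma rate_attained:
  assumes "I \<nu> < \<infinity>"
  shows "\<exists>\<mu>\<in>all_flows. marginal \<mu> = pmf_vec \<nu> \<and> I \<nu> = ereal (action K \<mu>)"
proof -
  let ?M = "{\<mu> \<in> all_flows. marginal \<mu> = pmf_vec \<nu>}"
  have flow: "family_flow b N r F q \<in> ?M" if "(N, r, F, q) \<in> admissible_families E x0 \<nu>" for N r F q
  proof -
    have "F \<in> edge_sequences E x0" using that by (simp add: admissible_families_def)
    then show ?thesis
      using family_flow_admissible[OF that] marginal_family_flow[OF that] by (auto simp: all_flows_def)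
  qed
  have "admissible_families E x0 \<nu> \<noteq> {}"
    using assms by (auto simp: orrw_rate_def top_ereal_def)
  then have "?M \<noteq> {}" using flow by fast
  have "closed {\<mu>. marginal \<mu> = pmf_vec \<nu>}"
    by (intro closed_Collect_eq continuous_on_marginal continuous_on_const)
  then have "compact (all_flows \<inter> {\<mu>. marginal \<mu> = pmf_vec \<nu>})"
    by (rule compact_Int_closed[OF compact_all_flows])
  then have "compact ?M" by (simp add: Int_def)
  then obtain \<mu> where \<mu>: "\<mu> \<in> ?M" and min: "\<And>\<mu>'. \<mu>' \<in> ?M \<Longrightarrow> action K \<mu> \<le> action K \<mu>'"
    using continuous_attains_inf[OF _ \<open>?M \<noteq> {}\<close> continuous_on_action] by blast
  have "ereal (action K \<mu>) \<le> I \<nu>"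
    unfolding orrw_rate_def
  proof (rule INF_greatest, clarsimp simp del: sum_ereal)
    fix N r F q assume fam: "(N, r, F, q) \<in> admissible_families E x0 \<nu>"
    show "ereal (action K \<mu>) \<le> (\<Sum>k=Suc 0..b. ereal (r k) *
          (\<Sum>x\<in>UNIV. ereal (pmf (N k) x) * relative_entropy (q k x) (step_pmf E \<delta> (F k) x)))"
      using family_cost[OF fam] min[OF flow[OF fam]] by simp
  qed
  moreover have "I \<nu> \<le> ereal (action K \<mu>)" using \<mu> by (intro rate_le_action) auto
  ultimately show ?thesis using \<mu> by (intro bexI[of _ \<mu>]) auto
qed

lemma rate_nonneg: "0 \<le> I \<nu>"
proof (cases "I \<nu> < \<infinity>")
  case True
  then show ?thesis using rate_attained action_all_flows_nonneg by force
qed simp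

text \<open>Attainment makes a level set exactly the image of a compact set of flows. Lower
  semicontinuity and compactness of level sets are both read off from this.\<close>

lemma rate_le_iff: "I \<nu> \<le> ereal a \<longleftrightarrow> pmf_vec \<nu> \<in> marginal ` {\<mu> \<in> all_flows. action K \<mu> \<le> a}"
proof
  assume le: "I \<nu> \<le> ereal a"
  then have "I \<nu> < \<infinity>" by auto
  then obtain \<mu> where "\<mu> \<in> all_flows" "marginal \<mu> = pmf_vec \<nu>" "I \<nu> = ereal (action K \<mu>)"
    using rate_attained by blast
  then show "pmf_vec \<nu> \<in> marginal ` {\<mu> \<in> all_flows. action K \<mu> \<le> a}"
    using le by (intro image_eqI[of _ _ \<mu>]) auto
next
  assume "pmf_vec \<nu> \<in> marginal ` {\<mu> \<in> all_flows. action K \<mu> \<le> a}"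
  then obtain \<mu> where \<mu>: "\<mu> \<in> all_flows" "marginal \<mu> = pmf_vec \<nu>" "action K \<mu> \<le> a" by auto
  have "I \<nu> \<le> ereal (action K \<mu>)" using \<mu> by (intro rate_le_action) auto
  also have "\<dots> \<le> ereal a" using \<mu> by simp
  finally show "I \<nu> \<le> ereal a" .
qed

lemma compact_level_flows: "compact {\<mu> \<in> all_flows. action K \<mu> \<le> a}"
proof -
  have "closed {\<mu>. action K \<mu> \<le> a}"
    by (intro closed_Collect_le continuous_on_action continuous_on_const)
  then have "compact (all_flows \<inter> {\<mu>. action K \<mu> \<le> a})"
    by (rule compact_Int_closed[OF compact_all_flows])
  then show ?thesis by (simp add: Int_def)
qed

lemma openin_rate_gt: "openin weak_topology {\<nu>. ereal a < I \<nu>}"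
proof -
  let ?L = "marginal ` {\<mu> \<in> all_flows. action K \<mu> \<le> a}"
  have "closed ?L"
    by (intro compact_imp_closed compact_continuous_image continuous_on_marginal compact_level_flows)
  then have "open (- ?L)" by (rule open_Compl)
  moreover have "{\<nu>. ereal a < I \<nu>} = pmf_vec -` (- ?L)"
    using rate_le_iff[of _ a] by (auto simp: not_le[symmetric] simp del: not_le)
  ultimately show ?thesis unfolding openin_weak_topology_iff by blast
qed

lemma inj_pmf_vec: "pmf_vec \<mu> = pmf_vec \<nu> \<Longrightarrow> \<mu> = \<nu>"
  by (simp add: pmf_vec_def vec_eq_iff pmf_eq_iff)

lemma compactin_rate_le: "compactin weak_topology {\<nu>. I \<nu> \<le> ereal a}"
proof -
  let ?L = "{\<mu> \<in> all_flows. action K \<mu> \<le> a}"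
  \<comment> \<open>The lift of \<open>marginal\<close> through the injection
    \<open>pmf_vec\<close>: a continuous map into the abstract weak topology that carries
    compactness over.\<close>
  define h where "h \<mu> = (SOME \<nu>. pmf_vec \<nu> = marginal \<mu>)" for \<mu> :: "real ^ (('v set set \<times> 'v) \<times> 'v)"
  have h: "pmf_vec (h \<mu>) = marginal \<mu>" if "\<mu> \<in> ?L" for \<mu>
    unfolding h_def using someI_ex[OF ex_pmf_marginal] that by blast
  have "continuous_map (top_of_set ?L) weak_topology h"
    unfolding continuous_map_def
  proof (intro conjI allI impI)
    fix U :: "'v pmf set" assume "openin weak_topology U"
    then obtain W where W: "open W" "U = pmf_vec -` W" unfolding openin_weak_topology_iff by blast
    have "{\<mu> \<in> topspace (top_of_set ?L). h \<mu> \<in> U} = ?L \<inter> marginal -` W"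
      using h W(2) by auto
    moreover have "openin (top_of_set ?L) (?L \<inter> marginal -` W)"
      by (rule continuous_openin_preimage_gen[OF continuous_on_marginal W(1)])
    ultimately show "openin (top_of_set ?L) {\<mu> \<in> topspace (top_of_set ?L). h \<mu> \<in> U}" by simp
  qed auto
  moreover have "compactin (top_of_set ?L) ?L"
    using compact_level_flows[of a] by (simp add: compactin_subtopology)
  ultimately have "compactin weak_topology (h ` ?L)" by (rule image_compactin[rotated])
  moreover have "h ` ?L = {\<nu>. I \<nu> \<le> ereal a}"
  proof (intro equalityI subsetI)
    fix \<nu> assume "\<nu> \<in> h ` ?L"
    then obtain \<mu> where "\<mu> \<in> ?L" "\<nu> = h \<mu>" by blast
    then show "\<nu> \<in> {\<nu>. I \<nu> \<le> ereal a}" using h[of \<mu>] by (auto simp: rate_le_iff)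
  next
    fix \<nu> assume "\<nu> \<in> {\<nu>. I \<nu> \<le> ereal a}"
    then obtain \<mu> where \<mu>: "\<mu> \<in> ?L" "pmf_vec \<nu> = marginal \<mu>" by (auto simp: rate_le_iff)
    then have "\<nu> = h \<mu>" using h[OF \<mu>(1)] by (intro inj_pmf_vec) simp
    then show "\<nu> \<in> h ` ?L" using \<mu>(1) by blast
  qed
  ultimately show ?thesis by simp
qed

text \<open>Equal mass on all admissible directed steps, balanced because an edge has no
  orientation. It is the direction of perturbation in the lower bound.\<close>

definition uniform_flow :: "(nat \<Rightarrow> 'v set set) \<Rightarrow> real ^ (('v set set \<times> 'v) \<times> 'v)" where
  "uniform_flow F = (\<chi> p. of_bool (fst (fst p) \<in> F ` {1..b} \<and> {snd (fst p), snd p} \<in> fst (fst p)) /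
     real (card {p :: ('v set set \<times> 'v) \<times> 'v. fst (fst p) \<in> F ` {1..b} \<and> {snd (fst p), snd p} \<in> fst (fst p)}))"

lemma uniform_flow:
  assumes F: "F \<in> edge_sequences E x0"
  shows "uniform_flow F \<in> admissible_flows E F"
    and "k \<in> {1..b} \<Longrightarrow> {x, y} \<in> F k \<Longrightarrow> 0 < uniform_flow F $ ((F k, x), y)"
proof -
  define A where "A = {p :: ('v set set \<times> 'v) \<times> 'v. fst (fst p) \<in> F ` {1..b} \<and> {snd (fst p), snd p} \<in> fst (fst p)}"
  obtain a c where ac: "{a, c} \<in> F 1" using edge_ex[OF F, of 1] b_pos by auto
  have "F 1 \<in> F ` {1..b}" using b_pos by simp
  then have "((F 1, a), c) \<in> A" using ac unfolding A_def by simp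
  then have A: "0 < real (card A)" by (auto simp: card_gt_0_iff)
  have u: "uniform_flow F $ p = of_bool (p \<in> A) / real (card A)" for p
    unfolding uniform_flow_def A_def[symmetric] vec_lambda_beta by (simp add: A_def del: One_nat_def)
  have nth: "((S, x), y) \<in> A \<longleftrightarrow> S \<in> F ` {1..b} \<and> {x, y} \<in> S" for S x y
    by (simp add: A_def)
  have "(\<Sum>p\<in>UNIV. uniform_flow F $ p) = real (card A) / real (card A)"
    unfolding u sum_divide_distrib[symmetric] by simp
  then have "(\<Sum>p\<in>UNIV. uniform_flow F $ p) = 1" using A by (metis divide_self less_irrefl)
  moreover have "outflow (uniform_flow F) (S, x) = (\<Sum>y\<in>UNIV. uniform_flow F $ ((S, y), x))" for S x
    unfolding outflow_def u nth by (simp add: insert_commute)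
  moreover have "0 \<le> uniform_flow F $ p" for p by (simp add: u)
  moreover have "S \<in> F ` {1..b} \<and> {x, y} \<in> S" if "uniform_flow F $ ((S, x), y) \<noteq> 0" for S x y
    using that unfolding u nth by (auto simp del: One_nat_def split: if_splits)
  ultimately show "uniform_flow F \<in> admissible_flows E F"
    unfolding admissible_flows_def by blast
  show "0 < uniform_flow F $ ((F k, x), y)" if "k \<in> {1..b}" "{x, y} \<in> F k"
  proof -
    have "((F k, x), y) \<in> A" using that unfolding nth by blast
    then show ?thesis using A by (simp add: u)
  qed
qed

lemma all_flows_ne: "all_flows \<noteq> {}"
  using edge_sequences_ne uniform_flow(1) by (auto simp: all_flows_def)

lemma good_rate: "good_rate_function weak_topology I"
proof -
  obtain \<mu> where "\<mu> \<in> all_flows" using all_flows_ne by blast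
  moreover obtain \<nu> where "pmf_vec \<nu> = marginal \<mu>" using ex_pmf_marginal[OF calculation] by blast
  ultimately have "I \<nu> \<le> ereal (action K \<mu>)" by (intro rate_le_action) auto
  then have "I \<nu> \<noteq> \<infinity>" by auto
  then show ?thesis
    unfolding good_rate_function_def topspace_weak_topology
    using rate_nonneg openin_rate_gt compactin_rate_le by auto
qed

text \<open>Summing a flow over its edge sets gives a balanced flow on \<open>E\<close>, which
  disintegrates. Conversely all mass can be put into the last stage, whose edge set is
  \<open>E\<close>, and every admissible flow has finite action.\<close>

lemma rate_finite_iff: "I \<nu> < \<infinity> \<longleftrightarrow> (\<exists>q\<in>transition_kernels E. invariant_distribution \<nu> q)"
proof
  assume "I \<nu> < \<infinity>"
  then obtain \<mu> where \<mu>: "\<mu> \<in> all_flows" "marginal \<mu> = pmf_vec \<nu>" using rate_attained by blast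
  note f = all_flowsD[OF \<mu>(1)]
  let ?m = "\<lambda>x y. \<Sum>S\<in>UNIV. \<mu> $ ((S, x), y)"
  have out: "(\<Sum>y\<in>UNIV. ?m x y) = pmf \<nu> x" for x
  proof -
    have "(\<Sum>y\<in>UNIV. ?m x y) = (\<Sum>S\<in>UNIV. outflow \<mu> (S, x))"
      unfolding outflow_def by (rule sum.swap)
    also have "\<dots> = marginal \<mu> $ x" by (simp add: marginal_def)
    finally show ?thesis by (simp add: \<mu>(2) pmf_vec_def)
  qed
  have "\<exists>N q. q \<in> transition_kernels E \<and> set_pmf N \<subseteq> \<Union>E \<and> invariant_distribution N q \<and>
      (\<forall>x y. 1 * (pmf N x * pmf (q x) y) = ?m x y)"
  proof (rule balanced_flow_kernel)
    show "\<And>e. e \<in> E \<Longrightarrow> card e = 2" using simple by (simp add: simple_graph_def)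
    show "0 \<le> ?m x y" for x y by (intro sum_nonneg f(1))
    show "{x, y} \<in> E" if "?m x y \<noteq> 0" for x y
    proof -
      obtain S where "\<mu> $ ((S, x), y) \<noteq> 0" using \<open>?m x y \<noteq> 0\<close> by (meson sum.neutral)
      then show ?thesis using f(3) by blast
    qed
    show "(\<Sum>y\<in>UNIV. ?m x y) = (\<Sum>y\<in>UNIV. ?m y x)" for x
    proof -
      have "(\<Sum>y\<in>UNIV. ?m x y) = (\<Sum>S\<in>UNIV. outflow \<mu> (S, x))"
        unfolding outflow_def by (rule sum.swap)
      also have "\<dots> = (\<Sum>y\<in>UNIV. ?m y x)" unfolding f(4) by (rule sum.swap)
      finally show ?thesis .
    qed
    show "1 = (\<Sum>x\<in>UNIV. \<Sum>y\<in>UNIV. ?m x y)" by (simp add: out sum_pmf_UNIV)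
  qed simp
  then obtain N q where q: "q \<in> transition_kernels E" "invariant_distribution N q"
    "\<And>x y. pmf N x * pmf (q x) y = ?m x y" by auto
  have "pmf N x = pmf \<nu> x" for x
  proof -
    have "pmf N x = (\<Sum>y\<in>UNIV. pmf N x * pmf (q x) y)"
      by (simp add: sum_pmf_UNIV flip: sum_distrib_left)
    then show ?thesis by (simp only: q(3) out)
  qed
  then have "N = \<nu>" by (rule pmf_eqI)
  then show "\<exists>q\<in>transition_kernels E. invariant_distribution \<nu> q" using q by blast
next
  assume "\<exists>q\<in>transition_kernels E. invariant_distribution \<nu> q"
  then obtain q where q: "q \<in> transition_kernels E" "invariant_distribution \<nu> q" by blast
  obtain F where F: "F \<in> edge_sequences E x0" using edge_sequences_ne by blast
  have "F b = E" using edge_sequenceD[OF F, of b] b_pos by (intro card_subset_eq) auto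
  define \<mu> where "\<mu> = (\<chi> p. of_bool (fst (fst p) = E) * (pmf \<nu> (snd (fst p)) * pmf (q (snd (fst p))) (snd p)))"
  have nth: "\<mu> $ ((S, x), y) = of_bool (S = E) * (pmf \<nu> x * pmf (q x) y)" for S x y
    by (simp add: \<mu>_def)
  have out: "outflow \<mu> (S, x) = of_bool (S = E) * pmf \<nu> x" for S x
    by (simp add: outflow_def nth sum_pmf_UNIV flip: sum_distrib_left)
  have marg: "marginal \<mu> = pmf_vec \<nu>"
    by (simp add: vec_eq_iff marginal_def out pmf_vec_def)
  have "(\<Sum>p\<in>UNIV. \<mu> $ p) = 1"
    by (simp add: marg pmf_vec_def sum_pmf_UNIV flip: marginal_total)
  moreover have "S \<in> F ` {1..b} \<and> {x, y} \<in> S" if nz: "\<mu> $ ((S, x), y) \<noteq> 0" for S x y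
  proof -
    have S: "S = E" using nz by (auto simp: nth)
    have "pmf (q x) y \<noteq> 0" using nz by (auto simp: nth)
    then have "0 < pmf (q x) y" by (simp add: less_le)
    then have "{x, y} \<in> E" using q(1) Union_E unfolding transition_kernels_def by blast
    moreover have "b \<in> {1..b}" using b_pos by simp
    ultimately show ?thesis using S \<open>F b = E\<close> by blast
  qed
  moreover have "outflow \<mu> (S, x) = (\<Sum>y\<in>UNIV. \<mu> $ ((S, y), x))" for S x
    using q(2) by (simp add: out nth invariant_distribution_iff flip: sum_distrib_left)
  moreover have "0 \<le> \<mu> $ p" for p by (simp add: \<mu>_def)
  ultimately have "\<mu> \<in> admissible_flows E F" unfolding admissible_flows_def by blast
  then have "\<mu> \<in> all_flows" using F by (auto simp: all_flows_def)
  then have "I \<nu> \<le> ereal (action K \<mu>)" using marg by (rule rate_le_action)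
  then show "I \<nu> < \<infinity>" by auto
qed

end

section \<open>The law of the walk\<close>

locale walk = once_reinforced E x0 \<delta>
  for E :: "'v::finite set set" and x0 :: 'v and \<delta> :: real +
  fixes M :: "'w measure" and X :: "nat \<Rightarrow> 'w \<Rightarrow> 'v"
  assumes walk: "once_reinforced_walk E \<delta> x0 M X"
begin

sublocale prob_space M
  using walk by (simp add: once_reinforced_walk_def)

lemma X_measurable [measurable]: "X n \<in> measurable M (count_space UNIV)"
  and X_0: "AE \<omega> in M. X 0 \<omega> = x0"
  and X_step: "AE \<omega> in M.
        real_cond_exp M (history_algebra M X n) (indicator {\<omega>'\<in>space M. X (Suc n) \<omega>' = u}) \<omega> =
        step_prob E \<delta> (traversed_edges X n \<omega>) (X n \<omega>) u"
  using walk unfolding once_reinforced_walk_def by blast+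

text \<open>\<open>X 0\<close> is left out because it belongs to the initial state. The n steps then
  depart from \<open>X 0\<close>, ..., \<open>X (n - 1)\<close>, the vertices counted by the
  empirical measure.\<close>

definition trajectory :: "nat \<Rightarrow> 'w \<Rightarrow> 'v list" where
  "trajectory n \<omega> = map (\<lambda>i. X (Suc i) \<omega>) [0..<n]"

lemma length_trajectory [simp]: "length (trajectory n \<omega>) = n"
  by (simp add: trajectory_def)

lemma trajectory_state:
  assumes "X 0 \<omega> = x0"
  shows "foldl orrw_next ({}, x0) (trajectory n \<omega>) = (traversed_edges X n \<omega>, X n \<omega>)"
proof (induction n)
  case 0
  then show ?case using assms by (simp add: trajectory_def traversed_edges_def)
next
  case (Suc n)
  have "traversed_edges X (Suc n) \<omega> = insert {X n \<omega>, X (Suc n) \<omega>} (traversed_edges X n \<omega>)"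
    by (auto simp: traversed_edges_def less_Suc_eq)
  then show ?case using Suc by (simp add: trajectory_def orrw_next_def)
qed

definition path_event :: "'v list \<Rightarrow> 'w set" where
  "path_event ys = {\<omega>\<in>space M. X 0 \<omega> = x0 \<and> trajectory (length ys) \<omega> = ys}"

lemma sets_history_subset: "{X i -` A \<inter> space M | i A. i \<le> n} \<subseteq> sets M"
  by (auto intro: measurable_sets[OF X_measurable])

lemma history_subalgebra: "subalgebra M (history_algebra M X n)"
proof -
  have "sigma_sets (space M) {X i -` A \<inter> space M | i A. i \<le> n} \<subseteq> sets M"
    by (rule sets.sigma_sets_subset[OF sets_history_subset])
  then show ?thesis
    unfolding subalgebra_def history_algebra_def
    by (subst sets_measure_of) (auto simp: space_measure_of_conv)
qed

lemma history_set:
  assumes "i \<le> n"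
  shows "{\<omega>\<in>space M. X i \<omega> = c} \<in> sets (history_algebra M X n)"
proof -
  have "{\<omega>\<in>space M. X i \<omega> = c} = X i -` {c} \<inter> space M" by auto
  then have "{\<omega>\<in>space M. X i \<omega> = c} \<in> {X i -` A \<inter> space M | i A. i \<le> n}" using assms by blast
  then show ?thesis
    unfolding history_algebra_def by (subst sets_measure_of) auto
qed

lemma path_event_history: "path_event ys \<in> sets (history_algebra M X (length ys))"
proof -
  let ?F = "history_algebra M X (length ys)"
  have sp: "space ?F = space M" using history_subalgebra[of "length ys"] by (simp add: subalgebra_def)
  have "path_event ys = {\<omega>\<in>space M. \<forall>i\<in>{..length ys}. X i \<omega> = (x0 # ys) ! i}"
  proof (intro set_eqI iffI)
    fix \<omega> assume "\<omega> \<in> path_event ys"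
    then have \<omega>: "\<omega> \<in> space M" "X 0 \<omega> = x0" and t: "trajectory (length ys) \<omega> = ys"
      by (auto simp: path_event_def)
    have "X i \<omega> = (x0 # ys) ! i" if i: "i \<le> length ys" for i
    proof (cases i)
      case (Suc j)
      have "trajectory (length ys) \<omega> ! j = X (Suc j) \<omega>" using i Suc by (simp add: trajectory_def)
      then show ?thesis using Suc t by simp
    qed (use \<omega> in simp)
    then show "\<omega> \<in> {\<omega>\<in>space M. \<forall>i\<in>{..length ys}. X i \<omega> = (x0 # ys) ! i}" using \<omega>(1) by simp
  next
    fix \<omega> assume \<omega>: "\<omega> \<in> {\<omega>\<in>space M. \<forall>i\<in>{..length ys}. X i \<omega> = (x0 # ys) ! i}"
    then have "X 0 \<omega> = x0" by (auto dest: bspec[of _ _ 0])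
    moreover have "trajectory (length ys) \<omega> = ys"
    proof (rule nth_equalityI)
      fix j assume "j < length (trajectory (length ys) \<omega>)"
      then have j: "j < length ys" by simp
      then have "Suc j \<in> {..length ys}" by simp
      then have "X (Suc j) \<omega> = (x0 # ys) ! Suc j" using \<omega> by blast
      then show "trajectory (length ys) \<omega> ! j = ys ! j" using j by (simp add: trajectory_def)
    qed simp
    ultimately show "\<omega> \<in> path_event ys" using \<omega> by (simp add: path_event_def)
  qed
  also have "\<dots> \<in> sets ?F"
    unfolding sp[symmetric]
    by (rule sets.sets_Collect_finite_All') (use history_set[of _ "length ys"] sp in auto)
  finally show ?thesis .
qed

lemma path_event_sets [measurable]: "path_event ys \<in> sets M"
  using path_event_history[of ys] history_subalgebra[of "length ys"] by (auto simp: subalgebra_def)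

text \<open>Induction on the last letter: the event of the prefix belongs to the history, and on it
  the traversed edges and the position are fixed, so the conditional probability is the constant
  \<open>K s y\<close> there.\<close>

lemma prob_path_event: "prob (path_event ys) = path_weight orrw_next K ({}, x0) ys"
proof (induction ys rule: rev_induct)
  case Nil
  have "AE \<omega> in M. \<omega> \<in> path_event []"
    using X_0 AE_space by eventually_elim (simp add: path_event_def trajectory_def)
  then show ?case by (simp add: prob_eq_1)
next
  case (snoc y ys)
  define n where "n = length ys"
  let ?F = "history_algebra M X n" and ?A = "path_event ys"
  let ?B = "{\<omega>\<in>space M. X (Suc n) \<omega> = y}"
  define s where "s = foldl orrw_next ({}, x0) ys"
  interpret finite_measure_subalgebra M ?F
    by unfold_locales (rule history_subalgebra)
  have A: "?A \<in> sets ?F" unfolding n_def by (rule path_event_history)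
  have B: "?B \<in> sets M" by measurable
  have "path_event (ys @ [y]) = ?A \<inter> ?B"
    by (auto simp: path_event_def trajectory_def n_def)
  then have "prob (path_event (ys @ [y])) = (\<integral>\<omega>. indicator (?A \<inter> ?B) \<omega> \<partial>M)"
    by simp
  also have "\<dots> = (\<integral>\<omega>\<in>?A. indicator ?B \<omega> \<partial>M)"
    unfolding set_lebesgue_integral_def
    by (rule Bochner_Integration.integral_cong) (auto simp: indicator_def)
  also have "\<dots> = (\<integral>\<omega>\<in>?A. real_cond_exp M ?F (indicator ?B) \<omega> \<partial>M)"
    by (rule real_cond_exp_intA[OF _ A]) (use B in \<open>simp add: emeasure_eq_measure\<close>)
  also have "\<dots> = (\<integral>\<omega>. indicator ?A \<omega> * K s y \<partial>M)"
    unfolding set_lebesgue_integral_def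
  proof (rule integral_cong_AE)
    show "(\<lambda>\<omega>. indicator ?A \<omega> *\<^sub>R real_cond_exp M ?F (indicator ?B) \<omega>) \<in> borel_measurable M"
      using borel_measurable_cond_exp2 by measurable
    show "(\<lambda>\<omega>. indicator ?A \<omega> * K s y) \<in> borel_measurable M" by measurable
    show "AE \<omega> in M. indicator ?A \<omega> *\<^sub>R real_cond_exp M ?F (indicator ?B) \<omega> = indicator ?A \<omega> * K s y"
      using X_step[of n y]
    proof eventually_elim
      case (elim \<omega>)
      show ?case
      proof (cases "\<omega> \<in> ?A")
        case True
        then have "X 0 \<omega> = x0" "trajectory n \<omega> = ys" by (auto simp: path_event_def n_def)
        then have "s = (traversed_edges X n \<omega>, X n \<omega>)"
          using trajectory_state[of \<omega> n] by (simp add: s_def)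
        then show ?thesis using elim True by (simp add: orrw_kernel_def)
      qed simp
    qed
  qed
  also have "\<dots> = prob ?A * K s y" by simp
  finally show ?case using snoc by (simp add: path_weight_append s_def)
qed

text \<open>The walk departs once from every visited position except the final one, which
  \<open>take\<close> removes.\<close>

lemma step_count_vertex:
  fixes v :: 'v
  shows "(\<Sum>S\<in>UNIV. \<Sum>y\<in>UNIV. step_count orrw_next (T, v) ys ((S, x), y)) = count_list (take (length ys) (v # ys)) x"
proof (induction ys arbitrary: T v)
  case (Cons a ys)
  have "(\<Sum>S\<in>UNIV. \<Sum>y\<in>UNIV. of_bool (((S, x), y) = ((T, v), a)))
      = (\<Sum>S\<in>UNIV. if S = T then \<Sum>y\<in>UNIV. if y = a then of_bool (x = v) else 0 else (0::nat))"
    by (intro sum.cong refl) (auto intro!: sum.cong)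
  then have "(\<Sum>S\<in>UNIV. \<Sum>y\<in>UNIV. of_bool (((S, x), y) = ((T, v), a))) = (of_bool (x = v) :: nat)"
    by simp
  then show ?case
    using Cons[of "insert {v, a} T" a] by (simp add: orrw_next_def sum.distrib)
qed simp

lemma empirical_measure_trajectory:
  assumes n: "n \<ge> 1" and x: "X 0 \<omega> = x0"
  shows "pmf_vec (empirical_measure X n \<omega>) = marginal (step_freq orrw_next ({}, x0) (trajectory n \<omega>))"
proof (simp only: vec_eq_iff, intro allI)
  fix z :: 'v
  have "x0 # trajectory n \<omega> = map (\<lambda>i. X i \<omega>) [0..<Suc n]"
    unfolding upt_conv_Cons[OF zero_less_Suc] map_Suc_upt[symmetric]
    by (simp add: trajectory_def x)
  then have "take n (x0 # trajectory n \<omega>) = map (\<lambda>i. X i \<omega>) [0..<n]"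
    by (simp add: take_map)
  moreover have "real (count_list (map g [0..<m]) z) = (\<Sum>i<m. of_bool (g i = z))" for g and m :: nat
    by (induction m) auto
  ultimately have c: "real (count_list (take n (x0 # trajectory n \<omega>)) z) = (\<Sum>i<n. of_bool (X i \<omega> = z))"
    by simp
  have "marginal (step_freq orrw_next ({}, x0) (trajectory n \<omega>)) $ z
      = real (\<Sum>S\<in>UNIV. \<Sum>y\<in>UNIV. step_count orrw_next ({}, x0) (trajectory n \<omega>) ((S, z), y)) / real n"
    by (simp add: marginal_def outflow_def step_freq_def sum_divide_distrib)
  also have "\<dots> = (\<Sum>i<n. of_bool (X i \<omega> = z)) / real n"
    unfolding step_count_vertex length_trajectory c ..
  also have "\<dots> = pmf (empirical_measure X n \<omega>) z"
    unfolding pmf_empirical_measure[OF n]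
    by (simp add: sum_divide_distrib indicator_def of_bool_def if_distrib cong: if_cong)
  finally show "pmf_vec (empirical_measure X n \<omega>) $ z
      = marginal (step_freq orrw_next ({}, x0) (trajectory n \<omega>)) $ z"
    by (simp add: pmf_vec_def)
qed

lemma empirical_event_sets:
  assumes "n \<ge> 1"
  shows "{\<omega>\<in>space M. empirical_measure X n \<omega> \<in> C} \<in> sets M"
proof -
  let ?l = "\<lambda>\<omega>. map (\<lambda>i. X i \<omega>) [0..<n]"
  let ?e = "\<lambda>zs. map_pmf (\<lambda>i. zs ! i) (pmf_of_set {..<n}) :: 'v pmf"
  have e: "empirical_measure X n \<omega> = ?e (?l \<omega>)" for \<omega>
    unfolding empirical_measure_def using assms by (intro map_pmf_cong) (auto simp: lessThan_empty_iff)
    have "{\<omega>\<in>space M. empirical_measure X n \<omega> \<in> C}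
        = (\<Union>zs\<in>{zs\<in>paths n. ?e zs \<in> C}. {\<omega>\<in>space M. \<forall>i<n. X i \<omega> = zs ! i})"
    proof (intro set_eqI iffI)
      fix \<omega> assume "\<omega> \<in> {\<omega>\<in>space M. empirical_measure X n \<omega> \<in> C}"
      then show "\<omega> \<in> (\<Union>zs\<in>{zs\<in>paths n. ?e zs \<in> C}. {\<omega>\<in>space M. \<forall>i<n. X i \<omega> = zs ! i})"
        using e[of \<omega>] by (intro UN_I[of "?l \<omega>"]) (auto simp: paths_def)
    next
      fix \<omega> assume "\<omega> \<in> (\<Union>zs\<in>{zs\<in>paths n. ?e zs \<in> C}. {\<omega>\<in>space M. \<forall>i<n. X i \<omega> = zs ! i})"
      then obtain zs where zs: "length zs = n" "?e zs \<in> C" "\<omega> \<in> space M" "\<forall>i<n. X i \<omega> = zs ! i"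
        by (auto simp: paths_def)
      then have "zs = ?l \<omega>" by (intro nth_equalityI) auto
      then show "\<omega> \<in> {\<omega>\<in>space M. empirical_measure X n \<omega> \<in> C}" using zs e[of \<omega>] by simp
    qed
    also have "\<dots> \<in> sets M" by (intro sets.finite_UN) auto
    finally show ?thesis .
qed

lemma prob_empirical_event:
  assumes n: "n \<ge> 1"
  shows "prob {\<omega>\<in>space M. empirical_measure X n \<omega> \<in> pmf_vec -` D}
    = (\<Sum>ys\<in>{ys\<in>paths n. step_freq orrw_next ({}, x0) ys \<in> marginal -` D}. path_weight orrw_next K ({}, x0) ys)"
proof -
  let ?P = "{ys\<in>paths n. step_freq orrw_next ({}, x0) ys \<in> marginal -` D}"
  have "prob {\<omega>\<in>space M. empirical_measure X n \<omega> \<in> pmf_vec -` D} = prob (\<Union>ys\<in>?P. path_event ys)"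
  \<comment> \<open>The start at \<open>x0\<close> is only almost sure, so the two events agree up
    to a null set.\<close>
  proof (rule measure_eq_AE)
    show "AE \<omega> in M. (\<omega> \<in> {\<omega>\<in>space M. empirical_measure X n \<omega> \<in> pmf_vec -` D}) = (\<omega> \<in> (\<Union>ys\<in>?P. path_event ys))"
      using X_0 AE_space
    proof eventually_elim
      case (elim \<omega>)
      have "\<omega> \<in> (\<Union>ys\<in>?P. path_event ys) \<longleftrightarrow> trajectory n \<omega> \<in> ?P"
        using elim by (auto simp: path_event_def paths_def)
      also have "\<dots> \<longleftrightarrow> pmf_vec (empirical_measure X n \<omega>) \<in> D"
        by (simp add: paths_def empirical_measure_trajectory[OF n elim(1)])
      finally show ?case using elim by simp
    qed
    show "{\<omega>\<in>space M. empirical_measure X n \<omega> \<in> pmf_vec -` D} \<in> sets M" by (rule empirical_event_sets[OF n])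
    show "(\<Union>ys\<in>?P. path_event ys) \<in> sets M" by (intro sets.finite_UN path_event_sets) auto
  qed
  also have "\<dots> = (\<Sum>ys\<in>?P. prob (path_event ys))"
  proof (rule finite_measure_finite_Union)
    show "path_event ` ?P \<subseteq> sets M" using path_event_sets by blast
    show "disjoint_family_on path_event ?P"
      by (auto simp: disjoint_family_on_def path_event_def paths_def)
  qed simp
  finally show ?thesis by (simp only: prob_path_event)
qed

section \<open>The large deviation principle\<close>

lemma upper_bound:
  assumes C: "closedin weak_topology C"
  shows "limsup (\<lambda>n. ereal (1 / real n) * log_prob (prob {\<omega>\<in>space M. empirical_measure X n \<omega> \<in> C}))
    \<le> - (INF \<nu>\<in>C. I \<nu>)"
proof (rule ccontr)
  let ?L = "\<lambda>n. ereal (1 / real n) * log_prob (prob {\<omega>\<in>space M. empirical_measure X n \<omega> \<in> C})"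
  assume "\<not> limsup ?L \<le> - (INF \<nu>\<in>C. I \<nu>)"
  \<comment> \<open>A real number strictly in between avoids cases for infinite infima;
    \<open>- z\<close> is the rate handed to \<open>path_sum_decay\<close>.\<close>
  then obtain z where z: "- (INF \<nu>\<in>C. I \<nu>) < ereal z" "ereal z < limsup ?L"
    using ereal_dense2 by (meson not_le)
  have "- ereal z < (INF \<nu>\<in>C. I \<nu>)" by (rule ereal_uminus_less_reorder[THEN iffD1, OF z(1)])
  then have c: "ereal (- z) < I \<nu>" if "\<nu> \<in> C" for \<nu>
    using that by (simp add: less_INF_D)
  obtain D where D: "closed D" "C = pmf_vec -` D" using closedin_weak_topology[OF C] by blast
  have "\<exists>c'>-z. \<forall>\<^sub>F n in sequentially.
    (\<Sum>ys\<in>{ys\<in>paths n. step_freq orrw_next ({}, x0) ys \<in> marginal -` D}. path_weight orrw_next K ({}, x0) ys)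
      \<le> exp (- (real n * c'))"
  proof (rule path_sum_decay[OF kernel_nonneg])
    show "closed (marginal -` D :: (real ^ (('v set set \<times> 'v) \<times> 'v)) set)"
      by (rule closed_vimage[OF D(1) continuous_on_marginal])
    fix \<mu> :: "real ^ (('v set set \<times> 'v) \<times> 'v)"
    assume "\<mu> \<in> marginal -` D" "limit_flow orrw_next K ({}, x0) \<mu>"
    then have \<mu>: "\<mu> \<in> all_flows" "marginal \<mu> \<in> D"
      using limit_flow_admissible by (auto simp: all_flows_def)
    then obtain \<nu> where \<nu>: "pmf_vec \<nu> = marginal \<mu>" using ex_pmf_marginal by blast
    then have "ereal (- z) < I \<nu>" using \<mu>(2) D(2) by (intro c) auto
    also have "\<dots> \<le> ereal (action K \<mu>)" using \<mu> \<nu> by (intro rate_le_action) auto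
    finally show "- z < action K \<mu>" by simp
  qed
  then obtain c' where c': "c' > - z" and ev: "\<forall>\<^sub>F n in sequentially.
    (\<Sum>ys\<in>{ys\<in>paths n. step_freq orrw_next ({}, x0) ys \<in> marginal -` D}. path_weight orrw_next K ({}, x0) ys)
      \<le> exp (- (real n * c'))" by blast
  have "\<forall>\<^sub>F n in sequentially. ?L n \<le> ereal z"
    using ev eventually_ge_at_top[of 1]
  proof eventually_elim
    case (elim n)
    let ?p = "prob {\<omega>\<in>space M. empirical_measure X n \<omega> \<in> C}"
    have le: "?p \<le> exp (- (real n * c'))"
      using elim(1) unfolding D(2) prob_empirical_event[OF elim(2)] .
    show ?case
    proof (cases "?p = 0")
      case True
      then show ?thesis using elim(2) by (simp add: log_prob_def)
    next
      case False
      then have "0 < ?p" by (simp add: less_le)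
      then have "ln ?p \<le> - (real n * c')" using le by (metis exp_gt_zero ln_exp ln_le_cancel_iff)
      also have "\<dots> \<le> real n * z" using c' mult_left_mono[of "- c'" z "real n"] by simp
      finally show ?thesis using False elim(2) by (simp add: log_prob_def field_simps)
    qed
  qed
  then have "limsup ?L \<le> ereal z" by (rule Limsup_bounded)
  then show False using z(2) by simp
qed

lemma lower_bound:
  assumes U: "openin weak_topology U"
  shows "liminf (\<lambda>n. ereal (1 / real n) * log_prob (prob {\<omega>\<in>space M. empirical_measure X n \<omega> \<in> U}))
    \<ge> - (INF \<nu>\<in>U. I \<nu>)"
proof (rule ccontr)
  let ?L = "\<lambda>n. ereal (1 / real n) * log_prob (prob {\<omega>\<in>space M. empirical_measure X n \<omega> \<in> U})"
  assume "\<not> liminf ?L \<ge> - (INF \<nu>\<in>U. I \<nu>)"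
  then obtain z where z: "liminf ?L < ereal z" "ereal z < - (INF \<nu>\<in>U. I \<nu>)"
    using ereal_dense2 by (meson not_le)
  have "(INF \<nu>\<in>U. I \<nu>) < - ereal z" by (rule ereal_less_uminus_reorder[THEN iffD1, OF z(2)])
  then obtain \<nu> where \<nu>: "\<nu> \<in> U" "I \<nu> < - ereal z" by (auto simp: INF_less_iff)
  then have "I \<nu> < \<infinity>" by auto
  then obtain \<mu> where \<mu>: "\<mu> \<in> all_flows" "marginal \<mu> = pmf_vec \<nu>" "I \<nu> = ereal (action K \<mu>)"
    using rate_attained by blast
  obtain W where W: "open W" "U = pmf_vec -` W" using U unfolding openin_weak_topology_iff by blast
  obtain F where F: "F \<in> edge_sequences E x0" "\<mu> \<in> admissible_flows E F"
    using \<mu>(1) by (auto simp: all_flows_def)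
  have act: "action K \<mu> < - z" using \<nu>(2) \<mu>(3) by simp
  \<comment> \<open>Strictly between 0 and 1, so that every \<open>g j\<close> retains a positive
    share of \<open>uniform_flow F\<close>. Both flows belong to the same \<open>F\<close>, hence so
    do their mixtures.\<close>
  define t where "t j = 1 / (real j + 2)" for j
  define g where "g j = (1 - t j) *\<^sub>R \<mu> + t j *\<^sub>R uniform_flow F" for j
  have "t \<longlonglongrightarrow> 0" unfolding t_def by real_asymp
  then have "g \<longlonglongrightarrow> (1 - 0) *\<^sub>R \<mu> + 0 *\<^sub>R uniform_flow F"
    unfolding g_def by (intro tendsto_intros)
  then have lim: "g \<longlonglongrightarrow> \<mu>" by simp
  have "isCont (action K) \<mu>"
    using continuous_on_action[of UNIV K] by (simp add: continuous_on_eq_continuous_at)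
  then have "(\<lambda>j. action K (g j)) \<longlonglongrightarrow> action K \<mu>" using lim by (rule isCont_tendsto_compose)
  then have ev1: "\<forall>\<^sub>F j in sequentially. action K (g j) < - z" using act by (rule order_tendstoD)
  have op: "open (marginal -` W :: (real ^ (('v set set \<times> 'v) \<times> 'v)) set)"
    by (rule open_vimage[OF W(1) continuous_on_marginal])
  have "\<mu> \<in> marginal -` W" using \<mu>(2) \<nu>(1) W(2) by simp
  then have "\<forall>\<^sub>F j in sequentially. g j \<in> marginal -` W" by (rule topological_tendstoD[OF lim op])
  then have "\<forall>\<^sub>F j in sequentially. action K (g j) < - z \<and> g j \<in> marginal -` W"
    using ev1 by eventually_elim simp
  then obtain j where j: "action K (g j) < - z" "g j \<in> marginal -` W"
    unfolding eventually_sequentially by blast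
  have tj: "0 < t j" "t j < 1" by (auto simp: t_def field_simps)
  note u = uniform_flow[OF F(1)]
  interpret positive_flow E x0 \<delta> F "g j"
  proof unfold_locales
    show "F \<in> edge_sequences E x0" by (rule F)
    show "g j \<in> admissible_flows E F"
      unfolding admissible_flows_def
    proof (intro CollectI conjI allI impI)
      show "0 \<le> g j $ p" for p
      proof -
        have "0 \<le> \<mu> $ p" "0 \<le> uniform_flow F $ p"
          using F(2) u(1) unfolding admissible_flows_def by blast+
        then show ?thesis using tj by (simp add: g_def)
      qed
      show "(\<Sum>p\<in>UNIV. g j $ p) = 1"
        using F(2) u(1) by (simp add: g_def admissible_flows_def sum.distrib flip: sum_distrib_left)
      fix S x y
      assume "g j $ ((S, x), y) \<noteq> 0"
      then have "\<mu> $ ((S, x), y) \<noteq> 0 \<or> uniform_flow F $ ((S, x), y) \<noteq> 0" by (auto simp: g_def)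
      then show "S \<in> F ` {1..b}" "{x, y} \<in> S" using F(2) u(1) unfolding admissible_flows_def by blast+
    next
      fix S x
      have "outflow \<mu> (S, x) = (\<Sum>y\<in>UNIV. \<mu> $ ((S, y), x))"
        "outflow (uniform_flow F) (S, x) = (\<Sum>y\<in>UNIV. uniform_flow F $ ((S, y), x))"
        using F(2) u(1) unfolding admissible_flows_def by blast+
      moreover have "outflow (g j) (S, x) = (1 - t j) * outflow \<mu> (S, x) + t j * outflow (uniform_flow F) (S, x)"
        by (simp add: outflow_def g_def sum.distrib sum_distrib_left)
      ultimately show "outflow (g j) (S, x) = (\<Sum>y\<in>UNIV. g j $ ((S, y), x))"
        by (simp add: g_def sum.distrib sum_distrib_left)
    qed
    fix k x y assume "k \<in> {1..b}" "{x, y} \<in> F k"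
    then have "0 < uniform_flow F $ ((F k, x), y)" by (rule u(2))
    moreover have "0 \<le> \<mu> $ ((F k, x), y)" using F(2) by (simp add: admissible_flows_def)
    ultimately show "0 < g j $ ((F k, x), y)" using tj by (simp add: g_def add_nonneg_pos)
  qed
  obtain e where e: "e > 0" "ball (g j) e \<subseteq> marginal -` W" using op j(2) open_contains_ball by blast
  define d where "d = real (CARD(('v set set \<times> 'v) \<times> 'v))"
  have d: "0 < d" by (simp add: d_def card_gt_0_iff)
  \<comment> \<open>The norm is at most the sum of \<open>d\<close> coordinate errors, so the first
    bound keeps step frequencies inside the ball; the second keeps the exponent at most
    \<open>- z\<close>.\<close>
  define \<epsilon> where "\<epsilon> = min (e / (2 * d)) (- z - action K (g j))"
  have \<epsilon>: "0 < \<epsilon>" "\<epsilon> * d < e" "action K (g j) + \<epsilon> \<le> - z"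
  proof -
    show "0 < \<epsilon>" using e d j(1) by (simp add: \<epsilon>_def)
    have "\<epsilon> * d \<le> e / (2 * d) * d" using d by (intro mult_right_mono) (auto simp: \<epsilon>_def)
    also have "\<dots> < e" using e d by simp
    finally show "\<epsilon> * d < e" .
    show "action K (g j) + \<epsilon> \<le> - z" by (simp add: \<epsilon>_def min_def)
  qed
  have near: "step_freq orrw_next ({}, x0) ys \<in> marginal -` W"
    if ys: "n \<ge> 1" "ys \<in> paths n"
      "\<forall>p. \<bar>real (step_count orrw_next ({}, x0) ys p) - real n * g j $ p\<bar> \<le> \<epsilon> * real n" for ys n
  proof -
    let ?v = "step_freq orrw_next ({}, x0) ys - g j"
    have comp: "\<bar>?v $ p\<bar> \<le> \<epsilon>" for p
    proof -
      have "real (step_count orrw_next ({}, x0) ys p) - real n * g j $ p = real n * ?v $ p"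
        using ys(1,2) by (simp add: step_freq_def paths_def field_simps)
      then have "real n * \<bar>?v $ p\<bar> \<le> real n * \<epsilon>"
        using ys(3) by (metis abs_mult abs_of_nat mult.commute)
      then show ?thesis using ys(1) by simp
    qed
    have "norm ?v \<le> (\<Sum>p\<in>UNIV. \<bar>?v $ p\<bar>)" by (rule norm_le_l1_cart)
    also have "\<dots> \<le> (\<Sum>p\<in>(UNIV :: (('v set set \<times> 'v) \<times> 'v) set). \<epsilon>)" by (intro sum_mono comp)
    also have "\<dots> = \<epsilon> * d" by (simp add: d_def)
    finally have "dist (g j) (step_freq orrw_next ({}, x0) ys) < e"
      using \<epsilon>(2) by (simp add: dist_norm norm_minus_commute)
    then show ?thesis using e(2) by (auto simp: subset_iff)
  qed
  obtain \<eta> where \<eta>: "\<eta> > 0" and ev: "\<forall>\<^sub>F n in sequentially. \<forall>m.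
     \<bar>real m - real n * 1\<bar> \<le> \<eta> * real n \<longrightarrow>
     exp (- (real n * (action K (g j) + \<epsilon>))) \<le>
     (\<Sum>ys\<in>{ys\<in>paths m. \<forall>p. \<bar>real (step_count orrw_next ({}, x0) ys p) - real n * g j $ p\<bar> \<le> \<epsilon> * real n}.
       path_weight orrw_next K ({}, x0) ys)"
    using lower_rate_flow \<epsilon>(1) unfolding lower_rate_def by blast
  have "\<forall>\<^sub>F n in sequentially. ereal z \<le> ?L n"
    using ev eventually_ge_at_top[of 1]
  proof eventually_elim
    case (elim n)
    let ?p = "prob {\<omega>\<in>space M. empirical_measure X n \<omega> \<in> U}"
    \<comment> \<open>The number of steps is now exactly n; the tolerance served the concatenation
      of stages.\<close>
    have "exp (- (real n * (action K (g j) + \<epsilon>))) \<le>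
     (\<Sum>ys\<in>{ys\<in>paths n. \<forall>p. \<bar>real (step_count orrw_next ({}, x0) ys p) - real n * g j $ p\<bar> \<le> \<epsilon> * real n}.
       path_weight orrw_next K ({}, x0) ys)"
      using elim(1)[rule_format, of n] \<eta> by simp
    also have "\<dots> \<le> ?p"
      unfolding W(2) prob_empirical_event[OF elim(2)]
      using near[OF elim(2)] by (intro sum_mono2) (auto intro: path_weight_nonneg kernel_nonneg)
    finally have le: "exp (- (real n * (action K (g j) + \<epsilon>))) \<le> ?p" .
    then have p: "0 < ?p" using exp_gt_zero by (rule less_le_trans[rotated])
    have "real n * z \<le> - (real n * (action K (g j) + \<epsilon>))"
      using mult_left_mono[OF \<epsilon>(3), of "real n"] by simp
    also have "\<dots> \<le> ln ?p" using le p by (metis exp_gt_zero ln_exp ln_le_cancel_iff)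
    finally show ?case using p elim(2) by (simp add: log_prob_def field_simps)
  qed
  then have "ereal z \<le> liminf ?L" by (rule Liminf_bounded)
  then show False using z(1) by simp
qed

lemma ldp: "large_deviation_principle M weak_topology (empirical_measure X) I"
  unfolding large_deviation_principle_def using upper_bound lower_bound by blast

end

theorem theorem2p6:
  fixes E :: "'v::finite set set" and x0 :: 'v and \<delta> :: real
  assumes "simple_graph E" and "connected_graph E" and "CARD('v) \<ge> 3" and "\<delta> > 0"
  shows "good_rate_function weak_topology (orrw_rate E \<delta> x0) \<and>
    (\<forall>(M :: 'w measure) X. once_reinforced_walk E \<delta> x0 M X \<longrightarrow>
       large_deviation_principle M weak_topology (empirical_measure X) (orrw_rate E \<delta> x0)) \<and>
    (\<forall>\<nu> :: 'v pmf. orrw_rate E \<delta> x0 \<nu> < \<infinity> \<longleftrightarrow>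
       (\<exists>q\<in>transition_kernels E. invariant_distribution \<nu> q))"
proof -
  interpret once_reinforced E x0 \<delta> using assms by unfold_locales
  have "large_deviation_principle M weak_topology (empirical_measure X) (orrw_rate E \<delta> x0)"
    if "once_reinforced_walk E \<delta> x0 M X" for M :: "'w measure" and X
  proof -
    interpret walk E x0 \<delta> M X using that by unfold_locales
    show ?thesis by (rule ldp)
  qed
  then show ?thesis using good_rate rate_finite_iff by blast
qed

end
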